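(* Let $\mathbb T$ be $\mathbb Z$ or $\mathbb R$ and $d\in\mathbb N$. Let $X=\{X(t),t\in\mathbb T^d\}$ be a stationary random field which is max-i.d. with $\operatorname{essinf}X(t)=0$ for all $t$, or i.d. without Gaussian component. If $\mathbb T=\mathbb R$, suppose in addition that $X$ is stochastically continuous. If $(f_0^{(i)},\{T_t^{(i)}\}_{t\in\mathbb T^d})$ are two minimal flow representations of $X$ on $\sigma$-finite Borel spaces $(\Omega_i,\mathcal B_i,\mu_i)$, $i=1,2$, then there is a measure space isomorphism $\Phi:\Omega_1\to\Omega_2$ (defined modulo null sets) such that $f_0^{(1)}=f_0^{(2)}\circ\Phi$, $\mu_1$-a.e., and for all $t\in\mathbb T^d$, $$\Phi\circ T_t^{(1)}=T_t^{(2)}\circ\Phi,\quad\mu_1\text{-a.e.}$$ The isomorphism $\Phi$ is unique modulo null sets.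
   Context: $\stackrel{d}{=}$ denotes equality of finite-dimensional distributions. A real-valued process is max-i.d. (resp. i.d.) if for every $n\in\mathbb N$ it equals in distribution the pointwise maximum (resp. sum) of $n$ i.i.d. processes. "Without Gaussian component" means the Gaussian part in the L\'evy triplet of every finite-dimensional distribution vanishes. Let $(\Omega,\mathcal B,\mu)$ be $\sigma$-finite and $\Pi_\mu=\{U_i,i\in J\}$ a Poisson point process on it with intensity $\mu$; functions equal $\mu$-a.e. are identified. $\mathcal L^\vee$: measurable $f:\Omega\to\mathbb R$ with $f\ge0$ $\mu$-a.e. and $\mu\{f>a\}<\infty$ for all $a>0$; $I^\vee(f):=\sup_{i\in J}f(U_i)$ ($0$ if $\Pi_\mu$ is empty). $\mathcal L^+$: measurable $f:\Omega\to\mathbb R$ with $\int\min\{1,|f|^2\}d\mu<\infty$; $I^+(f):=\lim_{\varepsilon\to0+}\{\sum_{i\in J}f(U_i)\mathbf 1_{\{|f(U_i)|>\varepsilon\}}-\int_{\{|f|>\varepsilon\}}a(f)\,d\mu\}$ (a.s. limit), where $a(u)=u$ for $|u|\le1$ and $a(u)=\operatorname{sign}(u)$ for $|u|>1$. In the max-i.d. case, $\{f_t\}\subset\mathcal L^\vee$ is a spectral representation of $X$ if $\{X(t)\}\stackrel{d}{=}\{I^\vee(f_t)\}$; in the i.d. case, $\{f_t\}\subset\mathcal L^+$ is one if $\{X(t)\}\stackrel{d}{=}\{I^+(f_t)+c(t)\}$ for some real function $c$. A representation has full support if (ii) there is no $B\in\mathcal B$ with $\mu(B)>0$ such that for every $t$,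 $f_t=0$ $\mu$-a.e. on $B$; it is minimal if (ii) holds and (i) for every $B\in\mathcal B$ there is $A\in\sigma\{f_t,t\in\mathbb T^d\}$ with $\mu(A\Delta B)=0$. A $\sigma$-finite Borel space is a measurable space isomorphic to a complete separable metric space with its Borel $\sigma$-algebra, endowed with a $\sigma$-finite measure. A measure space isomorphism (modulo null sets) between two measure spaces is a bijection between complements of null sets, measurable with measurable inverse, preserving measure; two isomorphisms are equal modulo null sets if they agree a.e. A measure-preserving $\mathbb T^d$-action (flow) on $(\Omega,\mathcal B,\mu)$ is a family $\{T_t\}_{t\in\mathbb T^d}$ of measure space isomorphisms $T_t:\Omega\to\Omega$ such that $T_0=\mathrm{id}$ $\mu$-a.e. and $T_t\circ T_s=T_{t+s}$ $\mu$-a.e. for all $t,s$. A flow representation of $X$ on $(\Omega,\mathcal B,\mu)$ is a pair $(f_0,\{T_t\}_{t\in\mathbb T^d})$ with $\{T_t\}$ a measure-preserving flow such that $X$ has a spectral representation $\{f_t,t\in\mathbb T^d\}$ of full support with $f_t=f_0\circ T_t$ $\mu$-a.e. for every $t$; it is minimal if $\{f_t\}$ is minimal. *)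

theory Defs
  imports "HOL-Probability.Probability"
begin

section \<open>Random fields and finite-dimensional distributions\<close>

text \<open>
  The index group is the set of vectors with all coordinates in \<open>T\<close>, where \<open>T\<close> is \<open>\<int>\<close> or
  \<open>UNIV\<close>; the dimension is the cardinality of \<open>'d\<close>. Values of fields, representations and flows
  at indices outside this set are irrelevant.
\<close>

definition index_group :: "real set \<Rightarrow> (real ^ 'd::finite) set" where
  "index_group T = {t. \<forall>k. t $ k \<in> T}"

definition random_field :: "'i set \<Rightarrow> 'w measure \<Rightarrow> ('i \<Rightarrow> 'w \<Rightarrow> real) \<Rightarrow> bool" where
  "random_field G M X \<longleftrightarrow> prob_space M \<and> (\<forall>t\<in>G. X t \<in> borel_measurable M)"

definition fdd :: "'w measure \<Rightarrow> ('i \<Rightarrow> 'w \<Rightarrow> real) \<Rightarrow> 'i set \<Rightarrow> ('i \<Rightarrow> real) measure" where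
  "fdd M X I = distr M (PiM I (\<lambda>_. borel)) (\<lambda>w. \<lambda>t\<in>I. X t w)"

definition fdd_eq ::
  "'i set \<Rightarrow> 'w measure \<Rightarrow> ('i \<Rightarrow> 'w \<Rightarrow> real) \<Rightarrow> 'v measure \<Rightarrow> ('i \<Rightarrow> 'v \<Rightarrow> real) \<Rightarrow> bool" where
  "fdd_eq G M X N Y \<longleftrightarrow> (\<forall>I. finite I \<and> I \<subseteq> G \<longrightarrow> fdd M X I = fdd N Y I)"

definition stationary :: "'i::plus set \<Rightarrow> 'w measure \<Rightarrow> ('i \<Rightarrow> 'w \<Rightarrow> real) \<Rightarrow> bool" where
  "stationary G M X \<longleftrightarrow> (\<forall>h\<in>G. fdd_eq G M (\<lambda>t. X (t + h)) M X)"

definition stochastically_continuous ::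
  "'i::topological_space set \<Rightarrow> 'w measure \<Rightarrow> ('i \<Rightarrow> 'w \<Rightarrow> real) \<Rightarrow> bool" where
  "stochastically_continuous G M X \<longleftrightarrow>
     (\<forall>t\<in>G. \<forall>e>0. ((\<lambda>s. measure M {w \<in> space M. \<bar>X s w - X t w\<bar> > e}) \<longlongrightarrow> 0) (at t within G))"

definition essinf :: "'w measure \<Rightarrow> ('w \<Rightarrow> real) \<Rightarrow> ereal" where
  "essinf M Z = - esssup M (\<lambda>w. - ereal (Z w))"


section \<open>Infinite divisibility\<close>

definition iid_fields :: "'i set \<Rightarrow> 'v measure \<Rightarrow> nat \<Rightarrow> (nat \<Rightarrow> 'i \<Rightarrow> 'v \<Rightarrow> real) \<Rightarrow> bool" where
  "iid_fields G N n Y \<longleftrightarrow>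
     (\<forall>k<n. random_field G N (Y k)) \<and>
     prob_space.indep_vars N (\<lambda>_. PiM G (\<lambda>_. borel)) (\<lambda>k w. \<lambda>t\<in>G. Y k t w) {..<n} \<and>
     (\<forall>k<n. \<forall>l<n. fdd_eq G N (Y k) N (Y l))"

text \<open>
  The sample space of the i.i.d. fields may be any probability space. Taking it over
  \<open>nat \<Rightarrow> 'i \<Rightarrow> real\<close> loses nothing: \<open>n\<close> i.i.d. fields can be realised as coordinate
  processes on the \<open>n\<close>-fold power of their common path law.
\<close>

definition max_infinitely_divisible :: "'i set \<Rightarrow> 'w measure \<Rightarrow> ('i \<Rightarrow> 'w \<Rightarrow> real) \<Rightarrow> bool" where
  "max_infinitely_divisible G M X \<longleftrightarrow>
     (\<forall>n\<ge>1. \<exists>(N :: (nat \<Rightarrow> 'i \<Rightarrow> real) measure) Y.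
        iid_fields G N n Y \<and> fdd_eq G M X N (\<lambda>t w. Max ((\<lambda>k. Y k t w) ` {..<n})))"

definition infinitely_divisible :: "'i set \<Rightarrow> 'w measure \<Rightarrow> ('i \<Rightarrow> 'w \<Rightarrow> real) \<Rightarrow> bool" where
  "infinitely_divisible G M X \<longleftrightarrow>
     (\<forall>n\<ge>1. \<exists>(N :: (nat \<Rightarrow> 'i \<Rightarrow> real) measure) Y.
        iid_fields G N n Y \<and> fdd_eq G M X N (\<lambda>t w. \<Sum>k<n. Y k t w))"

definition trunc :: "real \<Rightarrow> real" where
  "trunc u = (if \<bar>u\<bar> \<le> 1 then u else sgn u)"

definition levy_measure :: "'i set \<Rightarrow> ('i \<Rightarrow> real) measure \<Rightarrow> bool" where
  "levy_measure I \<nu> \<longleftrightarrow>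
     sets \<nu> = sets (PiM I (\<lambda>_. borel)) \<and>
     emeasure \<nu> {\<lambda>t\<in>I. 0} = 0 \<and>
     (\<integral>\<^sup>+ x. ennreal (min 1 (\<Sum>t\<in>I. (x t)\<^sup>2)) \<partial>\<nu>) < \<infinity>"

text \<open>
  Levy--Khintchine form of the characteristic function of a probability law \<open>L\<close> on \<open>\<real>\<^sup>I\<close>,
  with drift \<open>b\<close>, Gaussian covariance \<open>S\<close> and Levy measure \<open>\<nu>\<close>. Truncation is coordinatewise;
  its choice only affects \<open>b\<close>.
\<close>

definition has_levy_triplet ::
  "'i set \<Rightarrow> ('i \<Rightarrow> real) measure \<Rightarrow> ('i \<Rightarrow> real) \<Rightarrow> ('i \<Rightarrow> 'i \<Rightarrow> real) \<Rightarrow> ('i \<Rightarrow> real) measure \<Rightarrow> bool"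
where
  "has_levy_triplet I L b S \<nu> \<longleftrightarrow>
     levy_measure I \<nu> \<and>
     (\<forall>s\<in>I. \<forall>t\<in>I. S s t = S t s) \<and>
     (\<forall>\<theta>. 0 \<le> (\<Sum>s\<in>I. \<Sum>t\<in>I. \<theta> s * S s t * \<theta> t)) \<and>
     (\<forall>\<theta>. (CLINT x|L. iexp (\<Sum>t\<in>I. \<theta> t * x t)) =
        exp (\<i> * complex_of_real (\<Sum>t\<in>I. \<theta> t * b t)
             - complex_of_real ((\<Sum>s\<in>I. \<Sum>t\<in>I. \<theta> s * S s t * \<theta> t) / 2)
             + (CLINT x|\<nu>. iexp (\<Sum>t\<in>I. \<theta> t * x t) - 1
                             - \<i> * complex_of_real (\<Sum>t\<in>I. \<theta> t * trunc (x t)))))"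

definition without_gaussian_component ::
  "'i set \<Rightarrow> 'w measure \<Rightarrow> ('i \<Rightarrow> 'w \<Rightarrow> real) \<Rightarrow> bool" where
  "without_gaussian_component G M X \<longleftrightarrow>
     (\<forall>I. finite I \<and> I \<subseteq> G \<longrightarrow> (\<exists>b \<nu>. has_levy_triplet I (fdd M X I) b (\<lambda>_ _. 0) \<nu>))"


section \<open>Poisson point processes and stochastic integrals\<close>

text \<open>
  A point process is a random index set \<open>J w\<close> with points \<open>U i w\<close> for \<open>i \<in> J w\<close>, so that
  points may have multiplicities. Intensities are \<open>\<sigma>\<close>-finite, hence countably many indices
  suffice. \<open>U i\<close> is only constrained where \<open>i\<close> is an index.
\<close>

definition point_count ::
  "('w \<Rightarrow> nat set) \<Rightarrow> (nat \<Rightarrow> 'w \<Rightarrow> 'a) \<Rightarrow> 'a set \<Rightarrow> 'w \<Rightarrow> ennreal" where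
  "point_count J U A w = emeasure (count_space UNIV) {i \<in> J w. U i w \<in> A}"

definition poisson_point_process ::
  "'w measure \<Rightarrow> 'a measure \<Rightarrow> ('w \<Rightarrow> nat set) \<Rightarrow> (nat \<Rightarrow> 'w \<Rightarrow> 'a) \<Rightarrow> bool" where
  "poisson_point_process P \<mu> J U \<longleftrightarrow>
     prob_space P \<and>
     (\<forall>i. {w \<in> space P. i \<in> J w} \<in> sets P) \<and>
     (\<forall>i. U i \<in> restrict_space P {w \<in> space P. i \<in> J w} \<rightarrow>\<^sub>M \<mu>) \<and>
     (\<forall>A \<in> sets \<mu>. emeasure \<mu> A < \<infinity> \<longrightarrow>
        (\<forall>k::nat. measure P {w \<in> space P. point_count J U A w = of_nat k} =
                    measure \<mu> A ^ k / fact k * exp (- measure \<mu> A))) \<and>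
     (\<forall>A \<in> sets \<mu>. emeasure \<mu> A = \<infinity> \<longrightarrow> (AE w in P. point_count J U A w = \<infinity>)) \<and>
     (\<forall>F. finite F \<and> F \<subseteq> sets \<mu> \<and> disjoint F \<longrightarrow>
        prob_space.indep_vars P (\<lambda>_. borel) (point_count J U) F)"

definition L_max :: "'a measure \<Rightarrow> ('a \<Rightarrow> real) set" where
  "L_max \<mu> = {f \<in> borel_measurable \<mu>. (AE x in \<mu>. 0 \<le> f x) \<and>
                (\<forall>a>0. emeasure \<mu> {x \<in> space \<mu>. f x > a} < \<infinity>)}"

definition L_sum :: "'a measure \<Rightarrow> ('a \<Rightarrow> real) set" where
  "L_sum \<mu> = {f \<in> borel_measurable \<mu>. (\<integral>\<^sup>+ x. ennreal (min 1 (\<bar>f x\<bar>\<^sup>2)) \<partial>\<mu>) < \<infinity>}"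

text \<open>For \<open>f \<in> L_max \<mu>\<close> the set of values is almost surely bounded above.\<close>

definition I_max :: "('w \<Rightarrow> nat set) \<Rightarrow> (nat \<Rightarrow> 'w \<Rightarrow> 'a) \<Rightarrow> ('a \<Rightarrow> real) \<Rightarrow> 'w \<Rightarrow> real" where
  "I_max J U f w = (if J w = {} then 0 else (SUP i\<in>J w. f (U i w)))"

definition compensated_sum ::
  "'a measure \<Rightarrow> ('w \<Rightarrow> nat set) \<Rightarrow> (nat \<Rightarrow> 'w \<Rightarrow> 'a) \<Rightarrow> ('a \<Rightarrow> real) \<Rightarrow> real \<Rightarrow> 'w \<Rightarrow> real" where
  "compensated_sum \<mu> J U f e w =
     (\<Sum>i\<in>{i \<in> J w. \<bar>f (U i w)\<bar> > e}. f (U i w))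
     - (LINT x:{x \<in> space \<mu>. \<bar>f x\<bar> > e}|\<mu>. trunc (f x))"

text \<open>The sum integral is an almost sure limit, so it is determined up to null sets only:
  \<open>is_I_sum\<close> says that \<open>Z\<close> is a version of it.\<close>

definition is_I_sum ::
  "'w measure \<Rightarrow> 'a measure \<Rightarrow> ('w \<Rightarrow> nat set) \<Rightarrow> (nat \<Rightarrow> 'w \<Rightarrow> 'a) \<Rightarrow> ('a \<Rightarrow> real) \<Rightarrow> ('w \<Rightarrow> real) \<Rightarrow> bool"
where
  "is_I_sum P \<mu> J U f Z \<longleftrightarrow>
     Z \<in> borel_measurable P \<and>
     (AE w in P. ((\<lambda>e. compensated_sum \<mu> J U f e w) \<longlongrightarrow> Z w) (at_right 0))"


section \<open>Spectral representations\<close>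

definition max_spectral_rep ::
  "'i set \<Rightarrow> 'v measure \<Rightarrow> ('i \<Rightarrow> 'v \<Rightarrow> real) \<Rightarrow>
   'w measure \<Rightarrow> ('w \<Rightarrow> nat set) \<Rightarrow> (nat \<Rightarrow> 'w \<Rightarrow> 'a) \<Rightarrow> 'a measure \<Rightarrow> ('i \<Rightarrow> 'a \<Rightarrow> real) \<Rightarrow> bool" where
  "max_spectral_rep G M X P J U \<mu> f \<longleftrightarrow>
     (\<forall>t\<in>G. f t \<in> L_max \<mu>) \<and> fdd_eq G M X P (\<lambda>t. I_max J U (f t))"

definition sum_spectral_rep ::
  "'i set \<Rightarrow> 'v measure \<Rightarrow> ('i \<Rightarrow> 'v \<Rightarrow> real) \<Rightarrow>
   'w measure \<Rightarrow> ('w \<Rightarrow> nat set) \<Rightarrow> (nat \<Rightarrow> 'w \<Rightarrow> 'a) \<Rightarrow> 'a measure \<Rightarrow> ('i \<Rightarrow> 'a \<Rightarrow> real) \<Rightarrow> bool" where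
  "sum_spectral_rep G M X P J U \<mu> f \<longleftrightarrow>
     (\<forall>t\<in>G. f t \<in> L_sum \<mu>) \<and>
     (\<exists>Z c. (\<forall>t\<in>G. is_I_sum P \<mu> J U (f t) (Z t)) \<and>
            fdd_eq G M X P (\<lambda>t w. Z t w + c t))"

definition full_support :: "'i set \<Rightarrow> 'a measure \<Rightarrow> ('i \<Rightarrow> 'a \<Rightarrow> real) \<Rightarrow> bool" where
  "full_support G \<mu> f \<longleftrightarrow>
     \<not> (\<exists>B\<in>sets \<mu>. emeasure \<mu> B > 0 \<and> (\<forall>t\<in>G. AE x in \<mu>. x \<in> B \<longrightarrow> f t x = 0))"

definition generated_sigma :: "'i set \<Rightarrow> 'a measure \<Rightarrow> ('i \<Rightarrow> 'a \<Rightarrow> real) \<Rightarrow> 'a set set" where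
  "generated_sigma G \<mu> f = sigma_sets (space \<mu>) {f t -` C \<inter> space \<mu> | t C. t \<in> G \<and> C \<in> sets borel}"

definition minimal :: "'i set \<Rightarrow> 'a measure \<Rightarrow> ('i \<Rightarrow> 'a \<Rightarrow> real) \<Rightarrow> bool" where
  "minimal G \<mu> f \<longleftrightarrow>
     full_support G \<mu> f \<and>
     (\<forall>B\<in>sets \<mu>. \<exists>A\<in>generated_sigma G \<mu> f. emeasure \<mu> ((A - B) \<union> (B - A)) = 0)"


section \<open>Borel spaces, isomorphisms modulo null sets, and flows\<close>

text \<open>The metric space may be any complete separable one; by transport of structure along the
  isomorphism its carrier can be taken inside the type of \<open>\<mu>\<close>.\<close>

definition sigma_finite_borel_space :: "'a measure \<Rightarrow> bool" where
  "sigma_finite_borel_space \<mu> \<longleftrightarrow>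
     sigma_finite_measure \<mu> \<and>
     (\<exists>(S :: 'a set) d \<phi>.
        Metric_space S d \<and> Metric_space.mcomplete S d \<and>
        separable_space (Metric_space.mtopology S d) \<and>
        bij_betw \<phi> (space \<mu>) S \<and>
        \<phi> \<in> \<mu> \<rightarrow>\<^sub>M sigma S {V. openin (Metric_space.mtopology S d) V} \<and>
        the_inv_into (space \<mu>) \<phi> \<in> sigma S {V. openin (Metric_space.mtopology S d) V} \<rightarrow>\<^sub>M \<mu>)"

text \<open>Values of an isomorphism on the exceptional null set are arbitrary.\<close>

definition iso_mod_null :: "'a measure \<Rightarrow> 'b measure \<Rightarrow> ('a \<Rightarrow> 'b) \<Rightarrow> bool" where
  "iso_mod_null \<mu> \<nu> \<phi> \<longleftrightarrow>
     (\<exists>A\<in>null_sets \<mu>. \<exists>B\<in>null_sets \<nu>.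
        bij_betw \<phi> (space \<mu> - A) (space \<nu> - B) \<and>
        \<phi> \<in> restrict_space \<mu> (space \<mu> - A) \<rightarrow>\<^sub>M restrict_space \<nu> (space \<nu> - B) \<and>
        the_inv_into (space \<mu> - A) \<phi>
          \<in> restrict_space \<nu> (space \<nu> - B) \<rightarrow>\<^sub>M restrict_space \<mu> (space \<mu> - A) \<and>
        (\<forall>C\<in>sets \<nu>. C \<subseteq> space \<nu> - B \<longrightarrow>
           emeasure \<mu> (\<phi> -` C \<inter> (space \<mu> - A)) = emeasure \<nu> C))"

definition measure_preserving_flow ::
  "'i::monoid_add set \<Rightarrow> 'a measure \<Rightarrow> ('i \<Rightarrow> 'a \<Rightarrow> 'a) \<Rightarrow> bool" where
  "measure_preserving_flow G \<mu> T \<longleftrightarrow>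
     (\<forall>t\<in>G. iso_mod_null \<mu> \<mu> (T t)) \<and>
     (AE x in \<mu>. T 0 x = x) \<and>
     (\<forall>t\<in>G. \<forall>s\<in>G. AE x in \<mu>. T t (T s x) = T (t + s) x)"

text \<open>\<open>R\<close> is the property of being a spectral representation (in the max or in the sum sense)
  of the field under consideration.\<close>

definition minimal_flow_rep ::
  "(('i::monoid_add \<Rightarrow> 'a \<Rightarrow> real) \<Rightarrow> bool) \<Rightarrow> 'i set \<Rightarrow> 'a measure \<Rightarrow>
   ('a \<Rightarrow> real) \<Rightarrow> ('i \<Rightarrow> 'a \<Rightarrow> 'a) \<Rightarrow> bool" where
  "minimal_flow_rep R G \<mu> f0 T \<longleftrightarrow>
     measure_preserving_flow G \<mu> T \<and>
     (\<exists>f. R f \<and> minimal G \<mu> f \<and> f 0 = f0 \<and> (\<forall>t\<in>G. AE x in \<mu>. f t x = f0 (T t x)))"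

definition flow_rep_iso ::
  "'i set \<Rightarrow> 'a measure \<Rightarrow> ('a \<Rightarrow> real) \<Rightarrow> ('i \<Rightarrow> 'a \<Rightarrow> 'a) \<Rightarrow>
   'b measure \<Rightarrow> ('b \<Rightarrow> real) \<Rightarrow> ('i \<Rightarrow> 'b \<Rightarrow> 'b) \<Rightarrow> ('a \<Rightarrow> 'b) \<Rightarrow> bool" where
  "flow_rep_iso G \<mu> f T \<nu> g S \<Phi> \<longleftrightarrow>
     iso_mod_null \<mu> \<nu> \<Phi> \<and>
     (AE x in \<mu>. f x = g (\<Phi> x)) \<and>
     (\<forall>t\<in>G. AE x in \<mu>. \<Phi> (T t x) = S t (\<Phi> x))"

end

theory Submission
  imports Defs
begin

text \<open>
  Uniqueness of minimal flow representations rests on one object: the law of the trajectory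
  \<open>x \<mapsto> (f t x)\<^bsub>t \<in> G\<^esub>\<close> under the intensity \<open>\<mu>\<close>, a possibly infinite measure on
  the product space \<open>\<real>\<^sup>G\<close>. Everything probabilistic serves to show that the field determines
  this law; everything else is measure theory on top of it.

  \<^emph>\<open>The field determines the trajectory law off zero.\<close> In the max case
  \<open>P (X t \<le> x t, t \<in> I) = exp (- \<mu> {\<exists>t\<in>I. f t > x t})\<close> for positive thresholds, so the
  measures of all exceedance unions agree, and differences of such unions are the lower orthants
  inside \<open>{f s > \<epsilon>}\<close> (\<open>exceedances_determine_law\<close>). In the sum case the characteristic
  functional of a Poisson integral gives a Levy--Khintchine exponent without Gaussian part
  (\<open>sum_spectral_rep_char\<close>). Equal characteristic functions have equal continuous exponents
  (\<open>levy_exponent_unique\<close>), and a second difference of the exponent in the direction of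
  coordinate \<open>s\<close> is the characteristic function of the finite measure with density
  \<open>1 - cos (u * y s)\<close> with respect to the trajectory law (\<open>levy_integrand_second_difference\<close>).
  Either way the trajectory laws of the two representations agree on every set contained in
  some \<open>{y. y s \<noteq> 0}\<close>.

  \<^emph>\<open>Full support removes the restriction.\<close> Sigma-finiteness and full support give countably
  many indices whose coordinates do not vanish simultaneously, up to a null set
  (\<open>full_support_countable\<close>), so both laws live on a countable union of sets where they are
  known to agree (\<open>path_law_eqI\<close>).

  \<^emph>\<open>The trajectory law determines the representation.\<close> In a standard Borel space a point is
  coded by a sequence of naturals (\<open>standard_borel_coding\<close>). By minimality each digit is almost
  everywhere a function of the trajectory, hence so is the point itself (\<open>minimal_decoder\<close>).
  Sending \<open>x\<close> to its trajectory and decoding the latter in the second space is the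
  isomorphism \<open>\<Phi>\<close>, with inverse built in the same way (\<open>path_law_determines_minimal\<close>).

  \<^emph>\<open>Equivariance and uniqueness.\<close> The coordinates \<open>g t\<close> of a minimal representation separate
  maps that pull null sets back to null sets (\<open>minimal_separates\<close>). Both \<open>\<Phi> \<circ> S t\<close> and
  \<open>R t \<circ> \<Phi>\<close> have coordinates \<open>f (s + t)\<close>, and any two isomorphisms of flow representations
  have coordinates \<open>f t\<close>; hence they agree almost everywhere.
\<close>

section \<open>Trajectories and their law\<close>

text \<open>
  The trajectory is cut off outside \<open>G\<close> because elements of the product space \<open>PiM G\<close> are
  extensional functions.
\<close>

definition trajectory :: "'i set \<Rightarrow> ('i \<Rightarrow> 'a \<Rightarrow> real) \<Rightarrow> 'a \<Rightarrow> 'i \<Rightarrow> real" where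
  "trajectory G f x = (\<lambda>t\<in>G. f t x)"

abbreviation path_space :: "'i set \<Rightarrow> ('i \<Rightarrow> real) measure" where
  "path_space G \<equiv> PiM G (\<lambda>_. borel)"

definition path_law :: "'i set \<Rightarrow> 'a measure \<Rightarrow> ('i \<Rightarrow> 'a \<Rightarrow> real) \<Rightarrow> ('i \<Rightarrow> real) measure" where
  "path_law G \<mu> f = distr \<mu> (path_space G) (trajectory G f)"

lemma trajectory_measurable:
  assumes "\<forall>t\<in>G. f t \<in> borel_measurable \<mu>"
  shows "trajectory G f \<in> \<mu> \<rightarrow>\<^sub>M path_space G"
  unfolding trajectory_def[abs_def] using assms by (intro measurable_restrict) auto

section \<open>Coding standard Borel spaces by sequences of naturals\<close>

abbreviation baire :: "(nat \<Rightarrow> nat) measure" where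
  "baire \<equiv> PiM UNIV (\<lambda>_. count_space UNIV)"

lemma (in Metric_space) dense_sequence:
  assumes "separable_space mtopology" "M \<noteq> {}"
  obtains s :: "nat \<Rightarrow> 'a" where "range s \<subseteq> M" "\<And>x r. x \<in> M \<Longrightarrow> r > 0 \<Longrightarrow> \<exists>n. d x (s n) < r"
proof -
  obtain C where C: "countable C" "C \<subseteq> M" "mtopology closure_of C = M"
    using assms(1) unfolding separable_space_def by auto
  have near: "\<exists>c\<in>C. d x c < r" if "x \<in> M" "r > 0" for x r
  proof -
    have "x \<in> mtopology closure_of C" using C that by simp
    then show ?thesis using that(2) unfolding metric_closure_of by fastforce
  qed
  then have "C \<noteq> {}" using assms(2) by (metis all_not_in_conv zero_less_one)
  then have "range (from_nat_into C) = C" using C(1) by (simp add: range_from_nat_into)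
  then show thesis using that[of "from_nat_into C"] near C(2) by (metis rangeE)
qed

text \<open>
  The \<open>m\<close>-th digit of the code of a point is the index of the first member of a dense sequence
  closer than \<open>2\<^sup>-\<^sup>m\<close> to it. A code is decoded by taking the limit of the dense points it names.
  The distance from the decoded point to any dense point is therefore a measurable function of the
  code, and this makes both the set of codes and the decoding measurable.
\<close>

lemma standard_borel_coding:
  fixes \<mu> :: "'a measure"
  assumes "sigma_finite_borel_space \<mu>"
  obtains e :: "'a \<Rightarrow> nat \<Rightarrow> nat" where
    "e \<in> \<mu> \<rightarrow>\<^sub>M baire" "inj_on e (space \<mu>)" "e ` space \<mu> \<in> sets baire"
    "the_inv_into (space \<mu>) e \<in> restrict_space baire (e ` space \<mu>) \<rightarrow>\<^sub>M \<mu>"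
proof (cases "space \<mu> = {}")
  case True
  show thesis
    by (rule that[of "\<lambda>_ _. 0"]) (auto simp: True measurable_def space_restrict_space)
next
  case False
  obtain S :: "'a set" and d \<phi> where
    ms: "Metric_space S d" and mc: "Metric_space.mcomplete S d"
    and sep: "separable_space (Metric_space.mtopology S d)" and bij: "bij_betw \<phi> (space \<mu>) S"
    and phi: "\<phi> \<in> \<mu> \<rightarrow>\<^sub>M sigma S {V. openin (Metric_space.mtopology S d) V}"
    and psi: "the_inv_into (space \<mu>) \<phi> \<in> sigma S {V. openin (Metric_space.mtopology S d) V} \<rightarrow>\<^sub>M \<mu>"
    using assms unfolding sigma_finite_borel_space_def by blast
  interpret S: Metric_space S d by (rule ms)
  have "S \<noteq> {}" using False bij unfolding bij_betw_def by auto
  then obtain s :: "nat \<Rightarrow> 'a" where s: "range s \<subseteq> S" and dense: "\<And>x r. x \<in> S \<Longrightarrow> r > 0 \<Longrightarrow> \<exists>n. d x (s n) < r"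
    using S.dense_sequence[OF sep] by blast
  have sS: "s n \<in> S" for n using s by auto
  have phiS: "\<phi> x \<in> S" if "x \<in> space \<mu>" for x using bij that unfolding bij_betw_def by auto
  have opens: "{V. openin S.mtopology V} \<subseteq> Pow S" using openin_subset by fastforce
  have [measurable]: "Measurable.pred \<mu> (\<lambda>x. d (\<phi> x) (s j) < r)" for j r
  proof -
    have "\<phi> -` (S.mball (s j) r) \<inter> space \<mu> \<in> sets \<mu>"
      using measurable_sets[OF phi, of "S.mball (s j) r"] opens by (simp add: sigma_sets.Basic)
    also have "\<phi> -` (S.mball (s j) r) \<inter> space \<mu> = {x\<in>space \<mu>. d (\<phi> x) (s j) < r}"
      using phiS sS by (auto simp: S.commute)
    finally show ?thesis by (simp add: pred_def)
  qed
  define c where "c x m = (LEAST n. d x (s n) < (1/2)^m)" for x and m :: nat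
  define e where "e x = c (\<phi> x)" for x
  have c1: "d x (s (c x m)) < (1/2)^m" if "x \<in> S" for x m
    unfolding c_def by (rule LeastI_ex) (use dense that in simp)
  have c2: "\<not> d x (s j) < (1/2)^m" if "j < c x m" for x m j
    using not_less_Least that unfolding c_def by blast
  have cI: "c x m = n" if "d x (s n) < (1/2)^m" "\<And>j. j < n \<Longrightarrow> \<not> d x (s j) < (1/2)^m" for x m n
    unfolding c_def using that by (intro Least_equality) (auto simp: not_less[symmetric])
  have e_meas: "e \<in> \<mu> \<rightarrow>\<^sub>M baire"
  proof (rule measurable_PiM_single')
    show "e \<in> space \<mu> \<rightarrow> (\<Pi>\<^sub>E i\<in>UNIV. space (count_space UNIV))" by simp
    show "(\<lambda>x. e x i) \<in> \<mu> \<rightarrow>\<^sub>M count_space UNIV" for i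
      unfolding e_def c_def by measurable
  qed
  \<comment> \<open>The distance from the point coded by \<open>n\<close> to the \<open>j\<close>-th dense point, read off the code alone.\<close>
  define D where "D j n = lim (\<lambda>k. d (s (n k)) (s j))" for j and n :: "nat \<Rightarrow> nat"
  have D_meas[measurable]: "(\<lambda>n. D j n) \<in> borel_measurable baire" for j
    unfolding D_def by measurable
  have D_eq: "D j n = d y (s j)" if "limitin S.mtopology (\<lambda>k. s (n k)) y sequentially" for j n y
  proof -
    have y: "y \<in> S" and lim: "(\<lambda>k. d (s (n k)) y) \<longlonglongrightarrow> 0"
      using that unfolding S.limitin_metric_dist_null by auto
    have "(\<lambda>k. d (s (n k)) (s j)) \<longlonglongrightarrow> d y (s j)"
    proof (rule LIMSEQ_I)
      fix r :: real assume "r > 0"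
      then obtain N where N: "\<And>k. k \<ge> N \<Longrightarrow> norm (d (s (n k)) y - 0) < r" using LIMSEQ_D[OF lim] by blast
      have "norm (d (s (n k)) (s j) - d y (s j)) \<le> d (s (n k)) y" for k
        using S.mdist_reverse_triangle[of "s (n k)" "s j" y] S.triangle[of "s (n k)" y "s j"] S.triangle[of y "s (n k)" "s j"] y sS S.commute
        by (smt (verit) real_norm_def)
      with N show "\<exists>N. \<forall>k\<ge>N. norm (d (s (n k)) (s j) - d y (s j)) < r"
        by (smt (verit) S.nonneg real_norm_def)
    qed
    then show ?thesis unfolding D_def by (rule limI)
  qed
  have lim_code: "limitin S.mtopology (\<lambda>k. s (c x k)) x sequentially" if "x \<in> S" for x
    unfolding S.limitin_metric_dist_null
  proof (intro conjI)
    have "(\<lambda>k. (1/2::real)^k) \<longlonglongrightarrow> 0" by (intro LIMSEQ_power_zero) auto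
    then show "(\<lambda>k. d (s (c x k)) x) \<longlonglongrightarrow> 0"
      by (rule tendsto_sandwich[OF _ _ tendsto_const, rotated 2])
         (use c1[OF that] in \<open>auto simp: S.commute intro!: always_eventually less_imp_le\<close>)
  qed (use that sS in auto)
  \<comment> \<open>The codes: the first clause makes the named dense points a Cauchy sequence, the second
    says that the code of its limit is the given sequence.\<close>
  define R where "R = {n. (\<forall>k l. d (s (n k)) (s (n l)) < (1/2)^k + (1/2)^l) \<and>
      (\<forall>m j. (n m = j \<longrightarrow> D j n < (1/2)^m) \<and> (j < n m \<longrightarrow> \<not> D j n < (1/2)^m))}"
  have R_meas: "R \<in> sets baire"
  proof -
    have "{n\<in>space baire. (\<forall>k l. d (s (n k)) (s (n l)) < (1/2)^k + (1/2)^l) \<and>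
      (\<forall>m j. (n m = j \<longrightarrow> D j n < (1/2)^m) \<and> (j < n m \<longrightarrow> \<not> D j n < (1/2)^m))} \<in> sets baire"
      by measurable
    then show ?thesis by (simp add: R_def space_PiM)
  qed
  have inj_e: "inj_on e (space \<mu>)"
  proof (rule inj_onI)
    fix x y assume xy: "x \<in> space \<mu>" "y \<in> space \<mu>" "e x = e y"
    have "limitin S.mtopology (\<lambda>k. s (c (\<phi> x) k)) (\<phi> y) sequentially"
      using lim_code[OF phiS[OF xy(2)]] xy(3) by (simp add: e_def)
    with lim_code[OF phiS[OF xy(1)]] have "\<phi> x = \<phi> y"
      by (intro S.limitin_metric_unique) auto
    then show "x = y" using bij xy unfolding bij_betw_def inj_on_def by auto
  qed
  have R_eq: "e ` space \<mu> = R"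
  proof (intro equalityI subsetI)
    fix n assume "n \<in> e ` space \<mu>"
    then obtain x where x: "x \<in> space \<mu>" "n = c (\<phi> x)" by (auto simp: e_def)
    note D = D_eq[OF lim_code[OF phiS[OF x(1)]]]
    have "d (s (n k)) (s (n l)) < (1/2)^k + (1/2)^l" for k l
      using S.triangle[of "s (n k)" "\<phi> x" "s (n l)"] c1[OF phiS[OF x(1)], of k] c1[OF phiS[OF x(1)], of l]
        S.commute[of "\<phi> x" "s (n k)"] sS phiS[OF x(1)] x(2) by fastforce
    then show "n \<in> R" using c1[OF phiS[OF x(1)]] c2[of _ "\<phi> x"] unfolding R_def by (auto simp: x(2) D)
  next
    fix n assume n: "n \<in> R"
    have "S.MCauchy (\<lambda>k. s (n k))"
      unfolding S.MCauchy_def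
    proof (intro conjI allI impI)
      fix \<epsilon> :: real assume "\<epsilon> > 0"
      then obtain N where N: "(1/2)^N < \<epsilon>/2" using real_arch_pow_inv[of "\<epsilon>/2" "1/2"] by auto
      have "d (s (n k)) (s (n l)) < \<epsilon>" if "N \<le> k" "N \<le> l" for k l
      proof -
        have "(1/2::real)^k \<le> (1/2)^N" "(1/2::real)^l \<le> (1/2)^N" using that by (auto intro!: power_decreasing)
        moreover have "d (s (n k)) (s (n l)) < (1/2)^k + (1/2)^l" using n unfolding R_def by auto
        ultimately show ?thesis using N by linarith
      qed
      then show "\<exists>N. \<forall>k l. N \<le> k \<longrightarrow> N \<le> l \<longrightarrow> d (s (n k)) (s (n l)) < \<epsilon>" by blast
    qed (use sS in auto)
    then obtain y where y: "limitin S.mtopology (\<lambda>k. s (n k)) y sequentially"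
      using mc unfolding S.mcomplete_def by blast
    then have yS: "y \<in> S" by (simp add: S.limitin_metric_dist_null)
    have "c y m = n m" for m
      using n unfolding R_def by (intro cI) (auto simp: D_eq[OF y])
    then have "n = e (the_inv_into (space \<mu>) \<phi> y)"
      using bij yS unfolding e_def by (auto simp: fun_eq_iff f_the_inv_into_f_bij_betw)
    moreover have "the_inv_into (space \<mu>) \<phi> y \<in> space \<mu>"
      using bij yS by (meson bij_betw_apply bij_betw_the_inv_into)
    ultimately show "n \<in> e ` space \<mu>" by blast
  qed
  define g where "g n = \<phi> (the_inv_into (space \<mu>) e n)" for n
  have inv_e: "the_inv_into (space \<mu>) e n \<in> space \<mu>" "e (the_inv_into (space \<mu>) e n) = n" if "n \<in> R" for n
    using that R_eq inj_e by (auto intro: the_inv_into_into f_the_inv_into_f)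
  have gS: "g n \<in> S" if "n \<in> R" for n using inv_e[OF that] phiS by (simp add: g_def)
  have gD: "d (g n) (s j) = D j n" if "n \<in> R" for n j
    using D_eq[OF lim_code[OF gS[OF that]], of j] inv_e(2)[OF that] by (simp add: g_def e_def)
  have g_meas: "g \<in> restrict_space baire R \<rightarrow>\<^sub>M sigma S {V. openin S.mtopology V}"
  proof (rule measurable_measure_of)
    show "{V. openin S.mtopology V} \<subseteq> Pow S" by (rule opens)
    show "g \<in> space (restrict_space baire R) \<rightarrow> S" using gS by (auto simp: space_restrict_space)
    fix V assume "V \<in> {V. openin S.mtopology V}"
    then have V: "openin S.mtopology V" by simp
    have *: "g n \<in> V \<longleftrightarrow> (\<exists>j k. S.mball (s j) ((1/2)^k) \<subseteq> V \<and> D j n < (1/2)^k)" if n: "n \<in> R" for n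
    proof
      \<comment> \<open>Here separability is used: \<open>V\<close> is a union of balls of radius \<open>2\<^sup>-\<^sup>k\<close> around dense points.\<close>
      assume "g n \<in> V"
      then obtain r where r: "r > 0" "S.mball (g n) r \<subseteq> V" using V S.openin_mtopology by auto
      then obtain k where k: "(1/2)^k < r/2" using real_arch_pow_inv[of "r/2" "1/2"] by auto
      obtain j where j: "d (g n) (s j) < (1/2)^k" using dense[OF gS[OF n], of "(1/2)^k"] by auto
      have "S.mball (s j) ((1/2)^k) \<subseteq> S.mball (g n) r"
      proof
        fix z assume z: "z \<in> S.mball (s j) ((1/2)^k)"
        then have "d (g n) z \<le> d (g n) (s j) + d (s j) z" using S.triangle gS[OF n] sS by simp
        then show "z \<in> S.mball (g n) r" using z j k gS[OF n] by simp
      qed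
      then show "\<exists>j k. S.mball (s j) ((1/2)^k) \<subseteq> V \<and> D j n < (1/2)^k"
        using r(2) j gD[OF n] by (intro exI[of _ j] exI[of _ k]) auto
    next
      assume "\<exists>j k. S.mball (s j) ((1/2)^k) \<subseteq> V \<and> D j n < (1/2)^k"
      then obtain j k where "S.mball (s j) ((1/2)^k) \<subseteq> V" "D j n < (1/2)^k" by blast
      then show "g n \<in> V" using gD[OF n, of j] gS[OF n] sS[of j] S.commute[of "g n" "s j"] by auto
    qed
    have "{n\<in>space baire. \<exists>j k. S.mball (s j) ((1/2)^k) \<subseteq> V \<and> D j n < (1/2)^k} \<in> sets baire"
      by measurable
    then have "{n\<in>space baire. \<exists>j k. S.mball (s j) ((1/2)^k) \<subseteq> V \<and> D j n < (1/2)^k} \<inter> R \<in> sets (restrict_space baire R)"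
      unfolding sets_restrict_space by (subst Int_commute) (rule imageI)
    also have "{n\<in>space baire. \<exists>j k. S.mball (s j) ((1/2)^k) \<subseteq> V \<and> D j n < (1/2)^k} \<inter> R = g -` V \<inter> space (restrict_space baire R)"
      using * by (auto simp: space_restrict_space space_PiM)
    finally show "g -` V \<inter> space (restrict_space baire R) \<in> sets (restrict_space baire R)" .
  qed
  have "(\<lambda>n. the_inv_into (space \<mu>) \<phi> (g n)) \<in> restrict_space baire R \<rightarrow>\<^sub>M \<mu>"
    by (rule measurable_compose[OF g_meas psi])
  moreover have inv_g: "the_inv_into (space \<mu>) \<phi> (g n) = the_inv_into (space \<mu>) e n" if "n \<in> R" for n
    using inv_e(1)[OF that] bij unfolding g_def by (simp add: bij_betw_def the_inv_into_f_f)
  have "(\<lambda>n. the_inv_into (space \<mu>) \<phi> (g n)) \<in> restrict_space baire R \<rightarrow>\<^sub>M \<mu> \<longleftrightarrow>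
      the_inv_into (space \<mu>) e \<in> restrict_space baire R \<rightarrow>\<^sub>M \<mu>"
    by (rule measurable_cong) (simp add: space_restrict_space inv_g)
  ultimately have "the_inv_into (space \<mu>) e \<in> restrict_space baire R \<rightarrow>\<^sub>M \<mu>"
    by (simp only:)
  then show thesis using that[OF e_meas inj_e] R_meas unfolding R_eq by blast
qed

section \<open>Minimal representations are determined by their trajectory law\<close>

lemma generated_sigma_sets:
  assumes "\<forall>t\<in>G. f t \<in> borel_measurable \<mu>"
  shows "generated_sigma G \<mu> f \<subseteq> sets \<mu>"
  unfolding generated_sigma_def by (intro sets.sigma_sets_subset) (use assms in \<open>auto intro!: measurable_sets\<close>)

lemma generated_sigma_trajectory:
  assumes f: "\<forall>t\<in>G. f t \<in> borel_measurable \<mu>" and A: "A \<in> generated_sigma G \<mu> f"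
  shows "\<exists>C\<in>sets (path_space G). A = trajectory G f -` C \<inter> space \<mu>"
  using A unfolding generated_sigma_def
proof (induction rule: sigma_sets.induct)
  case (Basic A)
  then obtain t C where t: "t \<in> G" "C \<in> sets borel" "A = f t -` C \<inter> space \<mu>" by blast
  have "(\<lambda>y. y t) -` C \<inter> space (path_space G) \<in> sets (path_space G)"
    using t by (intro measurable_sets[OF measurable_component_singleton]) auto
  moreover have "A = trajectory G f -` ((\<lambda>y. y t) -` C \<inter> space (path_space G)) \<inter> space \<mu>"
    using t by (auto simp: trajectory_def space_PiM)
  ultimately show ?case by blast
next
  case Empty
  show ?case by (rule bexI[of _ "{}"]) auto
next
  case (Compl A)
  then obtain C where C: "C \<in> sets (path_space G)" "A = trajectory G f -` C \<inter> space \<mu>" by blast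
  have "space \<mu> - A = trajectory G f -` (space (path_space G) - C) \<inter> space \<mu>"
    using measurable_space[OF trajectory_measurable[OF f]] C by auto
  then show ?case using C by blast
next
  case (Union A)
  then obtain C where "\<And>i::nat. C i \<in> sets (path_space G) \<and> A i = trajectory G f -` (C i) \<inter> space \<mu>" by metis
  then show ?case by (intro bexI[of _ "\<Union>i. C i"]) auto
qed

text \<open>
  The symmetric difference in the definition of minimality is measurable, so a set of measure zero
  there is a genuine null set and can be used pointwise almost everywhere.
\<close>

lemma minimal_AE:
  assumes f: "\<forall>t\<in>G. f t \<in> borel_measurable \<mu>"
    and m: "minimal G \<mu> f" and B: "B \<in> sets \<mu>"
  obtains A where "A \<in> generated_sigma G \<mu> f" "AE x in \<mu>. x \<in> A \<longleftrightarrow> x \<in> B"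
proof -
  obtain A where A: "A \<in> generated_sigma G \<mu> f" "emeasure \<mu> ((A - B) \<union> (B - A)) = 0"
    using m B unfolding minimal_def by blast
  have "A \<in> sets \<mu>" using A(1) generated_sigma_sets[OF f] by auto
  then have "(A - B) \<union> (B - A) \<in> null_sets \<mu>" using A(2) B by (auto intro: null_setsI)
  from AE_not_in[OF this] have "AE x in \<mu>. x \<in> A \<longleftrightarrow> x \<in> B" by eventually_elim auto
  with A(1) that show thesis by blast
qed

text \<open>
  Each digit of the code of \<open>x\<close> takes countably many values, and by minimality the set where a
  digit takes a given value is almost everywhere a set of trajectories. Only countably many
  digit-value pairs occur, so almost every point can be recovered from its trajectory, even
  if \<open>G\<close> is uncountable.
\<close>

lemma minimal_decoder:
  assumes borel: "sigma_finite_borel_space \<mu>" and ne: "space \<mu> \<noteq> {}"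
    and f: "\<forall>t\<in>G. f t \<in> borel_measurable \<mu>" and m: "minimal G \<mu> f"
  obtains b where "b \<in> path_space G \<rightarrow>\<^sub>M \<mu>" "AE x in \<mu>. b (trajectory G f x) = x"
proof -
  obtain e where e: "e \<in> \<mu> \<rightarrow>\<^sub>M baire" "inj_on e (space \<mu>)" and E: "e ` space \<mu> \<in> sets baire"
    and inv_e: "the_inv_into (space \<mu>) e \<in> restrict_space baire (e ` space \<mu>) \<rightarrow>\<^sub>M \<mu>"
    using standard_borel_coding[OF borel] by blast
  have "\<exists>C\<in>sets (path_space G). AE x in \<mu>. trajectory G f x \<in> C \<longleftrightarrow> e x k = j" for k j
  proof -
    have "{x\<in>space \<mu>. e x k = j} \<in> sets \<mu>"
      using measurable_compose[OF e(1) measurable_component_singleton[of k UNIV]] by measurable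
    then obtain A where A: "A \<in> generated_sigma G \<mu> f" "AE x in \<mu>. x \<in> A \<longleftrightarrow> x \<in> {x\<in>space \<mu>. e x k = j}"
      by (rule minimal_AE[OF f m])
    obtain C where C: "C \<in> sets (path_space G)" "A = trajectory G f -` C \<inter> space \<mu>"
      using generated_sigma_trajectory[OF f A(1)] by blast
    have "AE x in \<mu>. trajectory G f x \<in> C \<longleftrightarrow> e x k = j"
      using A(2) AE_space by eventually_elim (auto simp: C(2))
    with C(1) show ?thesis by blast
  qed
  then obtain C where C[measurable]: "\<And>k j. C k j \<in> sets (path_space G)"
    and C_AE: "\<And>k j. AE x in \<mu>. trajectory G f x \<in> C k j \<longleftrightarrow> e x k = j" by metis
  define \<kappa> where "\<kappa> y k = (LEAST j. y \<in> C k j)" for y and k :: nat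
  have kappa_meas: "\<kappa> \<in> path_space G \<rightarrow>\<^sub>M baire"
  proof (rule measurable_PiM_single')
    show "(\<lambda>y. \<kappa> y k) \<in> path_space G \<rightarrow>\<^sub>M count_space UNIV" for k
      unfolding \<kappa>_def by measurable
  qed simp
  have kappa_AE: "AE x in \<mu>. \<kappa> (trajectory G f x) = e x"
  proof -
    have "AE x in \<mu>. \<forall>k j. trajectory G f x \<in> C k j \<longleftrightarrow> e x k = j"
      using C_AE by (simp add: AE_all_countable)
    then show ?thesis by eventually_elim (auto simp: \<kappa>_def fun_eq_iff intro: Least_equality)
  qed
  obtain x0 where x0: "x0 \<in> space \<mu>" using ne by blast
  \<comment> \<open>The value \<open>x0\<close> only makes the decoder total; sequences that are not codes arise on a null set.\<close>
  define r where "r n = (if n \<in> e ` space \<mu> then the_inv_into (space \<mu>) e n else x0)" for n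
  have "r \<in> baire \<rightarrow>\<^sub>M \<mu>"
    unfolding r_def by (subst measurable_restrict_space_iff[symmetric]) (use E x0 inv_e in auto)
  then have "(\<lambda>y. r (\<kappa> y)) \<in> path_space G \<rightarrow>\<^sub>M \<mu>" by (rule measurable_compose[OF kappa_meas])
  moreover have "AE x in \<mu>. r (\<kappa> (trajectory G f x)) = x"
    using kappa_AE AE_space by eventually_elim (auto simp: r_def the_inv_into_f_f[OF e(2)])
  ultimately show thesis by (rule that)
qed

text \<open>
  Codes separate points, so equality of two measurable maps is a countable conjunction of
  measurable conditions on digits.
\<close>

lemma standard_borel_diagonal:
  assumes "sigma_finite_borel_space \<mu>" and u: "u \<in> N \<rightarrow>\<^sub>M \<mu>" and v: "v \<in> N \<rightarrow>\<^sub>M \<mu>"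
  shows "{x\<in>space N. u x = v x} \<in> sets N"
proof -
  obtain e where e: "e \<in> \<mu> \<rightarrow>\<^sub>M baire" "inj_on e (space \<mu>)"
    using standard_borel_coding[OF assms(1)] by blast
  have [measurable]: "(\<lambda>x. e (u x) k) \<in> N \<rightarrow>\<^sub>M count_space UNIV" "(\<lambda>x. e (v x) k) \<in> N \<rightarrow>\<^sub>M count_space UNIV" for k
    using measurable_compose[OF u measurable_compose[OF e(1) measurable_component_singleton[of k UNIV]]]
      measurable_compose[OF v measurable_compose[OF e(1) measurable_component_singleton[of k UNIV]]] by auto
  have "{x\<in>space N. e (u x) k = e (v x) k} \<in> sets N" for k
  proof -
    have "{x\<in>space N. \<exists>j. e (u x) k = j \<and> e (v x) k = j} \<in> sets N" by measurable
    then show ?thesis by (rule back_subst[where P="\<lambda>A. A \<in> sets N"]) auto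
  qed
  then have "{x\<in>space N. \<forall>k. e (u x) k = e (v x) k} \<in> sets N" by (rule sets.sets_Collect_countable_All)
  also have "{x\<in>space N. \<forall>k. e (u x) k = e (v x) k} = {x\<in>space N. u x = v x}"
    using e(2) measurable_space[OF u] measurable_space[OF v] by (auto simp: inj_on_def fun_eq_iff)
  finally show ?thesis .
qed

text \<open>
  The exceptional sets are the complements of \<open>{x. \<psi> (\<phi> x) = x}\<close> and
  \<open>{z. \<phi> (\<psi> z) = z}\<close>, between which \<open>\<phi>\<close> and \<open>\<psi>\<close> are exactly inverse.
\<close>

lemma iso_mod_nullI:
  assumes borel: "sigma_finite_borel_space \<mu>" "sigma_finite_borel_space \<nu>"
    and \<phi>: "\<phi> \<in> \<mu> \<rightarrow>\<^sub>M \<nu>" and \<psi>: "\<psi> \<in> \<nu> \<rightarrow>\<^sub>M \<mu>"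
    and inv: "AE x in \<mu>. \<psi> (\<phi> x) = x" "AE z in \<nu>. \<phi> (\<psi> z) = z"
    and d: "distr \<mu> \<nu> \<phi> = \<nu>"
  shows "iso_mod_null \<mu> \<nu> \<phi>"
proof -
  define X where "X = {x\<in>space \<mu>. \<psi> (\<phi> x) = x}"
  define Z where "Z = {z\<in>space \<nu>. \<phi> (\<psi> z) = z}"
  have X: "X \<in> sets \<mu>"
    unfolding X_def by (rule standard_borel_diagonal[OF borel(1) measurable_compose[OF \<phi> \<psi>] measurable_ident_sets[OF refl]])
  have Z: "Z \<in> sets \<nu>"
    unfolding Z_def by (rule standard_borel_diagonal[OF borel(2) measurable_compose[OF \<psi> \<phi>] measurable_ident_sets[OF refl]])
  have nX: "space \<mu> - X \<in> null_sets \<mu>"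
    using inv(1) X by (subst AE_iff_null_sets) (auto simp: X_def elim!: eventually_mono)
  have nZ: "space \<nu> - Z \<in> null_sets \<nu>"
    using inv(2) Z by (subst AE_iff_null_sets) (auto simp: Z_def elim!: eventually_mono)
  have sX: "space \<mu> - (space \<mu> - X) = X" and sZ: "space \<nu> - (space \<nu> - Z) = Z"
    by (auto simp: X_def Z_def)
  have XZ: "\<phi> x \<in> Z" if "x \<in> X" for x
    using that measurable_space[OF \<phi>, of x] by (auto simp: X_def Z_def)
  have ZX: "\<psi> z \<in> X" if "z \<in> Z" for z
    using that measurable_space[OF \<psi>, of z] by (auto simp: X_def Z_def)
  have bij: "bij_betw \<phi> X Z"
    by (rule bij_betw_byWitness[of _ \<psi>]) (use XZ ZX in \<open>auto simp: X_def Z_def\<close>)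
  have the_inv: "the_inv_into X \<phi> z = \<psi> z" if "z \<in> Z" for z
    using that ZX[OF that] bij by (intro the_inv_into_f_eq) (auto simp: bij_betw_def Z_def)
  have "\<phi> \<in> restrict_space \<mu> X \<rightarrow>\<^sub>M restrict_space \<nu> Z"
    by (rule measurable_restrict_space2) (use XZ \<phi> in \<open>auto simp: space_restrict_space intro: measurable_restrict_space1\<close>)
  moreover have "\<psi> \<in> restrict_space \<nu> Z \<rightarrow>\<^sub>M restrict_space \<mu> X"
    by (rule measurable_restrict_space2) (use ZX \<psi> in \<open>auto simp: space_restrict_space intro: measurable_restrict_space1\<close>)
  then have "the_inv_into X \<phi> \<in> restrict_space \<nu> Z \<rightarrow>\<^sub>M restrict_space \<mu> X"
    by (subst measurable_cong[where g=\<psi>]) (auto simp: space_restrict_space the_inv)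
  moreover have "emeasure \<mu> (\<phi> -` C \<inter> X) = emeasure \<nu> C" if C: "C \<in> sets \<nu>" "C \<subseteq> Z" for C
  proof -
    have "emeasure \<mu> (\<phi> -` C \<inter> X) = emeasure \<mu> (\<phi> -` C \<inter> space \<mu>)"
    proof (rule emeasure_eq_AE)
      show "AE x in \<mu>. (x \<in> \<phi> -` C \<inter> X) = (x \<in> \<phi> -` C \<inter> space \<mu>)"
        using inv(1) AE_space by eventually_elim (auto simp: X_def)
      have "\<phi> -` C \<inter> X = (\<phi> -` C \<inter> space \<mu>) \<inter> X" by (auto simp: X_def)
      then show "\<phi> -` C \<inter> X \<in> sets \<mu>" using measurable_sets[OF \<phi> C(1)] X by auto
    qed (rule measurable_sets[OF \<phi> C(1)])
    also have "\<dots> = emeasure (distr \<mu> \<nu> \<phi>) C" by (rule emeasure_distr[OF \<phi> C(1), symmetric])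
    finally show ?thesis by (simp add: d)
  qed
  ultimately show ?thesis
    unfolding iso_mod_null_def using nX nZ bij
    by (intro bexI[of _ "space \<mu> - X"] bexI[of _ "space \<nu> - Z"]) (simp_all add: sX sZ)
qed

lemma iso_mod_null_trivial:
  assumes "emeasure \<mu> (space \<mu>) = 0" "emeasure \<nu> (space \<nu>) = 0"
  shows "iso_mod_null \<mu> \<nu> \<phi>"
  unfolding iso_mod_null_def using assms
  by (intro bexI[of _ "space \<mu>"] bexI[of _ "space \<nu>"])
     (auto simp: bij_betw_def measurable_def space_restrict_space sets_restrict_space null_sets_def)

text \<open>
  This transfers almost sure statements about trajectories from one representation to the other,
  and is the only way in which the equality of laws enters the construction of the isomorphism.
\<close>

lemma AE_path_law:
  assumes "\<forall>t\<in>G. f t \<in> borel_measurable \<mu>" "\<forall>t\<in>G. g t \<in> borel_measurable \<nu>"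
    and "path_law G \<mu> f = path_law G \<nu> g" "{y\<in>space (path_space G). P y} \<in> sets (path_space G)"
  shows "(AE x in \<mu>. P (trajectory G f x)) \<longleftrightarrow> (AE z in \<nu>. P (trajectory G g z))"
  using AE_distr_iff[OF trajectory_measurable[OF assms(1)] assms(4)] AE_distr_iff[OF trajectory_measurable[OF assms(2)] assms(4)]
    assms(3)[unfolded path_law_def] by metis

text \<open>
  If \<open>a\<close> and \<open>b\<close> decode trajectories in the two spaces, then \<open>\<Phi> = a \<circ> trajectory f\<close> and
  \<open>\<Psi> = b \<circ> trajectory g\<close>. That they are inverse to each other does not follow by comparing
  trajectories, since for uncountable \<open>G\<close> the trajectories of \<open>x\<close> and \<open>\<Phi> x\<close> need not agree
  simultaneously at all times. Instead the identity \<open>b (trajectory g (a y)) = b y\<close> is verified for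
  \<open>y\<close> a trajectory of \<open>g\<close>, where it is immediate, and transferred to trajectories of \<open>f\<close>
  because the two laws coincide.
\<close>

lemma path_law_determines_minimal:
  assumes borel: "sigma_finite_borel_space \<mu>" "sigma_finite_borel_space \<nu>"
    and f: "\<forall>t\<in>G. f t \<in> borel_measurable \<mu>" and g: "\<forall>t\<in>G. g t \<in> borel_measurable \<nu>"
    and m: "minimal G \<mu> f" "minimal G \<nu> g"
    and law: "path_law G \<mu> f = path_law G \<nu> g"
  obtains \<Phi> where "iso_mod_null \<mu> \<nu> \<Phi>" "\<And>t. t \<in> G \<Longrightarrow> AE x in \<mu>. f t x = g t (\<Phi> x)"
proof (cases "space \<mu> = {} \<or> space \<nu> = {}")
  case True
  have "emeasure \<mu> (space \<mu>) = emeasure (path_law G \<mu> f) (space (path_space G))"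
    unfolding path_law_def by (subst emeasure_distr[OF trajectory_measurable[OF f]])
      (use measurable_space[OF trajectory_measurable[OF f]] in \<open>auto intro!: arg_cong[where f="emeasure \<mu>"]\<close>)
  moreover have "emeasure \<nu> (space \<nu>) = emeasure (path_law G \<nu> g) (space (path_space G))"
    unfolding path_law_def by (subst emeasure_distr[OF trajectory_measurable[OF g]])
      (use measurable_space[OF trajectory_measurable[OF g]] in \<open>auto intro!: arg_cong[where f="emeasure \<nu>"]\<close>)
  ultimately have z: "emeasure \<mu> (space \<mu>) = 0" "emeasure \<nu> (space \<nu>) = 0"
    using True law by auto
  have "space \<mu> \<in> null_sets \<mu>" using z by (simp add: null_sets_def)
  from AE_not_in[OF this] have AE: "AE x in \<mu>. Q x" for Q
    using AE_space by eventually_elim auto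
  \<comment> \<open>Both measures vanish, so any map is an isomorphism modulo null sets.\<close>
  show thesis by (rule that[of undefined]) (auto intro: iso_mod_null_trivial z AE)
next
  case False
  obtain b where b: "b \<in> path_space G \<rightarrow>\<^sub>M \<mu>" "AE x in \<mu>. b (trajectory G f x) = x"
    using minimal_decoder[OF borel(1) _ f m(1)] False by blast
  obtain a where a: "a \<in> path_space G \<rightarrow>\<^sub>M \<nu>" "AE z in \<nu>. a (trajectory G g z) = z"
    using minimal_decoder[OF borel(2) _ g m(2)] False by blast
  note F = trajectory_measurable[OF f] and H = trajectory_measurable[OF g]
  define \<Phi> where "\<Phi> x = a (trajectory G f x)" for x
  define \<Psi> where "\<Psi> z = b (trajectory G g z)" for z
  have \<Phi>: "\<Phi> \<in> \<mu> \<rightarrow>\<^sub>M \<nu>" and \<Psi>: "\<Psi> \<in> \<nu> \<rightarrow>\<^sub>M \<mu>"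
    unfolding \<Phi>_def \<Psi>_def using measurable_compose[OF F a(1)] measurable_compose[OF H b(1)] by auto
  have "AE z in \<nu>. b (trajectory G g (a (trajectory G g z))) = b (trajectory G g z)"
    using a(2) by eventually_elim simp
  then have "AE x in \<mu>. b (trajectory G g (a (trajectory G f x))) = b (trajectory G f x)"
    by (subst AE_path_law[OF f g law standard_borel_diagonal[OF borel(1)
      measurable_compose[OF measurable_compose[OF a(1) H] b(1)] b(1)]])
  then have inv1: "AE x in \<mu>. \<Psi> (\<Phi> x) = x"
    using b(2) by eventually_elim (simp add: \<Psi>_def \<Phi>_def)
  have "AE x in \<mu>. a (trajectory G f (b (trajectory G f x))) = a (trajectory G f x)"
    using b(2) by eventually_elim simp
  then have "AE z in \<nu>. a (trajectory G f (b (trajectory G g z))) = a (trajectory G g z)"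
    by (subst (asm) AE_path_law[OF f g law standard_borel_diagonal[OF borel(2)
      measurable_compose[OF measurable_compose[OF b(1) F] a(1)] a(1)]])
  then have inv2: "AE z in \<nu>. \<Phi> (\<Psi> z) = z"
    using a(2) by eventually_elim (simp add: \<Psi>_def \<Phi>_def)
  have "distr \<mu> \<nu> \<Phi> = distr (path_law G \<mu> f) \<nu> a"
    unfolding path_law_def by (subst distr_distr[OF a(1) F]) (simp add: \<Phi>_def[abs_def] comp_def)
  also have "\<dots> = distr \<nu> \<nu> (\<lambda>z. a (trajectory G g z))"
    unfolding law unfolding path_law_def by (subst distr_distr[OF a(1) H]) (simp add: comp_def)
  also have "\<dots> = distr \<nu> \<nu> (\<lambda>z. z)"
    by (rule distr_cong_AE) (use a H in \<open>auto intro: measurable_compose\<close>)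
  finally have d: "distr \<mu> \<nu> \<Phi> = \<nu>" by (simp add: distr_id)
  have "AE x in \<mu>. f t x = g t (\<Phi> x)" if t: "t \<in> G" for t
  proof -
    have "AE z in \<nu>. trajectory G g z t = g t (a (trajectory G g z))"
      using a(2) by eventually_elim (simp add: trajectory_def t)
    moreover have "{y\<in>space (path_space G). y t = g t (a y)} \<in> sets (path_space G)"
      using measurable_compose[OF a(1) bspec[OF g t]] measurable_component_singleton[OF t, of "\<lambda>_. borel"]
      by measurable
    ultimately have "AE x in \<mu>. trajectory G f x t = g t (a (trajectory G f x))"
      by (subst AE_path_law[OF f g law])
    then show ?thesis by (simp add: trajectory_def t \<Phi>_def)
  qed
  then show thesis by (intro that[of \<Phi>] iso_mod_nullI[OF borel \<Phi> \<Psi> inv1 inv2 d])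
qed

text \<open>
  Stated through almost everywhere predicates and not through preimages of null sets, because an
  isomorphism modulo null sets need not be measurable on its exceptional set.
\<close>

definition nonsingular :: "'a measure \<Rightarrow> 'b measure \<Rightarrow> ('a \<Rightarrow> 'b) \<Rightarrow> bool" where
  "nonsingular \<mu> \<nu> \<phi> \<longleftrightarrow> (\<forall>P. (AE z in \<nu>. P z) \<longrightarrow> (AE x in \<mu>. P (\<phi> x)))"

lemma nonsingularD: "nonsingular \<mu> \<nu> \<phi> \<Longrightarrow> AE z in \<nu>. P z \<Longrightarrow> AE x in \<mu>. P (\<phi> x)"
  unfolding nonsingular_def by blast

lemma nonsingular_comp:
  "nonsingular \<mu> \<nu> \<phi> \<Longrightarrow> nonsingular \<nu> \<rho> \<psi> \<Longrightarrow> nonsingular \<mu> \<rho> (\<lambda>x. \<psi> (\<phi> x))"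
  unfolding nonsingular_def by blast

lemma iso_mod_null_nonsingular:
  assumes "iso_mod_null \<mu> \<nu> \<phi>"
  shows "nonsingular \<mu> \<nu> \<phi>"
  unfolding nonsingular_def
proof (intro allI impI)
  fix P assume "AE z in \<nu>. P z"
  then obtain N where N: "N \<in> null_sets \<nu>" "{z\<in>space \<nu>. \<not> P z} \<subseteq> N" by (auto elim!: AE_E simp: null_sets_def)
  obtain A B where AB: "A \<in> null_sets \<mu>" "B \<in> null_sets \<nu>" "bij_betw \<phi> (space \<mu> - A) (space \<nu> - B)"
    "\<phi> \<in> restrict_space \<mu> (space \<mu> - A) \<rightarrow>\<^sub>M restrict_space \<nu> (space \<nu> - B)"
    and pres: "\<And>C. C\<in>sets \<nu> \<Longrightarrow> C \<subseteq> space \<nu> - B \<Longrightarrow>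
           emeasure \<mu> (\<phi> -` C \<inter> (space \<mu> - A)) = emeasure \<nu> C"
    using assms unfolding iso_mod_null_def by blast
  define C where "C = N - B"
  have C: "C \<in> sets \<nu>" "C \<subseteq> space \<nu> - B" "emeasure \<nu> C = 0"
    using N(1) AB(2) sets.sets_into_space[of N \<nu>] unfolding C_def
    by (auto simp: null_sets_def emeasure_Diff_null_set)
  have "C \<in> sets (restrict_space \<nu> (space \<nu> - B))"
    using C AB(2) by (subst sets_restrict_space_iff) (auto simp: null_sets_def)
  from measurable_sets[OF AB(4) this] have "\<phi> -` C \<inter> (space \<mu> - A) \<in> sets \<mu>"
    using AB(1) by (subst (asm) sets_restrict_space_iff) (auto simp: space_restrict_space null_sets_def Int_absorb2 Int_absorb1)
  then have "\<phi> -` C \<inter> (space \<mu> - A) \<in> null_sets \<mu>" using pres C by (auto intro!: null_setsI)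
  from AE_not_in[OF this] AE_not_in[OF AB(1)] AE_space
  show "AE x in \<mu>. P (\<phi> x)"
  proof eventually_elim
    case (elim x)
    then have "\<phi> x \<in> space \<nu> - B" using AB(3) by (auto simp: bij_betw_def)
    with elim show ?case using N(2) by (auto simp: C_def)
  qed
qed

text \<open>
  The sets \<open>A\<close> with \<open>\<phi> x \<in> A \<longleftrightarrow> \<psi> x \<in> A\<close> almost everywhere form a sigma-algebra. It contains
  the sets generated by the coordinates, and by minimality and nonsingularity all measurable
  sets; applying this to the countably many digit sets of a code gives equality of the points.
\<close>

lemma minimal_separates:
  assumes borel: "sigma_finite_borel_space \<nu>"
    and g: "\<forall>t\<in>G. g t \<in> borel_measurable \<nu>" and m: "minimal G \<nu> g"
    and ns: "nonsingular \<mu> \<nu> \<phi>" "nonsingular \<mu> \<nu> \<psi>"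
    and eq: "\<And>t. t \<in> G \<Longrightarrow> AE x in \<mu>. g t (\<phi> x) = g t (\<psi> x)"
  shows "AE x in \<mu>. \<phi> x = \<psi> x"
proof -
  obtain e where e: "e \<in> \<nu> \<rightarrow>\<^sub>M baire" "inj_on e (space \<nu>)"
    using standard_borel_coding[OF borel] by blast
  have sp: "AE x in \<mu>. \<phi> x \<in> space \<nu> \<and> \<psi> x \<in> space \<nu>"
    using nonsingularD[OF ns(1) AE_space] nonsingularD[OF ns(2) AE_space] by eventually_elim simp
  have gen: "AE x in \<mu>. \<phi> x \<in> A \<longleftrightarrow> \<psi> x \<in> A" if "A \<in> generated_sigma G \<nu> g" for A
    using that unfolding generated_sigma_def
  proof (induction rule: sigma_sets.induct)
    case (Basic A)
    then obtain t C where t: "t \<in> G" "A = g t -` C \<inter> space \<nu>" by blast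
    from eq[OF t(1)] sp show ?case by eventually_elim (auto simp: t(2))
  next
    case (Compl A)
    from Compl.IH sp show ?case by eventually_elim auto
  next
    case (Union A)
    from Union.IH have "AE x in \<mu>. \<forall>i. \<phi> x \<in> A i \<longleftrightarrow> \<psi> x \<in> A i" by (simp add: AE_all_countable)
    then show ?case by eventually_elim auto
  qed simp
  have "AE x in \<mu>. e (\<phi> x) k = j \<longleftrightarrow> e (\<psi> x) k = j" for k j
  proof -
    have "{x\<in>space \<nu>. e x k = j} \<in> sets \<nu>"
      using measurable_compose[OF e(1) measurable_component_singleton[of k UNIV]] by measurable
    then obtain A where A: "A \<in> generated_sigma G \<nu> g" "AE x in \<nu>. x \<in> A \<longleftrightarrow> x \<in> {x\<in>space \<nu>. e x k = j}"
      by (rule minimal_AE[OF g m])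
    from gen[OF A(1)] sp nonsingularD[OF ns(1) A(2)] nonsingularD[OF ns(2) A(2)]
    show ?thesis by eventually_elim auto
  qed
  then have "AE x in \<mu>. \<forall>k j. e (\<phi> x) k = j \<longleftrightarrow> e (\<psi> x) k = j" by (simp add: AE_all_countable)
  with sp show ?thesis
    by eventually_elim (use e(2) in \<open>auto simp: inj_on_def fun_eq_iff\<close>)
qed

section \<open>Full support and the trajectory law off zero\<close>

text \<open>
  Exhaustion: among the countable index sets \<open>C\<close> choose one maximising the size, with respect to
  an equivalent finite measure, of the set where some coordinate in \<open>C\<close> does not vanish. No further
  index can enlarge this set by more than a null set, so every coordinate vanishes on its
  complement, which is null by full support.
\<close>

lemma full_support_countable:
  assumes sf: "sigma_finite_measure \<mu>" and f: "\<forall>t\<in>G. f t \<in> borel_measurable \<mu>"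
    and fs: "full_support G \<mu> f"
  obtains C where "countable C" "C \<subseteq> G" "AE x in \<mu>. \<exists>t\<in>C. f t x \<noteq> 0"
proof -
  interpret sigma_finite_measure \<mu> by (rule sf)
  obtain h :: "_ \<Rightarrow> real" where h[measurable]: "h \<in> borel_measurable \<mu>" and pos: "\<And>x. h x > 0"
    and "\<And>x. h x \<le> 1" and int: "integrable \<mu> h"
    using obtain_positive_integrable_function by metis
  define \<eta> where "\<eta> = density \<mu> (\<lambda>x. ennreal (h x))"
  have sets_l[simp]: "sets \<eta> = sets \<mu>" "space \<eta> = space \<mu>" by (simp_all add: \<eta>_def)
  have AE_l: "(AE x in \<eta>. Q x) \<longleftrightarrow> (AE x in \<mu>. Q x)" for Q
    unfolding \<eta>_def using AE_density[of "\<lambda>x. ennreal (h x)" \<mu> Q] pos by (simp add: ennreal_less_zero_iff)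
  have fin: "finite_measure \<eta>"
  proof
    have "emeasure \<eta> (space \<eta>) = (\<integral>\<^sup>+x. ennreal (h x) \<partial>\<mu>)"
      by (simp add: \<eta>_def emeasure_density cong: nn_integral_cong)
    also have "\<dots> < \<infinity>" using int pos by (simp add: integrable_iff_bounded less_imp_le)
    finally show "emeasure \<eta> (space \<eta>) \<noteq> \<infinity>" by simp
  qed
  define N where "N C = {x\<in>space \<mu>. \<exists>t\<in>C. f t x \<noteq> 0}" for C
  have N_sets: "N C \<in> sets \<mu>" if "countable C" "C \<subseteq> G" for C
  proof -
    have "{x\<in>space \<mu>. f t x \<noteq> 0} \<in> sets \<mu>" if "t \<in> C" for t
    proof -
      have [measurable]: "f t \<in> borel_measurable \<mu>" using f \<open>C \<subseteq> G\<close> that by auto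
      show ?thesis by measurable
    qed
    then have "(\<Union>t\<in>C. {x\<in>space \<mu>. f t x \<noteq> 0}) \<in> sets \<mu>" by (intro sets.countable_UN') (use that in auto)
    also have "(\<Union>t\<in>C. {x\<in>space \<mu>. f t x \<noteq> 0}) = N C" by (auto simp: N_def)
    finally show ?thesis .
  qed
  define \<C> where "\<C> = {C. countable C \<and> C \<subseteq> G}"
  have "(\<lambda>C. emeasure \<eta> (N C)) ` \<C> \<noteq> {}" by (auto simp: \<C>_def)
  from ennreal_Sup_countable_SUP[OF this] obtain v :: "nat \<Rightarrow> ennreal" where
    v: "range v \<subseteq> (\<lambda>C. emeasure \<eta> (N C)) ` \<C>" "Sup ((\<lambda>C. emeasure \<eta> (N C)) ` \<C>) = (SUP n. v n)" by blast
  then have "\<forall>n. \<exists>C\<in>\<C>. v n = emeasure \<eta> (N C)" by auto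
  then obtain D where D: "\<And>n. D n \<in> \<C>" "\<And>n. v n = emeasure \<eta> (N (D n))" by metis
  define C where "C = (\<Union>n. D n)"
  have C: "countable C" "C \<subseteq> G" using D(1) by (auto simp: C_def \<C>_def)
  have bound: "emeasure \<eta> (N E) \<le> emeasure \<eta> (N C)" if "E \<in> \<C>" for E
  proof -
    have "emeasure \<eta> (N E) \<le> Sup ((\<lambda>C. emeasure \<eta> (N C)) ` \<C>)" using that by (rule SUP_upper)
    also have "\<dots> \<le> emeasure \<eta> (N C)" unfolding v(2) D(2)
    proof (intro SUP_least emeasure_mono)
      show "N C \<in> sets \<eta>" using N_sets[OF C] by simp
    qed (auto simp: N_def C_def)
    finally show ?thesis .
  qed
  have AE0: "AE x in \<mu>. x \<in> space \<mu> - N C \<longrightarrow> f t x = 0" if t: "t \<in> G" for t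
  proof -
    have ins: "insert t C \<in> \<C>" using C t by (auto simp: \<C>_def)
    have N2: "N (insert t C) \<in> sets \<eta>" using ins N_sets by (auto simp: \<C>_def)
    have "emeasure \<eta> (N (insert t C) - N C) = emeasure \<eta> (N (insert t C)) - emeasure \<eta> (N C)"
      by (rule emeasure_Diff) (use N_sets[OF C] N2 finite_measure.emeasure_finite[OF fin] in \<open>auto simp: N_def\<close>)
    also have "\<dots> = 0" using bound[OF ins] finite_measure.emeasure_finite[OF fin]
      by (simp add: diff_eq_0_iff_ennreal less_top)
    finally have "N (insert t C) - N C \<in> null_sets \<eta>" using N2 N_sets[OF C] by (auto intro!: null_setsI)
    then have "AE x in \<mu>. x \<notin> N (insert t C) - N C" using AE_not_in AE_l by blast
    then show ?thesis by eventually_elim (auto simp: N_def)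
  qed
  have "emeasure \<mu> (space \<mu> - N C) = 0"
    using fs AE0 N_sets[OF C] unfolding full_support_def
    by (metis not_gr_zero sets.compl_sets)
  then have "AE x in \<mu>. x \<notin> space \<mu> - N C" using N_sets[OF C] by (intro AE_not_in null_setsI) auto
  then have "AE x in \<mu>. \<exists>t\<in>C. f t x \<noteq> 0" using AE_space by eventually_elim (auto simp: N_def)
  with C that show thesis by blast
qed

text \<open>
  With countably many indices \<open>s n\<close> from \<open>full_support_countable\<close>, a set of trajectories is, up to a
  null set of either law, the disjoint union over \<open>n\<close> of its parts on which \<open>s n\<close> is the first
  index with a nonzero coordinate.
\<close>

lemma path_law_eqI:
  assumes sf: "sigma_finite_measure \<mu>" "sigma_finite_measure \<nu>"
    and f: "\<forall>t\<in>G. f t \<in> borel_measurable \<mu>" and g: "\<forall>t\<in>G. g t \<in> borel_measurable \<nu>"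
    and fs: "full_support G \<mu> f" "full_support G \<nu> g" and ne: "G \<noteq> {}"
    and eq: "\<And>t C. t \<in> G \<Longrightarrow> C \<in> sets (path_space G) \<Longrightarrow> C \<subseteq> {y. y t \<noteq> 0} \<Longrightarrow>
      emeasure (path_law G \<mu> f) C = emeasure (path_law G \<nu> g) C"
  shows "path_law G \<mu> f = path_law G \<nu> g"
proof (rule measure_eqI)
  fix A assume "A \<in> sets (path_law G \<mu> f)"
  then have A: "A \<in> sets (path_space G)" by (simp add: path_law_def)
  obtain C1 where C1: "countable C1" "C1 \<subseteq> G" "AE x in \<mu>. \<exists>t\<in>C1. f t x \<noteq> 0"
    using full_support_countable[OF sf(1) f fs(1)] by blast
  obtain C2 where C2: "countable C2" "C2 \<subseteq> G" "AE x in \<nu>. \<exists>t\<in>C2. g t x \<noteq> 0"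
    using full_support_countable[OF sf(2) g fs(2)] by blast
  obtain t0 where t0: "t0 \<in> G" using ne by blast
  define s where "s = from_nat_into (insert t0 (C1 \<union> C2))"
  have rs: "range s = insert t0 (C1 \<union> C2)" unfolding s_def using C1 C2 by (intro range_from_nat_into) auto
  then have sG: "s n \<in> G" for n using C1 C2 t0 by (metis UnE insertE rangeI subsetD)
  define D where "D n = {y\<in>A. y (s n) \<noteq> 0 \<and> (\<forall>m<n. y (s m) = 0)}" for n
  have D_sets: "D n \<in> sets (path_space G)" for n
  proof -
    have [measurable]: "(\<lambda>y. y (s m)) \<in> borel_measurable (path_space G)" for m
      by (rule measurable_component_singleton[OF sG])
    have "{y\<in>space (path_space G). y (s n) \<noteq> 0 \<and> (\<forall>m<n. y (s m) = 0)} \<inter> A \<in> sets (path_space G)"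
      using A by measurable
    also have "{y\<in>space (path_space G). y (s n) \<noteq> 0 \<and> (\<forall>m<n. y (s m) = 0)} \<inter> A = D n"
      using sets.sets_into_space[OF A] by (auto simp: D_def)
    finally show ?thesis .
  qed
  have disj: "disjoint_family D"
    unfolding disjoint_family_on_def D_def using linorder_neqE_nat by blast
  have decomp: "emeasure (path_law G \<rho> h) A = (\<Sum>n. emeasure (path_law G \<rho> h) (D n))"
    if h: "\<forall>t\<in>G. h t \<in> borel_measurable \<rho>" and AE: "AE x in \<rho>. \<exists>n. h (s n) x \<noteq> 0" for \<rho> :: "'x measure" and h
  proof -
    have [measurable]: "(\<lambda>y. y (s m)) \<in> borel_measurable (path_space G)" for m
      by (rule measurable_component_singleton[OF sG])
    have "AE y in path_law G \<rho> h. \<exists>n. y (s n) \<noteq> 0"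
      unfolding path_law_def
    proof (subst AE_distr_iff[OF trajectory_measurable[OF h]])
      show "{y \<in> space (path_space G). \<exists>n. y (s n) \<noteq> 0} \<in> sets (path_space G)" by measurable
      show "AE x in \<rho>. \<exists>n. trajectory G h x (s n) \<noteq> 0" using AE sG by (simp add: trajectory_def)
    qed
    then have "AE y in path_law G \<rho> h. y \<in> A \<longleftrightarrow> y \<in> (\<Union>n. D n)"
    proof eventually_elim
      case (elim y)
      then have "y (s (LEAST n. y (s n) \<noteq> 0)) \<noteq> 0" by (rule LeastI_ex)
      moreover have "y (s m) = 0" if "m < (LEAST n. y (s n) \<noteq> 0)" for m
        using not_less_Least[OF that] by simp
      ultimately have "y \<in> A \<Longrightarrow> y \<in> D (LEAST n. y (s n) \<noteq> 0)" unfolding D_def by blast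
      then show ?case by (auto simp: D_def)
    qed
    then have "emeasure (path_law G \<rho> h) A = emeasure (path_law G \<rho> h) (\<Union>n. D n)"
      by (rule emeasure_eq_AE) (use A D_sets in \<open>auto simp: path_law_def\<close>)
    also have "\<dots> = (\<Sum>n. emeasure (path_law G \<rho> h) (D n))"
      by (rule suminf_emeasure[symmetric]) (use D_sets disj in \<open>auto simp: path_law_def\<close>)
    finally show ?thesis .
  qed
  have "AE x in \<mu>. \<exists>n. f (s n) x \<noteq> 0"
    using C1(3)
  proof eventually_elim
    case (elim x)
    then obtain t where "t \<in> C1" "f t x \<noteq> 0" by blast
    with rs show ?case by (metis UnI1 insertCI rangeE)
  qed
  note e1 = decomp[OF f this]
  have "AE x in \<nu>. \<exists>n. g (s n) x \<noteq> 0"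
    using C2(3)
  proof eventually_elim
    case (elim x)
    then obtain t where "t \<in> C2" "g t x \<noteq> 0" by blast
    with rs show ?case by (metis UnI2 insertCI rangeE)
  qed
  note e2 = decomp[OF g this]
  have "emeasure (path_law G \<mu> f) (D n) = emeasure (path_law G \<nu> g) (D n)" for n
    by (rule eq[OF sG[of n] D_sets]) (auto simp: D_def)
  then show "emeasure (path_law G \<mu> f) A = emeasure (path_law G \<nu> g) A"
    unfolding e1 e2 by simp
qed (simp add: path_law_def)

section \<open>Poisson point processes\<close>

lemma ppp_prob_space: "poisson_point_process P \<mu> J U \<Longrightarrow> prob_space P"
  by (simp add: poisson_point_process_def)

lemma ppp_index_sets: "poisson_point_process P \<mu> J U \<Longrightarrow> {w\<in>space P. i \<in> J w} \<in> sets P"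
  by (simp add: poisson_point_process_def)

lemma ppp_point_measurable:
  "poisson_point_process P \<mu> J U \<Longrightarrow> U i \<in> restrict_space P {w \<in> space P. i \<in> J w} \<rightarrow>\<^sub>M \<mu>"
  by (simp add: poisson_point_process_def)

lemma ppp_point_space:
  assumes "poisson_point_process P \<mu> J U" "w \<in> space P" "i \<in> J w"
  shows "U i w \<in> space \<mu>"
  using measurable_space[OF ppp_point_measurable[OF assms(1)], of w i] assms(2,3)
  by (simp add: space_restrict_space)

lemma ppp_event:
  assumes "poisson_point_process P \<mu> J U" "A \<in> sets \<mu>"
  shows "{w\<in>space P. i \<in> J w \<and> U i w \<in> A} \<in> sets P"
proof -
  have "U i -` A \<inter> space (restrict_space P {w \<in> space P. i \<in> J w}) \<in> sets (restrict_space P {w \<in> space P. i \<in> J w})"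
    by (rule measurable_sets[OF ppp_point_measurable[OF assms(1)] assms(2)])
  then have "U i -` A \<inter> space (restrict_space P {w \<in> space P. i \<in> J w}) \<in> sets P"
    using ppp_index_sets[OF assms(1)] by (subst (asm) sets_restrict_space_iff) auto
  then show ?thesis
    by (rule back_subst[where P="\<lambda>A. A \<in> sets P"]) (auto simp: space_restrict_space)
qed

lemma ppp_count_indep:
  assumes "poisson_point_process P \<mu> J U" "finite F" "F \<subseteq> sets \<mu>" "disjoint F"
  shows "prob_space.indep_vars P (\<lambda>_. borel) (point_count J U) F"
  using assms by (simp add: poisson_point_process_def)

lemma ppp_count_measurable:
  assumes "poisson_point_process P \<mu> J U" "A \<in> sets \<mu>"
  shows "point_count J U A \<in> borel_measurable P"
  using ppp_count_indep[OF assms(1), of "{A}"] assms(2) ppp_prob_space[OF assms(1)]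
  by (auto simp: prob_space.indep_vars_def)

lemma ppp_count_prob:
  assumes "poisson_point_process P \<mu> J U" "A \<in> sets \<mu>" "emeasure \<mu> A < \<infinity>"
  shows "measure P {w\<in>space P. point_count J U A w = of_nat k} =
    measure \<mu> A ^ k / fact k * exp (- measure \<mu> A)"
  using assms by (simp add: poisson_point_process_def)

text \<open>
  The Poisson probabilities of finite counts sum to one.
\<close>

lemma ppp_count_finite:
  assumes ppp: "poisson_point_process P \<mu> J U" and A: "A \<in> sets \<mu>" "emeasure \<mu> A < \<infinity>"
  shows "AE w in P. finite {i \<in> J w. U i w \<in> A}"
proof -
  interpret prob_space P by (rule ppp_prob_space[OF ppp])
  note [measurable] = ppp_count_measurable[OF ppp A(1)]
  define E where "E k = {w\<in>space P. point_count J U A w = of_nat k}" for k :: nat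
  have E: "range E \<subseteq> sets P" unfolding E_def by auto
  have "disjoint_family E" by (auto simp: disjoint_family_on_def E_def)
  from finite_measure_UNION[OF E this]
  have "(\<lambda>k. measure \<mu> A ^ k / fact k * exp (- measure \<mu> A)) sums measure P (\<Union>k. E k)"
    by (simp add: E_def ppp_count_prob[OF ppp A])
  moreover have "(\<lambda>k. measure \<mu> A ^ k / fact k * exp (- measure \<mu> A)) sums (exp (measure \<mu> A) * exp (- measure \<mu> A))"
    using exp_converges[of "measure \<mu> A"] by (intro sums_mult2) (simp add: field_simps)
  ultimately have "measure P (\<Union>k. E k) = 1"
    by (simp add: sums_unique2 exp_minus)
  then have "AE w in P. w \<in> (\<Union>k. E k)" using E by (intro AE_prob_1) auto
  then show ?thesis
  proof eventually_elim
    case (elim w)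
    then obtain k where "point_count J U A w = of_nat k" by (auto simp: E_def)
    then have "emeasure (count_space UNIV) {i \<in> J w. U i w \<in> A} \<noteq> \<infinity>" by (simp add: point_count_def)
    then show ?case by (auto simp: emeasure_count_space split: if_splits)
  qed
qed

section \<open>The trajectory law in the max case\<close>

text \<open>
  The supremum of an unbounded set of reals is an unspecified constant. The event that the values
  are unbounded is measurable and \<open>I_max\<close> is constant on it; elsewhere it is a genuine supremum.
\<close>

lemma I_max_measurable:
  assumes ppp: "poisson_point_process P \<mu> J U" and f: "f \<in> borel_measurable \<mu>"
  shows "I_max J U f \<in> borel_measurable P"
proof (rule borel_measurable_iff_le[THEN iffD2], rule allI)
  fix a :: real
  have ex: "{w\<in>space P. \<exists>i. i \<in> J w \<and> U i w \<in> {x\<in>space \<mu>. f x > k}} \<in> sets P" for k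
  proof -
    have "{x\<in>space \<mu>. f x > k} \<in> sets \<mu>" using f by measurable
    from ppp_event[OF ppp this] have "(\<Union>i. {w\<in>space P. i \<in> J w \<and> U i w \<in> {x\<in>space \<mu>. f x > k}}) \<in> sets P"
      by (intro sets.countable_nat_UN) auto
    then show ?thesis by (rule back_subst[where P="\<lambda>A. A \<in> sets P"]) auto
  qed
  have [measurable]: "Measurable.pred P (\<lambda>w. \<exists>i. i \<in> J w \<and> U i w \<in> {x\<in>space \<mu>. f x > k})" for k
    using ex by (simp add: pred_def)
  have [measurable]: "Measurable.pred P (\<lambda>w. i \<in> J w)" for i
    using ppp_index_sets[OF ppp] by (simp add: pred_def)
  have 1: "I_max J U f w \<le> a \<longleftrightarrow>
      (if \<forall>i. i \<notin> J w then 0 \<le> a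
       else if \<exists>k::nat. \<not> (\<exists>i. i \<in> J w \<and> U i w \<in> {x\<in>space \<mu>. f x > real k})
       then \<not> (\<exists>i. i \<in> J w \<and> U i w \<in> {x\<in>space \<mu>. f x > a})
       else (LEAST z::real. False) \<le> a)" if w: "w \<in> space P" for w
  proof (cases "\<exists>k::nat. \<not> (\<exists>i. i \<in> J w \<and> U i w \<in> {x\<in>space \<mu>. f x > real k})")
    case True
    then obtain k :: nat where k: "\<not> (\<exists>i. i \<in> J w \<and> U i w \<in> {x\<in>space \<mu>. f x > real k})" by blast
    have "f (U i w) \<le> real k" if "i \<in> J w" for i
      using k that ppp_point_space[OF ppp w that] by (auto simp: not_less[symmetric])
    then have "bdd_above ((\<lambda>i. f (U i w)) ` J w)" by (auto intro!: bdd_aboveI2)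
    then have "J w \<noteq> {} \<Longrightarrow> I_max J U f w \<le> a \<longleftrightarrow> (\<forall>i\<in>J w. f (U i w) \<le> a)"
      by (simp add: I_max_def cSUP_le_iff)
    moreover have "(\<forall>i\<in>J w. f (U i w) \<le> a) \<longleftrightarrow> \<not> (\<exists>i. i \<in> J w \<and> U i w \<in> {x\<in>space \<mu>. f x > a})"
      using ppp_point_space[OF ppp w] by (auto simp: not_less[symmetric])
    moreover have "J w = {} \<Longrightarrow> I_max J U f w = 0" by (simp add: I_max_def)
    ultimately show ?thesis using True by auto
  next
    case False
    have "\<not> (\<forall>x\<in>(\<lambda>i. f (U i w)) ` J w. x \<le> z)" for z
    proof
      assume *: "\<forall>x\<in>(\<lambda>i. f (U i w)) ` J w. x \<le> z"
      obtain k :: nat where "z \<le> real k" using real_arch_simple by blast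
      with * have "f (U i w) \<le> real k" if "i \<in> J w" for i using that by fastforce
      then have "\<not> (\<exists>i. i \<in> J w \<and> U i w \<in> {x\<in>space \<mu>. f x > real k})" by (auto simp: not_less[symmetric])
      with False show False by blast
    qed
    then have "(\<lambda>z. \<forall>x\<in>(\<lambda>i. f (U i w)) ` J w. x \<le> z) = (\<lambda>_. False)" by (simp only: not_False_eq_True)
    then have "(SUP i\<in>J w. f (U i w)) = (LEAST z::real. False)" unfolding Sup_real_def by (rule arg_cong)
    with False show ?thesis by (auto simp: I_max_def)
  qed
  have "{w \<in> space P. I_max J U f w \<le> a} = {w \<in> space P. (if \<forall>i. i \<notin> J w then 0 \<le> a
       else if \<exists>k::nat. \<not> (\<exists>i. i \<in> J w \<and> U i w \<in> {x\<in>space \<mu>. f x > real k})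
       then \<not> (\<exists>i. i \<in> J w \<and> U i w \<in> {x\<in>space \<mu>. f x > a})
       else (LEAST z::real. False) \<le> a)}"
    using 1 by blast
  also have "\<dots> \<in> sets P" by measurable
  finally show "{w \<in> space P. I_max J U f w \<le> a} \<in> sets P" .
qed

lemma L_maxD:
  assumes "f \<in> L_max \<mu>"
  shows "f \<in> borel_measurable \<mu>" "AE x in \<mu>. 0 \<le> f x" "a > 0 \<Longrightarrow> emeasure \<mu> {x\<in>space \<mu>. f x > a} < \<infinity>"
  using assms by (auto simp: L_max_def)

lemma I_max_le_AE:
  assumes ppp: "poisson_point_process P \<mu> J U" and f: "f \<in> L_max \<mu>" and a: "a > 0"
  shows "AE w in P. I_max J U f w \<le> a \<longleftrightarrow> (\<forall>i\<in>J w. f (U i w) \<le> a)"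
proof -
  note [measurable] = L_maxD(1)[OF f]
  have "AE w in P. finite {i\<in>J w. U i w \<in> {x\<in>space \<mu>. f x > 1}}"
    by (rule ppp_count_finite[OF ppp]) (use L_maxD(3)[OF f, of 1] in auto)
  with AE_space show ?thesis
  proof eventually_elim
    case (elim w)
    have "(\<lambda>i. f (U i w)) ` J w \<subseteq> {..1} \<union> (\<lambda>i. f (U i w)) ` {i\<in>J w. U i w \<in> {x\<in>space \<mu>. f x > 1}}"
      using ppp_point_space[OF ppp elim(1)] by (auto simp: not_le[symmetric])
    moreover have "bdd_above \<dots>" using elim(2) by (simp add: bdd_above_finite)
    ultimately have "bdd_above ((\<lambda>i. f (U i w)) ` J w)" by (rule bdd_above_mono[rotated])
    then show ?case using a by (auto simp: I_max_def cSUP_le_iff)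
  qed
qed

lemma exceedance_finite:
  assumes "finite I" "\<And>t. t \<in> I \<Longrightarrow> f t \<in> L_max \<mu>" "\<And>t. t \<in> I \<Longrightarrow> x t > 0"
  shows "{z\<in>space \<mu>. \<exists>t\<in>I. f t z > x t} \<in> sets \<mu>" "emeasure \<mu> {z\<in>space \<mu>. \<exists>t\<in>I. f t z > x t} < \<infinity>"
proof -
  have s: "{z\<in>space \<mu>. f t z > x t} \<in> sets \<mu>" if "t \<in> I" for t
    using L_maxD(1)[OF assms(2)[OF that]] by measurable
  have eq: "{z\<in>space \<mu>. \<exists>t\<in>I. f t z > x t} = (\<Union>t\<in>I. {z\<in>space \<mu>. f t z > x t})" by auto
  show "{z\<in>space \<mu>. \<exists>t\<in>I. f t z > x t} \<in> sets \<mu>"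
    unfolding eq by (intro sets.finite_UN assms s)
  have "emeasure \<mu> (\<Union>t\<in>I. {z\<in>space \<mu>. f t z > x t}) \<le> (\<Sum>t\<in>I. emeasure \<mu> {z\<in>space \<mu>. f t z > x t})"
    using s assms(1) by (intro emeasure_subadditive_finite) auto
  also have "\<dots> < \<infinity>"
  proof -
    have "emeasure \<mu> {z\<in>space \<mu>. f t z > x t} < \<infinity>" if "t \<in> I" for t
      by (rule L_maxD(3)) (use assms that in auto)
    then show ?thesis using assms(1) by (simp add: less_top)
  qed
  finally show "emeasure \<mu> {z\<in>space \<mu>. \<exists>t\<in>I. f t z > x t} < \<infinity>" by (simp add: eq)
qed

text \<open>
  The field stays below the thresholds precisely if no point of the process falls into the
  exceedance set, whose count is Poisson with finite mean.
\<close>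

lemma max_spectral_rep_prob:
  assumes X: "random_field G M X" and ppp: "poisson_point_process P \<mu> J U"
    and rep: "max_spectral_rep G M X P J U \<mu> f"
    and I: "finite I" "I \<subseteq> G" and x: "\<And>t. t \<in> I \<Longrightarrow> x t > 0"
  shows "emeasure (fdd M X I) {y\<in>space (path_space I). \<forall>t\<in>I. y t \<le> x t} =
    ennreal (exp (- measure \<mu> {z\<in>space \<mu>. \<exists>t\<in>I. f t z > x t}))"
proof -
  interpret P: prob_space P by (rule ppp_prob_space[OF ppp])
  define A where "A = {z\<in>space \<mu>. \<exists>t\<in>I. f t z > x t}"
  have fL: "f t \<in> L_max \<mu>" if "t \<in> I" for t using rep I that by (auto simp: max_spectral_rep_def)
  have A: "A \<in> sets \<mu>" "emeasure \<mu> A < \<infinity>" unfolding A_def using exceedance_finite[OF I(1) fL x] by auto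
  have meas: "(\<lambda>w. \<lambda>t\<in>I. I_max J U (f t) w) \<in> P \<rightarrow>\<^sub>M path_space I"
    by (intro measurable_restrict I_max_measurable[OF ppp] L_maxD fL)
  have B: "{y\<in>space (path_space I). \<forall>t\<in>I. y t \<le> x t} \<in> sets (path_space I)"
    using I(1) by measurable
  have "AE w in P. \<forall>t\<in>I. I_max J U (f t) w \<le> x t \<longleftrightarrow> (\<forall>i\<in>J w. f t (U i w) \<le> x t)"
    using I_max_le_AE[OF ppp fL x] I(1) by (intro AE_finite_allI)
  then have AE: "AE w in P. (\<forall>t\<in>I. I_max J U (f t) w \<le> x t) \<longleftrightarrow> point_count J U A w = of_nat 0"
    using AE_space
  proof eventually_elim
    case (elim w)
    have "point_count J U A w = of_nat 0 \<longleftrightarrow> {i\<in>J w. U i w \<in> A} = {}"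
      by (auto simp: point_count_def emeasure_count_space_eq_0)
    with elim ppp_point_space[OF ppp elim(2)] show ?case
      by (auto simp: A_def not_less[symmetric])
  qed
  have "fdd M X I = fdd P (\<lambda>t. I_max J U (f t)) I" using rep I by (auto simp: max_spectral_rep_def fdd_eq_def)
  then have "emeasure (fdd M X I) {y\<in>space (path_space I). \<forall>t\<in>I. y t \<le> x t} =
      emeasure P ((\<lambda>w. \<lambda>t\<in>I. I_max J U (f t) w) -` {y\<in>space (path_space I). \<forall>t\<in>I. y t \<le> x t} \<inter> space P)"
    by (simp add: fdd_def emeasure_distr[OF meas B])
  also have "\<dots> = emeasure P {w\<in>space P. point_count J U A w = of_nat 0}"
  proof (rule emeasure_eq_AE)
    show "AE w in P. (w \<in> (\<lambda>w. \<lambda>t\<in>I. I_max J U (f t) w) -` {y\<in>space (path_space I). \<forall>t\<in>I. y t \<le> x t} \<inter> space P) =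
        (w \<in> {w\<in>space P. point_count J U A w = of_nat 0})"
      using AE AE_space by eventually_elim (auto simp: space_PiM)
    show "{w\<in>space P. point_count J U A w = of_nat 0} \<in> sets P"
      using ppp_count_measurable[OF ppp A(1)] by measurable
  qed (rule measurable_sets[OF meas B])
  also have "\<dots> = ennreal (exp (- measure \<mu> A))"
    unfolding P.emeasure_eq_measure ppp_count_prob[OF ppp A] by simp
  finally show ?thesis by (simp add: A_def)
qed

lemma max_spectral_rep_exceedance_eq:
  assumes X: "random_field G M X"
    and ppp1: "poisson_point_process P1 \<mu> J1 U1" and rep1: "max_spectral_rep G M X P1 J1 U1 \<mu> f"
    and ppp2: "poisson_point_process P2 \<nu> J2 U2" and rep2: "max_spectral_rep G M X P2 J2 U2 \<nu> g"
    and I: "finite I" "I \<subseteq> G" and x: "\<And>t. t \<in> I \<Longrightarrow> x t > 0"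
  shows "emeasure \<mu> {z\<in>space \<mu>. \<exists>t\<in>I. f t z > x t} = emeasure \<nu> {z\<in>space \<nu>. \<exists>t\<in>I. g t z > x t}"
proof -
  have L: "f t \<in> L_max \<mu>" "g t \<in> L_max \<nu>" if "t \<in> I" for t
    using rep1 rep2 I that by (auto simp: max_spectral_rep_def)
  have "measure \<mu> {z\<in>space \<mu>. \<exists>t\<in>I. f t z > x t} = measure \<nu> {z\<in>space \<nu>. \<exists>t\<in>I. g t z > x t}"
    using max_spectral_rep_prob[OF X ppp1 rep1 I x] max_spectral_rep_prob[OF X ppp2 rep2 I x] by simp
  then show ?thesis
    using exceedance_finite(2)[of I f \<mu> x, OF I(1) L(1) x] exceedance_finite(2)[of I g \<nu> x, OF I(1) L(2) x]
    by (simp add: emeasure_eq_ennreal_measure less_top)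
qed

text \<open>
  For positive thresholds, the lower orthant \<open>{y t \<le> x t, t \<in> I}\<close> inside \<open>{y s > \<epsilon>}\<close> is the
  difference of two exceedance unions, the larger one having the additional threshold \<open>\<epsilon>\<close> at \<open>s\<close>.
  Nonnegative thresholds follow by continuity from above; with a negative threshold the orthant is
  null because the functions are nonnegative. Lower orthants are closed under intersection and
  generate the product sigma-algebra.
\<close>

lemma exceedances_determine_law:
  assumes f: "\<forall>t\<in>G. f t \<in> L_max \<mu>" and g: "\<forall>t\<in>G. g t \<in> L_max \<nu>"
    and exc: "\<And>I x. finite I \<Longrightarrow> I \<subseteq> G \<Longrightarrow> (\<And>t. t \<in> I \<Longrightarrow> x t > (0::real)) \<Longrightarrow>
      emeasure \<mu> {z\<in>space \<mu>. \<exists>t\<in>I. f t z > x t} = emeasure \<nu> {z\<in>space \<nu>. \<exists>t\<in>I. g t z > x t}"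
    and s: "s \<in> G" and C: "C \<in> sets (path_space G)" "C \<subseteq> {y. y s \<noteq> 0}"
  shows "emeasure (path_law G \<mu> f) C = emeasure (path_law G \<nu> g) C"
proof -
  have fm: "\<forall>t\<in>G. f t \<in> borel_measurable \<mu>" and gm: "\<forall>t\<in>G. g t \<in> borel_measurable \<nu>"
    using f g by (auto simp: L_max_def)
  have sets_law[simp]: "sets (path_law G \<rho> h) = sets (path_space G)" "space (path_law G \<rho> h) = space (path_space G)"
    for \<rho> :: "'x measure" and h by (simp_all add: path_law_def)
  define Q where "Q \<epsilon> = {y\<in>space (path_space G). y s > \<epsilon>}" for \<epsilon> :: real
  have Q: "Q \<epsilon> \<in> sets (path_space G)" for \<epsilon>
    unfolding Q_def using measurable_component_singleton[OF s, of "\<lambda>_. borel::real measure"] by measurable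
  define E where "E I x = {y\<in>space (path_space G). \<forall>t\<in>I. y t \<le> (x t::real)}" for I x
  have E: "E I x \<in> sets (path_space G)" if "finite I" "I \<subseteq> G" for I x
  proof -
    have [measurable]: "(\<lambda>y. y t) \<in> borel_measurable (path_space G)" if "t \<in> I" for t
      using \<open>I \<subseteq> G\<close> that by (intro measurable_component_singleton) auto
    show ?thesis unfolding E_def using \<open>finite I\<close> by measurable
  qed
  have law_emeasure: "emeasure (path_law G \<rho> h) B = emeasure \<rho> {z\<in>space \<rho>. trajectory G h z \<in> B}"
    if "\<forall>t\<in>G. h t \<in> borel_measurable \<rho>" "B \<in> sets (path_space G)" for \<rho> :: "'x measure" and h B
    unfolding path_law_def using emeasure_distr[OF trajectory_measurable[OF that(1)] that(2)]
    by (simp add: vimage_def Int_def conj_commute)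
  have orth_pos: "emeasure (path_law G \<rho> h) (Q \<epsilon> \<inter> E I x) =
      emeasure \<rho> {z\<in>space \<rho>. \<exists>t\<in>insert s I. h t z > (if t = s then if s \<in> I then min (x s) \<epsilon> else \<epsilon> else x t)}
      - emeasure \<rho> {z\<in>space \<rho>. \<exists>t\<in>I. h t z > x t}"
    if h: "\<forall>t\<in>G. h t \<in> L_max \<rho>" and \<epsilon>: "\<epsilon> > 0" and I: "finite I" "I \<subseteq> G" and x: "\<And>t. t \<in> I \<Longrightarrow> x t > 0"
    for \<rho> :: "'x measure" and h \<epsilon> I x
  proof -
    \<comment> \<open>The thresholds of the larger union; if \<open>s\<close> itself belongs to \<open>I\<close>, the lower one counts.\<close>
    define x' where "x' t = (if t = s then if s \<in> I then min (x s) \<epsilon> else \<epsilon> else x t)" for t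
    have x': "x' t > 0" if "t \<in> insert s I" for t using that \<epsilon> x by (auto simp: x'_def)
    have hm: "\<forall>t\<in>G. h t \<in> borel_measurable \<rho>" using h by (auto simp: L_max_def)
    have QE: "Q \<epsilon> \<inter> E I x \<in> sets (path_space G)" using Q E I by auto
    have "emeasure (path_law G \<rho> h) (Q \<epsilon> \<inter> E I x) = emeasure \<rho>
      ({z\<in>space \<rho>. \<exists>t\<in>insert s I. h t z > x' t} - {z\<in>space \<rho>. \<exists>t\<in>I. h t z > x t})"
      unfolding law_emeasure[OF hm QE]
      using measurable_space[OF trajectory_measurable[OF hm]] s I(2)
      by (intro arg_cong[where f="emeasure \<rho>"])
         (auto simp: Q_def E_def trajectory_def x'_def not_less subset_iff min_def split: if_splits)
    also have "\<dots> = emeasure \<rho> {z\<in>space \<rho>. \<exists>t\<in>insert s I. h t z > x' t}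
        - emeasure \<rho> {z\<in>space \<rho>. \<exists>t\<in>I. h t z > x t}"
    proof (rule emeasure_Diff)
      show "{z\<in>space \<rho>. \<exists>t\<in>insert s I. h t z > x' t} \<in> sets \<rho>"
        by (rule exceedance_finite) (use I h s x' in auto)
      show "{z\<in>space \<rho>. \<exists>t\<in>I. h t z > x t} \<in> sets \<rho>"
        by (rule exceedance_finite) (use I h x in auto)
      have "emeasure \<rho> {z\<in>space \<rho>. \<exists>t\<in>I. h t z > x t} < \<infinity>"
        by (rule exceedance_finite) (use I h x in auto)
      then show "emeasure \<rho> {z\<in>space \<rho>. \<exists>t\<in>I. h t z > x t} \<noteq> \<infinity>" by simp
      show "{z\<in>space \<rho>. \<exists>t\<in>I. h t z > x t} \<subseteq> {z\<in>space \<rho>. \<exists>t\<in>insert s I. h t z > x' t}"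
      proof -
        have "x' t \<le> x t" if "t \<in> I" for t using that by (auto simp: x'_def)
        then show ?thesis by (blast intro: le_less_trans)
      qed
    qed
    finally show ?thesis by (simp only: x'_def)
  qed
  have fin: "emeasure (path_law G \<rho> h) (Q \<epsilon>) < \<infinity>"
    if h: "\<forall>t\<in>G. h t \<in> L_max \<rho>" and \<epsilon>: "\<epsilon> > 0" for \<rho> :: "'x measure" and h \<epsilon>
  proof -
    have hm: "\<forall>t\<in>G. h t \<in> borel_measurable \<rho>" using h by (auto simp: L_max_def)
    have "{z\<in>space \<rho>. trajectory G h z \<in> Q \<epsilon>} = {z\<in>space \<rho>. h s z > \<epsilon>}"
      using measurable_space[OF trajectory_measurable[OF hm]] s by (auto simp: Q_def trajectory_def)
    then show ?thesis unfolding law_emeasure[OF hm Q] using L_maxD(3)[OF bspec[OF h s] \<epsilon>] by simp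
  qed
  have orth: "emeasure (path_law G \<mu> f) (Q \<epsilon> \<inter> E I x) = emeasure (path_law G \<nu> g) (Q \<epsilon> \<inter> E I x)"
    if \<epsilon>: "\<epsilon> > 0" and I: "finite I" "I \<subseteq> G" for \<epsilon> I x
  proof (cases "\<forall>t\<in>I. x t \<ge> 0")
    case True
    have lim: "(\<lambda>n. emeasure (path_law G \<rho> h) (Q \<epsilon> \<inter> E I (\<lambda>t. x t + 1 / Suc n))) \<longlonglongrightarrow> emeasure (path_law G \<rho> h) (Q \<epsilon> \<inter> E I x)"
      if h: "\<forall>t\<in>G. h t \<in> L_max \<rho>" for \<rho> :: "'x measure" and h
    proof -
      have "(\<lambda>n. emeasure (path_law G \<rho> h) (Q \<epsilon> \<inter> E I (\<lambda>t. x t + 1 / Suc n))) \<longlonglongrightarrow>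
          emeasure (path_law G \<rho> h) (\<Inter>n. Q \<epsilon> \<inter> E I (\<lambda>t. x t + 1 / Suc n))"
      proof (rule Lim_emeasure_decseq)
        show "range (\<lambda>n. Q \<epsilon> \<inter> E I (\<lambda>t. x t + 1 / Suc n)) \<subseteq> sets (path_law G \<rho> h)" using Q E[OF I] by auto
        show "decseq (\<lambda>n. Q \<epsilon> \<inter> E I (\<lambda>t. x t + 1 / Suc n))"
        proof (rule decseq_SucI, intro Int_mono order_refl subsetI)
          fix n y assume y: "y \<in> E I (\<lambda>t. x t + 1 / real (Suc (Suc n)))"
          have "1 / real (Suc (Suc n)) \<le> 1 / real (Suc n)" by (intro divide_left_mono) auto
          with y show "y \<in> E I (\<lambda>t. x t + 1 / real (Suc n))" unfolding E_def by fastforce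
        qed
        fix n
        have "emeasure (path_law G \<rho> h) (Q \<epsilon> \<inter> E I (\<lambda>t. x t + 1 / Suc n)) \<le> emeasure (path_law G \<rho> h) (Q \<epsilon>)"
          using Q by (intro emeasure_mono) auto
        then show "emeasure (path_law G \<rho> h) (Q \<epsilon> \<inter> E I (\<lambda>t. x t + 1 / Suc n)) \<noteq> \<infinity>"
          using fin[OF h \<epsilon>] by (auto simp: top_unique)
      qed
      moreover have "(\<Inter>n. Q \<epsilon> \<inter> E I (\<lambda>t. x t + 1 / Suc n)) = Q \<epsilon> \<inter> E I x"
      proof (intro equalityI subsetI)
        fix y assume y: "y \<in> (\<Inter>n. Q \<epsilon> \<inter> E I (\<lambda>t. x t + 1 / Suc n))"
        have "y t \<le> x t" if "t \<in> I" for t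
        proof (rule LIMSEQ_le_const)
          show "(\<lambda>n. x t + 1 / Suc n) \<longlonglongrightarrow> x t"
            using tendsto_add[OF tendsto_const[of "x t"] LIMSEQ_inverse_real_of_nat] by (simp add: inverse_eq_divide)
          show "\<exists>N. \<forall>n\<ge>N. y t \<le> x t + 1 / Suc n" using y that by (auto simp: E_def)
        qed
        then show "y \<in> Q \<epsilon> \<inter> E I x" using y by (auto simp: E_def)
      next
        fix y assume y: "y \<in> Q \<epsilon> \<inter> E I x"
        have "y t \<le> x t + 1 / Suc n" if "t \<in> I" for t n
          using y that by (auto simp: E_def intro: add_increasing2)
        with y show "y \<in> (\<Inter>n. Q \<epsilon> \<inter> E I (\<lambda>t. x t + 1 / Suc n))" by (auto simp: E_def)
      qed
      ultimately show ?thesis by simp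
    qed
    have "emeasure (path_law G \<mu> f) (Q \<epsilon> \<inter> E I (\<lambda>t. x t + 1 / Suc n)) =
        emeasure (path_law G \<nu> g) (Q \<epsilon> \<inter> E I (\<lambda>t. x t + 1 / Suc n))" for n
    proof -
      have p: "x t + 1 / Suc n > 0" if "t \<in> I" for t using True that by (auto intro: add_nonneg_pos)
      let ?y = "\<lambda>t. x t + 1 / real (Suc n)"
      let ?y' = "\<lambda>t. if t = s then if s \<in> I then min (?y s) \<epsilon> else \<epsilon> else ?y t"
      have m1: "emeasure \<mu> {z\<in>space \<mu>. \<exists>t\<in>insert s I. f t z > ?y' t} = emeasure \<nu> {z\<in>space \<nu>. \<exists>t\<in>insert s I. g t z > ?y' t}"
        by (rule exc) (use I s p \<epsilon> in auto)
      have m2: "emeasure \<mu> {z\<in>space \<mu>. \<exists>t\<in>I. f t z > ?y t} = emeasure \<nu> {z\<in>space \<nu>. \<exists>t\<in>I. g t z > ?y t}"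
        by (rule exc) (use I p in auto)
      show ?thesis
        using orth_pos[OF f \<epsilon> I, of ?y, OF p] orth_pos[OF g \<epsilon> I, of ?y, OF p] unfolding m1 m2 by (rule trans[OF _ sym])
    qed
    then have "(\<lambda>n. emeasure (path_law G \<mu> f) (Q \<epsilon> \<inter> E I (\<lambda>t. x t + 1 / Suc n))) \<longlonglongrightarrow> emeasure (path_law G \<nu> g) (Q \<epsilon> \<inter> E I x)"
      using lim[OF g] by presburger
    with lim[OF f] show ?thesis by (rule LIMSEQ_unique)
  next
    case False
    then obtain t where t: "t \<in> I" "x t < 0" by (auto simp: not_le)
    have null: "emeasure (path_law G \<rho> h) (Q \<epsilon> \<inter> E I x) = 0" if h: "\<forall>t\<in>G. h t \<in> L_max \<rho>" for \<rho> :: "'x measure" and h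
    proof -
      have hm: "\<forall>t\<in>G. h t \<in> borel_measurable \<rho>" using h by (auto simp: L_max_def)
      have QE: "Q \<epsilon> \<inter> E I x \<in> sets (path_space G)" using Q E I by auto
      have "AE z in \<rho>. 0 \<le> h t z" using h t I by (auto simp: L_max_def)
      then have "AE z in \<rho>. \<not> (trajectory G h z \<in> Q \<epsilon> \<inter> E I x)"
        by eventually_elim (use t I in \<open>force simp: E_def trajectory_def\<close>)
      then have "{z\<in>space \<rho>. trajectory G h z \<in> Q \<epsilon> \<inter> E I x} \<in> null_sets \<rho>"
        using measurable_sets[OF trajectory_measurable[OF hm] QE]
        by (subst AE_iff_null_sets) (auto simp: vimage_def Int_def conj_commute elim!: eventually_mono)
      then show ?thesis unfolding law_emeasure[OF hm QE] by auto
    qed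
    show ?thesis using null[OF f] null[OF g] by (rule trans[OF _ sym])
  qed
  have restr: "density (path_law G \<mu> f) (indicator (Q \<epsilon>)) = density (path_law G \<nu> g) (indicator (Q \<epsilon>))"
    if \<epsilon>: "\<epsilon> > 0" for \<epsilon>
  proof (rule measure_eqI_generator_eq[where \<Omega>="space (path_space G)" and A="\<lambda>_. space (path_space G)"
      and E="{E I x |I x. finite I \<and> I \<subseteq> G}"])
    let ?E = "{E I x |I x. finite I \<and> I \<subseteq> G}"
    show "Int_stable ?E"
    proof (rule Int_stableI)
      fix a b assume "a \<in> ?E" "b \<in> ?E"
      then obtain I x K y where *: "a = E I x" "b = E K y" "finite I" "I \<subseteq> G" "finite K" "K \<subseteq> G" by blast
      have "a \<inter> b = E (I \<union> K) (\<lambda>t. if t \<in> I then if t \<in> K then min (x t) (y t) else x t else y t)"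
        unfolding * E_def by (auto split: if_splits)
      with * show "a \<inter> b \<in> ?E" by blast
    qed
    show E_Pow: "?E \<subseteq> Pow (space (path_space G))" by (auto simp: E_def)
    show "emeasure (density (path_law G \<mu> f) (indicator (Q \<epsilon>))) B = emeasure (density (path_law G \<nu> g) (indicator (Q \<epsilon>))) B"
      if B_E: "B \<in> ?E" for B
    proof -
      obtain I x where B: "B = E I x" "finite I" "I \<subseteq> G" using B_E by blast
      then show ?thesis using orth[OF \<epsilon>] Q E by (simp add: emeasure_restricted)
    qed
    have gen: "sets (path_space G) = sigma_sets (space (path_space G)) ?E"
    proof (rule antisym)
      show "sigma_sets (space (path_space G)) ?E \<subseteq> sets (path_space G)"
        using E by (intro sets.sigma_sets_subset) auto
      have "(\<lambda>y. y) \<in> sigma (space (path_space G)) ?E \<rightarrow>\<^sub>M path_space G"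
      proof (rule measurable_PiM_single')
        fix t assume t: "t \<in> G"
        show "(\<lambda>y. y t) \<in> borel_measurable (sigma (space (path_space G)) ?E)"
        proof (rule borel_measurable_iff_le[THEN iffD2], rule allI)
          fix a :: real
          have "{y\<in>space (path_space G). y t \<le> a} = E {t} (\<lambda>_. a)" by (auto simp: E_def)
          then show "{y \<in> space (sigma (space (path_space G)) ?E). y t \<le> a} \<in> sets (sigma (space (path_space G)) ?E)"
            using E_Pow t by (auto intro!: sigma_sets.Basic)
        qed
      qed (use E_Pow in \<open>simp add: space_PiM\<close>)
      note id_meas = this
      show "sets (path_space G) \<subseteq> sigma_sets (space (path_space G)) ?E"
      proof
        fix B assume B: "B \<in> sets (path_space G)"
        have "(\<lambda>y. y) -` B \<inter> space (path_space G) \<in> sigma_sets (space (path_space G)) ?E"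
          using measurable_sets[OF id_meas B] E_Pow by simp
        then show "B \<in> sigma_sets (space (path_space G)) ?E"
          using sets.sets_into_space[OF B] by (simp add: Int_absorb2)
      qed
    qed
    show "sets (density (path_law G \<mu> f) (indicator (Q \<epsilon>))) = sigma_sets (space (path_space G)) ?E" using gen by simp
    show "sets (density (path_law G \<nu> g) (indicator (Q \<epsilon>))) = sigma_sets (space (path_space G)) ?E" using gen by simp
    \<comment> \<open>The orthant without constraints.\<close>
    have "space (path_space G) = E {} undefined" by (simp add: E_def)
    then show "range (\<lambda>_::nat. space (path_space G)) \<subseteq> ?E" by blast
    show "emeasure (density (path_law G \<mu> f) (indicator (Q \<epsilon>))) (space (path_space G)) \<noteq> \<infinity>"
      using fin[OF f \<epsilon>] Q sets.sets_into_space[OF Q] by (simp add: emeasure_restricted Int_absorb2)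
  qed simp
  have lim: "(\<lambda>n. emeasure (path_law G \<rho> h) (Q (1 / Suc n) \<inter> C)) \<longlonglongrightarrow> emeasure (path_law G \<rho> h) C"
    if h: "\<forall>t\<in>G. h t \<in> L_max \<rho>" for \<rho> :: "'x measure" and h
  proof -
    have hm: "\<forall>t\<in>G. h t \<in> borel_measurable \<rho>" using h by (auto simp: L_max_def)
    have "incseq (\<lambda>n. Q (1 / Suc n) \<inter> C)"
    proof (rule incseq_SucI, intro Int_mono order_refl subsetI)
      fix n y assume y: "y \<in> Q (1 / real (Suc n))"
      have "1 / real (Suc (Suc n)) \<le> 1 / real (Suc n)" by (intro divide_left_mono) auto
      with y show "y \<in> Q (1 / real (Suc (Suc n)))" unfolding Q_def by auto
    qed
    then have "(\<lambda>n. emeasure (path_law G \<rho> h) (Q (1 / Suc n) \<inter> C)) \<longlonglongrightarrow> emeasure (path_law G \<rho> h) (\<Union>n. Q (1 / Suc n) \<inter> C)"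
      using Q C(1) by (intro Lim_emeasure_incseq) auto
    also have "emeasure (path_law G \<rho> h) (\<Union>n. Q (1 / Suc n) \<inter> C) = emeasure (path_law G \<rho> h) C"
    proof (rule emeasure_eq_AE)
      have "AE z in \<rho>. 0 \<le> h s z" using h s by (auto simp: L_max_def)
      then have "AE y in path_law G \<rho> h. 0 \<le> y s"
        unfolding path_law_def by (subst AE_distr_iff[OF trajectory_measurable[OF hm]])
          (use measurable_component_singleton[OF s, of "\<lambda>_. borel::real measure"] s in \<open>auto simp: trajectory_def\<close>)
      then show "AE y in path_law G \<rho> h. (y \<in> (\<Union>n. Q (1 / Suc n) \<inter> C)) = (y \<in> C)"
      proof eventually_elim
        case (elim y)
        show ?case
        proof
          assume y: "y \<in> C"
          then have "y s > 0" using elim C(2) by force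
          then obtain n where "inverse (real (Suc n)) < y s" using reals_Archimedean by blast
          then show "y \<in> (\<Union>n. Q (1 / Suc n) \<inter> C)" using y sets.sets_into_space[OF C(1)]
            by (auto simp: Q_def inverse_eq_divide)
        qed auto
      qed
    qed (use Q C(1) in auto)
    finally show ?thesis .
  qed
  have "emeasure (path_law G \<mu> f) (Q (1 / Suc n) \<inter> C) = emeasure (path_law G \<nu> g) (Q (1 / Suc n) \<inter> C)" for n
    using arg_cong[OF restr[of "1 / Suc n"], of "\<lambda>M. emeasure M C"] Q C(1) by (simp add: emeasure_restricted)
  then have "(\<lambda>n. emeasure (path_law G \<mu> f) (Q (1 / Suc n) \<inter> C)) \<longlonglongrightarrow> emeasure (path_law G \<nu> g) C"
    using lim[OF g] by presburger
  with lim[OF f] show ?thesis by (rule LIMSEQ_unique)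
qed

section \<open>Characteristic functions of Poisson sums\<close>

lemma ppp_count_AE_nat:
  assumes ppp: "poisson_point_process P \<mu> J U" and A: "A \<in> sets \<mu>" "emeasure \<mu> A < \<infinity>"
  shows "AE w in P. \<exists>k::nat. point_count J U A w = of_nat k"
  using ppp_count_finite[OF assms] by eventually_elim (auto simp: point_count_def)

text \<open>
  The characteristic function of a Poisson variable with mean \<open>\<mu> A\<close>, as a power series.
\<close>

lemma ppp_count_char:
  assumes ppp: "poisson_point_process P \<mu> J U" and A: "A \<in> sets \<mu>" "emeasure \<mu> A < \<infinity>"
  shows "(CLINT w|P. iexp (c * enn2real (point_count J U A w))) = exp (measure \<mu> A *\<^sub>R (iexp c - 1))"
proof -
  interpret prob_space P by (rule ppp_prob_space[OF ppp])
  define m where "m = measure \<mu> A"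
  note N[measurable] = ppp_count_measurable[OF ppp A(1)]
  define E where "E k = {w\<in>space P. point_count J U A w = of_nat k}" for k :: nat
  have E[measurable]: "E k \<in> sets P" for k unfolding E_def by measurable
  have PE: "measure P (E k) = m ^ k / fact k * exp (- m)" for k
    unfolding E_def m_def by (rule ppp_count_prob[OF ppp A])
  define s where "s n w = (\<Sum>k<n. indicat_real (E k) w *\<^sub>R iexp (c * real k))" for n w
  have s_eq: "s n w = (if k0 < n then iexp (c * real k0) else 0)" if "w \<in> E k0" for n w k0
  proof -
    have "s n w = (\<Sum>k<n. if k = k0 then iexp (c * real k) else 0)"
      unfolding s_def using that by (intro sum.cong) (auto simp: E_def indicator_def)
    then show ?thesis by (simp add: sum.delta)
  qed
  have s_norm: "norm (s n w) \<le> 1" for n w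
  proof (cases "\<exists>k. w \<in> E k")
    case True
    then show ?thesis using s_eq by auto
  next
    case False
    then show ?thesis unfolding s_def by simp
  qed
  have "(\<lambda>n. CLINT w|P. s n w) \<longlonglongrightarrow> (CLINT w|P. iexp (c * enn2real (point_count J U A w)))"
  proof (rule integral_dominated_convergence[where w="\<lambda>_. 1"])
    show "AE w in P. (\<lambda>n. s n w) \<longlonglongrightarrow> iexp (c * enn2real (point_count J U A w))"
      using ppp_count_AE_nat[OF ppp A] AE_space
    proof eventually_elim
      case (elim w)
      then obtain k where k: "point_count J U A w = of_nat k" by blast
      then have "w \<in> E k" using elim by (simp add: E_def)
      then have "eventually (\<lambda>n. s n w = iexp (c * real k)) sequentially"
        using eventually_gt_at_top[of k] by (auto elim!: eventually_mono simp: s_eq)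
      then have "(\<lambda>n. s n w) \<longlonglongrightarrow> iexp (c * real k)" by (rule tendsto_eventually)
      then show ?case by (simp add: k enn2real_of_nat)
    qed
    show "s n \<in> borel_measurable P" for n unfolding s_def[abs_def] by measurable
  qed (use s_norm in auto)
  moreover have "(CLINT w|P. s n w) = (\<Sum>k<n. measure P (E k) *\<^sub>R iexp (c * real k))" for n
    unfolding s_def by (subst Bochner_Integration.integral_sum) (auto intro!: integrable_scaleR_left simp: less_top[symmetric])
  ultimately have "(\<lambda>k. measure P (E k) *\<^sub>R iexp (c * real k)) sums (CLINT w|P. iexp (c * enn2real (point_count J U A w)))"
    by (simp add: sums_def)
  moreover have "(\<lambda>k. measure P (E k) *\<^sub>R iexp (c * real k)) sums (exp (- complex_of_real m) * exp (complex_of_real m * iexp c))"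
  proof -
    have "(\<lambda>k. exp (- complex_of_real m) * ((complex_of_real m * iexp c) ^ k /\<^sub>R fact k)) sums (exp (- complex_of_real m) * exp (complex_of_real m * iexp c))"
      by (intro sums_mult exp_converges)
    moreover have "exp (- complex_of_real m) * ((complex_of_real m * iexp c) ^ k /\<^sub>R fact k) = measure P (E k) *\<^sub>R iexp (c * real k)" for k
    proof -
      have "iexp c ^ k = iexp (c * real k)" by (simp add: exp_of_nat_mult[symmetric] mult_ac)
      moreover have "complex_of_real (exp (- m)) = exp (- complex_of_real m)"
        using exp_of_real[of "-m", where ?'a=complex] by simp
      ultimately show ?thesis
        unfolding PE scaleR_conv_of_real power_mult_distrib by (simp add: field_simps)
    qed
    ultimately show ?thesis by simp
  qed
  ultimately have "(CLINT w|P. iexp (c * enn2real (point_count J U A w))) = exp (- complex_of_real m) * exp (complex_of_real m * iexp c)"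
    by (rule sums_unique2)
  also have "\<dots> = exp (m *\<^sub>R (iexp c - 1))" by (simp add: exp_add[symmetric] scaleR_conv_of_real algebra_simps)
  finally show ?thesis by (simp add: m_def)
qed

text \<open>
  Sums over the random index set itself are not visibly measurable; a limit of partial sums
  is, and it has the same value whenever only finitely many points contribute.
\<close>

definition poisson_sum :: "('w \<Rightarrow> nat set) \<Rightarrow> (nat \<Rightarrow> 'w \<Rightarrow> 'a) \<Rightarrow> ('a \<Rightarrow> real) \<Rightarrow> 'w \<Rightarrow> real" where
  "poisson_sum J U h w = lim (\<lambda>n. \<Sum>i<n. if i \<in> J w then h (U i w) else 0)"

lemma poisson_sum_eq:
  assumes "finite K" "K \<subseteq> J w" "\<And>i. i \<in> J w \<Longrightarrow> i \<notin> K \<Longrightarrow> h (U i w) = 0"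
  shows "poisson_sum J U h w = (\<Sum>i\<in>K. h (U i w))"
proof -
  obtain N where N: "K \<subseteq> {..<N}" using finite_nat_iff_bounded assms(1) by blast
  have "(\<Sum>i<n. if i \<in> J w then h (U i w) else 0) = (\<Sum>i\<in>K. h (U i w))" if "n \<ge> N" for n
  proof -
    have "(\<Sum>i\<in>K. h (U i w)) = (\<Sum>i<n. if i \<in> J w then h (U i w) else 0)"
      by (rule sum.mono_neutral_cong_left) (use N \<open>n \<ge> N\<close> assms in \<open>auto split: if_splits\<close>)
    then show ?thesis by simp
  qed
  then have "eventually (\<lambda>n. (\<Sum>i<n. if i \<in> J w then h (U i w) else 0) = (\<Sum>i\<in>K. h (U i w))) sequentially"
    by (rule eventually_sequentiallyI)
  from tendsto_eventually[OF this] show ?thesis unfolding poisson_sum_def by (rule limI)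
qed

lemma poisson_sum_measurable:
  assumes ppp: "poisson_point_process P \<mu> J U" and h: "h \<in> borel_measurable \<mu>"
  shows "poisson_sum J U h \<in> borel_measurable P"
proof -
  have [measurable]: "(\<lambda>w. if i \<in> J w then h (U i w) else 0) \<in> borel_measurable P" for i
  proof -
    have "(\<lambda>w. h (U i w)) \<in> borel_measurable (restrict_space P {w \<in> space P. i \<in> J w})"
      by (rule measurable_compose[OF ppp_point_measurable[OF ppp] h])
    then have "(\<lambda>w. if w \<in> {w \<in> space P. i \<in> J w} then h (U i w) else 0) \<in> borel_measurable P"
      using ppp_index_sets[OF ppp] by (subst (asm) measurable_restrict_space_iff[where c=0]) (auto simp: Int_absorb2)
    then show ?thesis by (rule measurable_cong[THEN iffD1, rotated]) auto
  qed
  show ?thesis unfolding poisson_sum_def[abs_def] by measurable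
qed

text \<open>
  For a function taking the value \<open>v B\<close> on \<open>B\<close>, the sum over all points is the sum of the
  independent Poisson variables counting the points in \<open>B\<close>, weighted with \<open>v B\<close>.
\<close>

lemma poisson_sum_char_simple:
  assumes ppp: "poisson_point_process P \<mu> J U"
    and F: "finite F" "F \<subseteq> sets \<mu>" "disjoint F" "\<And>B. B \<in> F \<Longrightarrow> emeasure \<mu> B < \<infinity>"
    and h: "\<And>x. h x = (\<Sum>B\<in>F. v B * indicator B x)"
  shows "(CLINT w|P. iexp (poisson_sum J U h w)) = exp (CLINT x|\<mu>. iexp (h x) - 1)"
proof -
  interpret prob_space P by (rule ppp_prob_space[OF ppp])
  have "AE w in P. \<forall>B\<in>F. finite {i \<in> J w. U i w \<in> B}"
    using F ppp_count_finite[OF ppp] by (intro AE_finite_allI) auto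
  then have "AE w in P. iexp (poisson_sum J U h w) = (\<Prod>B\<in>F. iexp (v B * enn2real (point_count J U B w)))"
  proof eventually_elim
    case (elim w)
    define K where "K = (\<Union>B\<in>F. {i \<in> J w. U i w \<in> B})"
    have K: "finite K" using elim F(1) by (auto simp: K_def)
    have "poisson_sum J U h w = (\<Sum>i\<in>K. h (U i w))"
      by (rule poisson_sum_eq[OF K]) (auto simp: K_def h indicator_def intro!: sum.neutral)
    also have "\<dots> = (\<Sum>i\<in>K. \<Sum>B\<in>F. v B * indicator B (U i w))" by (simp add: h)
    also have "\<dots> = (\<Sum>B\<in>F. \<Sum>i\<in>K. v B * indicator B (U i w))" by (rule sum.swap)
    also have "\<dots> = (\<Sum>B\<in>F. v B * enn2real (point_count J U B w))"
    proof (rule sum.cong)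
      fix B assume B: "B \<in> F"
      have "(\<Sum>i\<in>K. v B * indicator B (U i w)) = v B * (\<Sum>i\<in>K. indicator B (U i w))" by (simp add: sum_distrib_left)
      also have "(\<Sum>i\<in>K. indicator B (U i w) :: real) = (\<Sum>i\<in>K. if U i w \<in> B then 1 else 0)"
        by (simp add: indicator_def of_bool_def)
      also have "\<dots> = (\<Sum>i\<in>{i\<in>K. U i w \<in> B}. 1)" by (rule sum.inter_filter[OF K, symmetric])
      also have "{i\<in>K. U i w \<in> B} = {i \<in> J w. U i w \<in> B}" using B by (auto simp: K_def)
      also have "(\<Sum>i\<in>{i \<in> J w. U i w \<in> B}. 1 :: real) = card {i \<in> J w. U i w \<in> B}" by simp
      also have "\<dots> = enn2real (point_count J U B w)"
        using elim B by (simp add: point_count_def enn2real_of_nat)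
      finally show "(\<Sum>i\<in>K. v B * indicator B (U i w)) = v B * enn2real (point_count J U B w)" .
    qed simp
    finally have "poisson_sum J U h w = (\<Sum>B\<in>F. v B * enn2real (point_count J U B w))" .
    then show ?case using F(1) by (simp add: exp_sum sum_distrib_left)
  qed
  then have "(CLINT w|P. iexp (poisson_sum J U h w)) = (CLINT w|P. \<Prod>B\<in>F. iexp (v B * enn2real (point_count J U B w)))"
  proof (rule integral_cong_AE[rotated 2])
    have "h \<in> borel_measurable \<mu>" unfolding h[abs_def] using F by (intro borel_measurable_sum) auto
    from poisson_sum_measurable[OF ppp this] have [measurable]: "poisson_sum J U h \<in> borel_measurable P" .
    show "(\<lambda>w. iexp (poisson_sum J U h w)) \<in> borel_measurable P" by measurable
    have [measurable]: "point_count J U B \<in> borel_measurable P" if "B \<in> F" for B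
      using F that by (intro ppp_count_measurable[OF ppp]) auto
    show "(\<lambda>w. \<Prod>B\<in>F. iexp (v B * enn2real (point_count J U B w))) \<in> borel_measurable P"
      by (intro borel_measurable_prod) measurable
  qed
  also have "\<dots> = (\<Prod>B\<in>F. CLINT w|P. iexp (v B * enn2real (point_count J U B w)))"
  proof (rule indep_vars_lebesgue_integral[OF F(1)])
    show "indep_vars (\<lambda>_. borel) (\<lambda>B w. iexp (v B * enn2real (point_count J U B w))) F"
      by (rule indep_vars_compose2[OF ppp_count_indep[OF ppp F(1-3)]]) measurable
    fix B assume "B \<in> F"
    then have [measurable]: "point_count J U B \<in> borel_measurable P"
      using F by (intro ppp_count_measurable[OF ppp]) auto
    show "integrable P (\<lambda>w. iexp (v B * enn2real (point_count J U B w)))"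
      by (rule integrable_const_bound[where B=1]) auto
  qed
  also have "\<dots> = (\<Prod>B\<in>F. exp (measure \<mu> B *\<^sub>R (iexp (v B) - 1)))"
    using F by (intro prod.cong refl ppp_count_char[OF ppp]) auto
  also have "\<dots> = exp (\<Sum>B\<in>F. measure \<mu> B *\<^sub>R (iexp (v B) - 1))" using F(1) by (simp add: exp_sum)
  also have "(\<Sum>B\<in>F. measure \<mu> B *\<^sub>R (iexp (v B) - 1)) = (CLINT x|\<mu>. \<Sum>B\<in>F. indicat_real B x *\<^sub>R (iexp (v B) - 1))"
  proof -
    have "(CLINT x|\<mu>. \<Sum>B\<in>F. indicat_real B x *\<^sub>R (iexp (v B) - 1)) = (\<Sum>B\<in>F. CLINT x|\<mu>. indicat_real B x *\<^sub>R (iexp (v B) - 1))"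
      using F by (intro Bochner_Integration.integral_sum integrable_scaleR_left) auto
    also have "\<dots> = (\<Sum>B\<in>F. measure \<mu> B *\<^sub>R (iexp (v B) - 1))"
    proof (rule sum.cong)
      fix B assume "B \<in> F"
      then have "B \<in> sets \<mu>" using F by auto
      then show "(CLINT x|\<mu>. indicat_real B x *\<^sub>R (iexp (v B) - 1)) = measure \<mu> B *\<^sub>R (iexp (v B) - 1)"
        using F(4)[OF \<open>B \<in> F\<close>] by (simp add: less_top[symmetric])
    qed simp
    finally show ?thesis by simp
  qed
  also have "(\<lambda>x. \<Sum>B\<in>F. indicat_real B x *\<^sub>R (iexp (v B) - 1)) = (\<lambda>x. iexp (h x) - 1)"
  proof
    fix x
    show "(\<Sum>B\<in>F. indicat_real B x *\<^sub>R (iexp (v B) - 1)) = iexp (h x) - 1"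
    proof (cases "\<exists>B\<in>F. x \<in> B")
      case True
      then obtain C where C: "C \<in> F" "x \<in> C" by blast
      then have D: "B = C" if "B \<in> F" "x \<in> B" for B using F(3) that by (auto simp: disjoint_def)
      have ind: "indicat_real B x = (if B = C then 1 else 0)" if "B \<in> F" for B
        using C(2) D[OF that] by (cases "B = C") (auto simp: indicator_def)
      have "h x = (\<Sum>B\<in>F. if B = C then v B else 0)" unfolding h by (rule sum.cong) (simp_all add: ind)
      moreover have "(\<Sum>B\<in>F. indicat_real B x *\<^sub>R (iexp (v B) - 1)) = (\<Sum>B\<in>F. if B = C then iexp (v B) - 1 else 0)"
        by (rule sum.cong) (simp_all add: ind)
      ultimately show ?thesis using C F(1) by (simp add: sum.delta)
    next
      case False
      then show ?thesis by (simp add: h)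
    qed
  qed
  finally show ?thesis .
qed

lemma norm_iexp_minus_1: "norm (iexp x - 1) \<le> 2"
  using norm_triangle_ineq4[of "iexp x" 1] by simp

text \<open>
  Approximate \<open>h\<close> pointwise by simple functions supported in \<open>A\<close>. Almost surely there are finitely
  many points in \<open>A\<close>, so the sums converge, and dominated convergence applies on both sides.
\<close>

lemma poisson_sum_char:
  assumes ppp: "poisson_point_process P \<mu> J U" and h: "h \<in> borel_measurable \<mu>"
    and A: "A \<in> sets \<mu>" "emeasure \<mu> A < \<infinity>" and off: "\<And>x. x \<in> space \<mu> - A \<Longrightarrow> h x = 0"
  shows "(CLINT w|P. iexp (poisson_sum J U h w)) = exp (CLINT x|\<mu>. iexp (h x) - 1)"
proof -
  interpret prob_space P by (rule ppp_prob_space[OF ppp])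
  obtain s where s: "\<And>n. simple_function \<mu> (s n)" "\<And>x. x \<in> space \<mu> \<Longrightarrow> (\<lambda>n. s n x :: real) \<longlonglongrightarrow> h x"
    using borel_measurable_implies_sequence_metric[OF h, of 0] by blast
  define k where "k n x = s n x * indicator A x" for n x
  note [measurable] = h A(1)
  have [measurable]: "s n \<in> borel_measurable \<mu>" for n using s(1) by (rule borel_measurable_simple_function)
  have k_meas[measurable]: "k n \<in> borel_measurable \<mu>" for n unfolding k_def[abs_def] by measurable
  have k_lim: "(\<lambda>n. k n x) \<longlonglongrightarrow> h x" if "x \<in> space \<mu>" for x
    using s(2)[OF that] off[of x] that by (cases "x \<in> A") (auto simp: k_def)
  have step: "(CLINT w|P. iexp (poisson_sum J U (k n) w)) = exp (CLINT x|\<mu>. iexp (k n x) - 1)" for n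
  proof -
    \<comment> \<open>The level sets of \<open>s n\<close> inside \<open>A\<close>, with \<open>v\<close> reading the level off any of its points.\<close>
    define F where "F = (\<lambda>c. s n -` {c} \<inter> A) ` (s n ` space \<mu>)"
    define v where "v B = s n (SOME x. x \<in> B)" for B
    have fin: "finite F" unfolding F_def using s(1)[of n] by (auto simp: simple_function_def)
    have A_sp: "A \<subseteq> space \<mu>" using A(1) by (rule sets.sets_into_space)
    have F_sets: "F \<subseteq> sets \<mu>"
    proof
      fix B assume "B \<in> F"
      then obtain c where "B = s n -` {c} \<inter> A" by (auto simp: F_def)
      then have "B = (s n -` {c} \<inter> space \<mu>) \<inter> A" using A_sp by auto
      then show "B \<in> sets \<mu>" by simp
    qed
    have v: "v B = s n x" if "B \<in> F" "x \<in> B" for B x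
    proof -
      have "(SOME x. x \<in> B) \<in> B" using that(2) by (rule someI)
      then show ?thesis using that by (auto simp: v_def F_def)
    qed
    have dis: "disjoint F" unfolding disjoint_def F_def by auto
    have "k n x = (\<Sum>B\<in>F. v B * indicator B x)" for x
    proof (cases "x \<in> A")
      case True
      define C where "C = s n -` {s n x} \<inter> A"
      have C: "C \<in> F" "x \<in> C" using True A_sp by (auto simp: C_def F_def)
      have "(\<Sum>B\<in>F. v B * indicator B x) = (\<Sum>B\<in>F. if B = C then s n x else 0)"
      proof (rule sum.cong)
        fix B assume B: "B \<in> F"
        show "v B * indicator B x = (if B = C then s n x else 0)"
        proof (cases "x \<in> B")
          case True
          then have "B = C" using B C dis by (auto simp: disjoint_def)
          then show ?thesis using v[OF B True] True by simp
        next
          case False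
          then show ?thesis using C by auto
        qed
      qed simp
      then show ?thesis using True C fin by (simp add: k_def sum.delta)
    next
      case False
      then have "x \<notin> B" if "B \<in> F" for B using that by (auto simp: F_def)
      then show ?thesis using False by (simp add: k_def)
    qed
    moreover have "emeasure \<mu> B < \<infinity>" if "B \<in> F" for B
      using emeasure_mono[of B A \<mu>] A that by (auto simp: F_def intro: le_less_trans)
    ultimately show ?thesis by (intro poisson_sum_char_simple[OF ppp fin F_sets dis]) auto
  qed
  have lhs: "(\<lambda>n. CLINT w|P. iexp (poisson_sum J U (k n) w)) \<longlonglongrightarrow> (CLINT w|P. iexp (poisson_sum J U h w))"
  proof (rule integral_dominated_convergence[where w="\<lambda>_. 1"])
    have [measurable]: "poisson_sum J U h \<in> borel_measurable P" "poisson_sum J U (k n) \<in> borel_measurable P" for n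
      using poisson_sum_measurable[OF ppp] by auto
    show "(\<lambda>w. iexp (poisson_sum J U h w)) \<in> borel_measurable P" by measurable
    show "(\<lambda>w. iexp (poisson_sum J U (k n) w)) \<in> borel_measurable P" for n by measurable
    show "AE w in P. (\<lambda>n. iexp (poisson_sum J U (k n) w)) \<longlonglongrightarrow> iexp (poisson_sum J U h w)"
      using ppp_count_finite[OF ppp A] AE_space
    proof eventually_elim
      case (elim w)
      let ?K = "{i \<in> J w. U i w \<in> A}"
      have "poisson_sum J U h w = (\<Sum>i\<in>?K. h (U i w))"
        by (rule poisson_sum_eq[OF elim(1)]) (use ppp_point_space[OF ppp elim(2)] off in auto)
      moreover have "poisson_sum J U (k n) w = (\<Sum>i\<in>?K. k n (U i w))" for n
        by (rule poisson_sum_eq[OF elim(1)]) (auto simp: k_def)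
      moreover have "(\<lambda>n. \<Sum>i\<in>?K. k n (U i w)) \<longlonglongrightarrow> (\<Sum>i\<in>?K. h (U i w))"
        by (intro tendsto_sum k_lim) (use ppp_point_space[OF ppp elim(2)] in auto)
      ultimately have "(\<lambda>n. poisson_sum J U (k n) w) \<longlonglongrightarrow> poisson_sum J U h w" by simp
      then show ?case by (intro tendsto_exp tendsto_mult tendsto_const tendsto_of_real)
    qed
  qed auto
  have rhs: "(\<lambda>n. CLINT x|\<mu>. iexp (k n x) - 1) \<longlonglongrightarrow> (CLINT x|\<mu>. iexp (h x) - 1)"
  proof (rule integral_dominated_convergence[where w="\<lambda>x. 2 * indicat_real A x"])
    show "integrable \<mu> (\<lambda>x. 2 * indicat_real A x)" using A by simp
    show "AE x in \<mu>. (\<lambda>n. iexp (k n x) - 1) \<longlonglongrightarrow> iexp (h x) - 1"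
      using AE_space by eventually_elim (auto intro!: tendsto_intros k_lim)
    show "AE x in \<mu>. norm (iexp (k n x) - 1) \<le> 2 * indicat_real A x" for n
    proof (rule AE_I2)
      fix x
      show "norm (iexp (k n x) - 1) \<le> 2 * indicat_real A x"
        using norm_iexp_minus_1[of "s n x"] by (cases "x \<in> A") (simp_all add: k_def)
    qed
  qed measurable
  have "(\<lambda>n. exp (CLINT x|\<mu>. iexp (k n x) - 1)) \<longlonglongrightarrow> exp (CLINT x|\<mu>. iexp (h x) - 1)"
    by (rule tendsto_exp[OF rhs])
  with lhs show ?thesis unfolding step by (rule LIMSEQ_unique)
qed

section \<open>The Levy exponent of a sum representation\<close>

text \<open>
  The Levy--Khintchine integrand at frequency \<open>\<theta>\<close>, compensated coordinatewise.
\<close>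

definition levy_integrand :: "'i set \<Rightarrow> ('i \<Rightarrow> real) \<Rightarrow> ('i \<Rightarrow> real) \<Rightarrow> complex" where
  "levy_integrand I \<theta> y =
     iexp (\<Sum>t\<in>I. \<theta> t * y t) - 1 - \<i> * complex_of_real (\<Sum>t\<in>I. \<theta> t * trunc (y t))"

lemma trunc_eq: "trunc u = max (- 1) (min 1 u)"
  by (auto simp: trunc_def sgn_if)

lemma trunc_measurable[measurable]: "trunc \<in> borel_measurable borel"
  unfolding trunc_eq[abs_def] by measurable

lemma abs_trunc_le_1: "\<bar>trunc u\<bar> \<le> 1"
  by (auto simp: trunc_eq)

lemma levy_integrand_measurable:
  assumes "\<And>t. t \<in> I \<Longrightarrow> (\<lambda>x. y x t) \<in> borel_measurable \<mu>"
  shows "(\<lambda>x. levy_integrand I \<theta> (y x)) \<in> borel_measurable \<mu>"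
proof -
  have "(\<lambda>x. trunc (y x t)) \<in> borel_measurable \<mu>" if "t \<in> I" for t
    using assms[OF that] by measurable
  then have [measurable]: "(\<lambda>x. \<Sum>t\<in>I. \<theta> t * y x t) \<in> borel_measurable \<mu>"
      "(\<lambda>x. \<Sum>t\<in>I. \<theta> t * trunc (y x t)) \<in> borel_measurable \<mu>"
    using assms by (auto intro!: borel_measurable_sum)
  show ?thesis unfolding levy_integrand_def by measurable
qed

text \<open>
  Monotone in each \<open>\<bar>\<theta> t\<bar>\<close>, hence one dominating function serves a whole segment of frequencies.
\<close>

definition levy_bound :: "'i set \<Rightarrow> ('i \<Rightarrow> real) \<Rightarrow> real" where
  "levy_bound I \<theta> = 2 + (\<Sum>t\<in>I. \<bar>\<theta> t\<bar>) + (\<Sum>t\<in>I. (\<theta> t)\<^sup>2)"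

text \<open>
  If all coordinates are at most one in modulus, the integrand is the second order Taylor remainder
  of the exponential, controlled by Cauchy--Schwarz. Otherwise the sum on the right is at least
  one and the integrand is bounded.
\<close>

lemma levy_integrand_bound:
  assumes I: "finite I"
  shows "norm (levy_integrand I \<theta> y) \<le> levy_bound I \<theta> * (\<Sum>t\<in>I. min 1 ((y t)\<^sup>2))"
proof (cases "\<forall>t\<in>I. \<bar>y t\<bar> \<le> 1")
  case True
  define L where "L = (\<Sum>t\<in>I. \<theta> t * y t)"
  have tr: "(\<Sum>t\<in>I. \<theta> t * trunc (y t)) = L"
    unfolding L_def using True by (intro sum.cong) (auto simp: trunc_def)
  have mn: "(\<Sum>t\<in>I. min 1 ((y t)\<^sup>2)) = (\<Sum>t\<in>I. (y t)\<^sup>2)"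
  proof (rule sum.cong)
    fix t assume "t \<in> I"
    then have "(y t)\<^sup>2 \<le> 1" using True by (simp add: abs_square_le_1)
    then show "min 1 ((y t)\<^sup>2) = (y t)\<^sup>2" by simp
  qed simp
  have "norm (levy_integrand I \<theta> y) = norm (iexp L - (\<Sum>k\<le>1. (\<i> * L) ^ k / fact k))"
    unfolding levy_integrand_def tr L_def[symmetric] by (simp add: algebra_simps)
  also have "\<dots> \<le> \<bar>L\<bar>\<^sup>2 / 2"
    using iexp_approx1[of L 1] by (simp add: numeral_2_eq_2)
  also have "\<dots> \<le> L\<^sup>2" by simp
  also have "\<dots> \<le> (\<Sum>t\<in>I. (\<theta> t)\<^sup>2) * (\<Sum>t\<in>I. (y t)\<^sup>2)"
    unfolding L_def by (rule Cauchy_Schwarz_ineq_sum)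
  also have "\<dots> \<le> levy_bound I \<theta> * (\<Sum>t\<in>I. (y t)\<^sup>2)"
    unfolding levy_bound_def by (intro mult_right_mono sum_nonneg) (auto intro!: add_nonneg_nonneg sum_nonneg)
  finally show ?thesis by (simp add: mn)
next
  case False
  then obtain s where s: "s \<in> I" "\<bar>y s\<bar> > 1" by (auto simp: not_le)
  have "1 \<le> (y s)\<^sup>2" using s(2) by (metis abs_square_less_1 less_imp_le not_le)
  then have "1 \<le> min 1 ((y s)\<^sup>2)" by simp
  also have "\<dots> \<le> (\<Sum>t\<in>I. min 1 ((y t)\<^sup>2))"
    by (rule member_le_sum[OF s(1) _ I]) auto
  finally have one: "1 \<le> (\<Sum>t\<in>I. min 1 ((y t)\<^sup>2))" .
  have "norm (levy_integrand I \<theta> y) \<le> norm (iexp (\<Sum>t\<in>I. \<theta> t * y t) - 1) + norm (\<i> * complex_of_real (\<Sum>t\<in>I. \<theta> t * trunc (y t)))"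
    unfolding levy_integrand_def by (rule norm_triangle_ineq4)
  also have "\<dots> \<le> 2 + \<bar>\<Sum>t\<in>I. \<theta> t * trunc (y t)\<bar>"
    by (intro add_mono norm_iexp_minus_1) (simp add: norm_mult del: of_real_sum)
  also have "\<bar>\<Sum>t\<in>I. \<theta> t * trunc (y t)\<bar> \<le> (\<Sum>t\<in>I. \<bar>\<theta> t\<bar>)"
  proof (rule order.trans[OF sum_abs], rule sum_mono)
    fix t
    show "\<bar>\<theta> t * trunc (y t)\<bar> \<le> \<bar>\<theta> t\<bar>"
      using mult_left_mono[OF abs_trunc_le_1[of "y t"], of "\<bar>\<theta> t\<bar>"] by (simp add: abs_mult)
  qed
  also have "2 + (\<Sum>t\<in>I. \<bar>\<theta> t\<bar>) \<le> levy_bound I \<theta>" unfolding levy_bound_def by (simp add: sum_nonneg)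
  also have "\<dots> \<le> levy_bound I \<theta> * (\<Sum>t\<in>I. min 1 ((y t)\<^sup>2))"
    using mult_left_mono[OF one, of "levy_bound I \<theta>"] unfolding levy_bound_def
    by (simp add: add_nonneg_nonneg sum_nonneg)
  finally show ?thesis by simp
qed

lemma levy_bound_nonneg: "0 \<le> levy_bound I \<theta>"
  unfolding levy_bound_def by (simp add: add_nonneg_nonneg sum_nonneg)

lemma L_sumD:
  assumes "f \<in> L_sum \<mu>"
  shows "f \<in> borel_measurable \<mu>" and "integrable \<mu> (\<lambda>x. min 1 ((f x)\<^sup>2))"
    and "e > 0 \<Longrightarrow> emeasure \<mu> {x\<in>space \<mu>. \<bar>f x\<bar> > e} < \<infinity>"
proof -
  show m[measurable]: "f \<in> borel_measurable \<mu>" using assms by (simp add: L_sum_def)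
  have fin: "(\<integral>\<^sup>+ x. ennreal (min 1 ((f x)\<^sup>2)) \<partial>\<mu>) < \<infinity>" using assms by (simp add: L_sum_def)
  then show "integrable \<mu> (\<lambda>x. min 1 ((f x)\<^sup>2))" by (simp add: integrable_iff_bounded)
  assume e: "e > 0"
  define c where "c = min 1 (e\<^sup>2)"
  have c: "c > 0" using e by (simp add: c_def)
  have "ennreal c * emeasure \<mu> {x\<in>space \<mu>. \<bar>f x\<bar> > e} = (\<integral>\<^sup>+ x. ennreal c * indicator {x\<in>space \<mu>. \<bar>f x\<bar> > e} x \<partial>\<mu>)"
    by (simp add: nn_integral_cmult_indicator)
  also have "\<dots> \<le> (\<integral>\<^sup>+ x. ennreal (min 1 ((f x)\<^sup>2)) \<partial>\<mu>)"
  proof (rule nn_integral_mono)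
    fix x
    have "c \<le> min 1 ((f x)\<^sup>2)" if "\<bar>f x\<bar> > e"
      using power_mono[of e "\<bar>f x\<bar>" 2] e that by (auto simp: c_def)
    then show "ennreal c * indicator {x\<in>space \<mu>. \<bar>f x\<bar> > e} x \<le> ennreal (min 1 ((f x)\<^sup>2))"
      by (auto simp: indicator_def intro!: ennreal_leI)
  qed
  finally have "ennreal c * emeasure \<mu> {x\<in>space \<mu>. \<bar>f x\<bar> > e} < \<infinity>" using fin by (rule le_less_trans)
  then show "emeasure \<mu> {x\<in>space \<mu>. \<bar>f x\<bar> > e} < \<infinity>"
    using c by (auto simp: ennreal_mult_less_top ennreal_zero_less_top)
qed

lemma levy_integrand_integrable:
  assumes I: "finite I" and f: "\<And>t. t \<in> I \<Longrightarrow> f t \<in> L_sum \<mu>"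
  shows "integrable \<mu> (\<lambda>x. levy_integrand I \<theta> (\<lambda>t. f t x))"
proof (rule Bochner_Integration.integrable_bound)
  show "integrable \<mu> (\<lambda>x. levy_bound I \<theta> * (\<Sum>t\<in>I. min 1 ((f t x)\<^sup>2)))"
    using L_sumD(2)[OF f] by (intro integrable_mult_right Bochner_Integration.integrable_sum)
  show "(\<lambda>x. levy_integrand I \<theta> (\<lambda>t. f t x)) \<in> borel_measurable \<mu>"
    by (rule levy_integrand_measurable) (use L_sumD(1)[OF f] in simp)
  show "AE x in \<mu>. norm (levy_integrand I \<theta> (\<lambda>t. f t x)) \<le> norm (levy_bound I \<theta> * (\<Sum>t\<in>I. min 1 ((f t x)\<^sup>2)))"
  proof (rule AE_I2)
    fix x
    show "norm (levy_integrand I \<theta> (\<lambda>t. f t x)) \<le> norm (levy_bound I \<theta> * (\<Sum>t\<in>I. min 1 ((f t x)\<^sup>2)))"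
      using levy_integrand_bound[OF I, of \<theta> "\<lambda>t. f t x"] by (simp add: abs_of_nonneg mult_nonneg_nonneg levy_bound_nonneg sum_nonneg)
  qed
qed

text \<open>
  At truncation level \<open>e n = 1 / (n + 1)\<close> the linear combination of compensated sums is a Poisson sum
  of a function with support of finite measure minus a constant, so \<open>poisson_sum_char\<close> gives its
  characteristic function. Its exponent is again a Levy integrand, that of the truncated functions,
  and both sides converge by domination as the truncation is removed.
\<close>

lemma sum_integral_char:
  assumes ppp: "poisson_point_process P \<mu> J U" and I: "finite I"
    and f: "\<And>t. t \<in> I \<Longrightarrow> f t \<in> L_sum \<mu>" and Z: "\<And>t. t \<in> I \<Longrightarrow> is_I_sum P \<mu> J U (f t) (Z t)"
  shows "(CLINT w|P. iexp (\<Sum>t\<in>I. \<theta> t * Z t w)) = exp (CLINT x|\<mu>. levy_integrand I \<theta> (\<lambda>t. f t x))"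
proof -
  interpret prob_space P by (rule ppp_prob_space[OF ppp])
  define e where "e n = 1 / real (Suc n)" for n
  have e: "e n > 0" for n by (simp add: e_def)
  have e_lim: "filterlim e (at_right 0) sequentially"
    using LIMSEQ_inverse_real_of_nat e unfolding filterlim_at e_def by (simp add: inverse_eq_divide)
  define y where "y n t x = (if \<bar>f t x\<bar> > e n then f t x else 0)" for n t x
  define h where "h n x = (\<Sum>t\<in>I. \<theta> t * y n t x)" for n x
  define A where "A n = {x\<in>space \<mu>. \<exists>t\<in>I. \<bar>f t x\<bar> > e n}" for n
  have fm[measurable]: "f t \<in> borel_measurable \<mu>" if "t \<in> I" for t using L_sumD(1)[OF f[OF that]] .
  have ym[measurable]: "y n t \<in> borel_measurable \<mu>" if "t \<in> I" for n t
    using fm[OF that] unfolding y_def[abs_def] by measurable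
  have hm[measurable]: "h n \<in> borel_measurable \<mu>" for n
    unfolding h_def[abs_def] using ym by (intro borel_measurable_sum) simp
  have Am: "{x\<in>space \<mu>. \<bar>f t x\<bar> > e n} \<in> sets \<mu>" if "t \<in> I" for t n
    using fm[OF that] by measurable
  have A_eq: "A n = (\<Union>t\<in>I. {x\<in>space \<mu>. \<bar>f t x\<bar> > e n})" for n by (auto simp: A_def)
  have A: "A n \<in> sets \<mu>" for n unfolding A_eq using I Am by (intro sets.finite_UN) auto
  have A_fin: "emeasure \<mu> (A n) < \<infinity>" for n
  proof -
    have "emeasure \<mu> (A n) \<le> (\<Sum>t\<in>I. emeasure \<mu> {x\<in>space \<mu>. \<bar>f t x\<bar> > e n})"
      unfolding A_eq using I Am by (intro emeasure_subadditive_finite) auto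
    also have "\<dots> < \<infinity>" using L_sumD(3)[OF f e] I by (simp add: less_top)
    finally show ?thesis .
  qed
  have off: "h n x = 0" if "x \<in> space \<mu> - A n" for n x
    using that by (auto simp: h_def y_def A_def intro!: sum.neutral)
  define b where "b n = (\<Sum>t\<in>I. \<theta> t * (LINT x|\<mu>. trunc (y n t x)))" for n
  define V where "V n w = poisson_sum J U (h n) w - b n" for n w
  have Vm[measurable]: "V n \<in> borel_measurable P" for n
    unfolding V_def[abs_def] using poisson_sum_measurable[OF ppp hm] by measurable
  have Zm: "Z t \<in> borel_measurable P" if "t \<in> I" for t using Z[OF that] by (simp add: is_I_sum_def)
  have lim: "AE w in P. (\<lambda>n. V n w) \<longlonglongrightarrow> (\<Sum>t\<in>I. \<theta> t * Z t w)"
  proof -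
    have 1: "AE w in P. \<forall>n. finite {i \<in> J w. U i w \<in> A n}"
      using ppp_count_finite[OF ppp A A_fin] by (simp add: AE_all_countable)
    have 2: "AE w in P. \<forall>t\<in>I. ((\<lambda>e. compensated_sum \<mu> J U (f t) e w) \<longlongrightarrow> Z t w) (at_right 0)"
      using Z I by (intro AE_finite_allI) (auto simp: is_I_sum_def)
    from 1 2 AE_space show ?thesis
    proof eventually_elim
      case (elim w)
      have "V n w = (\<Sum>t\<in>I. \<theta> t * compensated_sum \<mu> J U (f t) (e n) w)" for n
      proof -
        let ?K = "{i \<in> J w. U i w \<in> A n}"
        have K: "finite ?K" using elim by blast
        have "poisson_sum J U (h n) w = (\<Sum>i\<in>?K. h n (U i w))"
          by (rule poisson_sum_eq[OF K]) (use off ppp_point_space[OF ppp elim(3)] in auto)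
        also have "\<dots> = (\<Sum>t\<in>I. \<theta> t * (\<Sum>i\<in>?K. y n t (U i w)))"
          unfolding h_def by (subst sum.swap) (simp add: sum_distrib_left)
        also have "\<dots> = (\<Sum>t\<in>I. \<theta> t * (\<Sum>i\<in>{i \<in> J w. \<bar>f t (U i w)\<bar> > e n}. f t (U i w)))"
        proof (rule sum.cong[OF refl])
          fix t assume t: "t \<in> I"
          have "(\<Sum>i\<in>?K. y n t (U i w)) = (\<Sum>i\<in>{i \<in> J w. \<bar>f t (U i w)\<bar> > e n}. f t (U i w))"
            by (rule sum.mono_neutral_cong_right[OF K])
               (use t ppp_point_space[OF ppp elim(3)] in \<open>auto simp: A_def y_def\<close>)
          then show "\<theta> t * (\<Sum>i\<in>?K. y n t (U i w)) = \<theta> t * (\<Sum>i\<in>{i \<in> J w. \<bar>f t (U i w)\<bar> > e n}. f t (U i w))"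
            by (rule arg_cong)
        qed
        finally have ps: "poisson_sum J U (h n) w = (\<Sum>t\<in>I. \<theta> t * (\<Sum>i\<in>{i \<in> J w. \<bar>f t (U i w)\<bar> > e n}. f t (U i w)))" .
        have tr: "(LINT x|\<mu>. trunc (y n t x)) = (LINT x:{x \<in> space \<mu>. \<bar>f t x\<bar> > e n}|\<mu>. trunc (f t x))" for t
          unfolding set_lebesgue_integral_def
          by (rule Bochner_Integration.integral_cong) (auto simp: y_def trunc_def indicator_def)
        show ?thesis
          unfolding V_def ps b_def compensated_sum_def tr by (simp add: sum_subtractf right_diff_distrib)
      qed
      moreover have "(\<lambda>n. \<Sum>t\<in>I. \<theta> t * compensated_sum \<mu> J U (f t) (e n) w) \<longlonglongrightarrow> (\<Sum>t\<in>I. \<theta> t * Z t w)"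
        using elim(2) by (intro tendsto_sum tendsto_mult tendsto_const) (auto intro: filterlim_compose[OF _ e_lim])
      ultimately show ?case by simp
    qed
  qed
  have lhs: "(\<lambda>n. CLINT w|P. iexp (V n w)) \<longlonglongrightarrow> (CLINT w|P. iexp (\<Sum>t\<in>I. \<theta> t * Z t w))"
  proof (rule integral_dominated_convergence[where w="\<lambda>_. 1"])
    have [measurable]: "(\<lambda>w. \<Sum>t\<in>I. \<theta> t * Z t w) \<in> borel_measurable P"
      using Zm by (intro borel_measurable_sum) simp
    show "(\<lambda>w. iexp (\<Sum>t\<in>I. \<theta> t * Z t w)) \<in> borel_measurable P" by measurable
    show "AE w in P. (\<lambda>n. iexp (V n w)) \<longlonglongrightarrow> iexp (\<Sum>t\<in>I. \<theta> t * Z t w)"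
      using lim by eventually_elim (intro tendsto_exp tendsto_mult tendsto_const tendsto_of_real)
  qed auto
  have step: "(CLINT w|P. iexp (V n w)) = exp (CLINT x|\<mu>. levy_integrand I \<theta> (\<lambda>t. y n t x))" for n
  proof -
    have int_ind: "integrable \<mu> (\<lambda>x. c * indicat_real (A n) x)" for c :: real using A A_fin[of n] by simp
    have int1: "integrable \<mu> (\<lambda>x. iexp (h n x) - 1)"
    proof (rule Bochner_Integration.integrable_bound[OF int_ind[of 2]])
      show "AE x in \<mu>. norm (iexp (h n x) - 1) \<le> norm (2 * indicat_real (A n) x)"
      proof (rule AE_I2)
        fix x assume "x \<in> space \<mu>"
        then show "norm (iexp (h n x) - 1) \<le> norm (2 * indicat_real (A n) x)"
          using norm_iexp_minus_1[of "h n x"] off[of x n] by (cases "x \<in> A n") auto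
      qed
    qed measurable
    have int2: "integrable \<mu> (\<lambda>x. trunc (y n t x))" if t: "t \<in> I" for t
    proof (rule Bochner_Integration.integrable_bound[OF int_ind[of 1]])
      show "(\<lambda>x. trunc (y n t x)) \<in> borel_measurable \<mu>" using ym[OF t] by measurable
      show "AE x in \<mu>. norm (trunc (y n t x)) \<le> norm (1 * indicat_real (A n) x)"
      proof (rule AE_I2)
        fix x assume "x \<in> space \<mu>"
        then show "norm (trunc (y n t x)) \<le> norm (1 * indicat_real (A n) x)"
          using abs_trunc_le_1[of "y n t x"] t by (cases "x \<in> A n") (auto simp: A_def y_def trunc_def)
      qed
    qed
    have "(CLINT x|\<mu>. levy_integrand I \<theta> (\<lambda>t. y n t x)) =
        (CLINT x|\<mu>. (iexp (h n x) - 1) - \<i> * complex_of_real (\<Sum>t\<in>I. \<theta> t * trunc (y n t x)))"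
      by (simp add: levy_integrand_def h_def)
    also have "\<dots> = (CLINT x|\<mu>. iexp (h n x) - 1) - (CLINT x|\<mu>. \<i> * complex_of_real (\<Sum>t\<in>I. \<theta> t * trunc (y n t x)))"
      by (rule Bochner_Integration.integral_diff[OF int1])
         (intro integrable_mult_right integrable_of_real Bochner_Integration.integrable_sum int2)
    also have "(CLINT x|\<mu>. \<i> * complex_of_real (\<Sum>t\<in>I. \<theta> t * trunc (y n t x))) = \<i> * complex_of_real (b n)"
    proof -
      have "(LINT x|\<mu>. (\<Sum>t\<in>I. \<theta> t * trunc (y n t x))) = b n"
        unfolding b_def by (subst Bochner_Integration.integral_sum) (auto intro!: integrable_mult_right int2)
      then show ?thesis by (simp only: integral_mult_right_zero integral_complex_of_real)
    qed
    finally have "exp (CLINT x|\<mu>. levy_integrand I \<theta> (\<lambda>t. y n t x)) = exp (CLINT x|\<mu>. iexp (h n x) - 1) * iexp (- b n)"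
      by (simp add: exp_diff exp_minus divide_inverse)
    also have "\<dots> = (CLINT w|P. iexp (poisson_sum J U (h n) w)) * iexp (- b n)"
      by (subst poisson_sum_char[OF ppp hm A A_fin off]) auto
    also have "\<dots> = (CLINT w|P. iexp (poisson_sum J U (h n) w) * iexp (- b n))"
      by (rule integral_mult_left_zero[symmetric])
    also have "\<dots> = (CLINT w|P. iexp (V n w))"
      by (simp add: V_def exp_add[symmetric] algebra_simps)
    finally show ?thesis by simp
  qed
  have "(\<lambda>n. CLINT x|\<mu>. levy_integrand I \<theta> (\<lambda>t. y n t x)) \<longlonglongrightarrow> (CLINT x|\<mu>. levy_integrand I \<theta> (\<lambda>t. f t x))"
  proof (rule integral_dominated_convergence[where w="\<lambda>x. levy_bound I \<theta> * (\<Sum>t\<in>I. min 1 ((f t x)\<^sup>2))"])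
    show "(\<lambda>x. levy_integrand I \<theta> (\<lambda>t. f t x)) \<in> borel_measurable \<mu>"
      by (rule levy_integrand_measurable) (use fm in simp)
    show "(\<lambda>x. levy_integrand I \<theta> (\<lambda>t. y n t x)) \<in> borel_measurable \<mu>" for n
      by (rule levy_integrand_measurable) (use ym in simp)
    show "integrable \<mu> (\<lambda>x. levy_bound I \<theta> * (\<Sum>t\<in>I. min 1 ((f t x)\<^sup>2)))"
      using L_sumD(2)[OF f] by (intro integrable_mult_right Bochner_Integration.integrable_sum)
    show "AE x in \<mu>. (\<lambda>n. levy_integrand I \<theta> (\<lambda>t. y n t x)) \<longlonglongrightarrow> levy_integrand I \<theta> (\<lambda>t. f t x)"
    proof (rule AE_I2)
      fix x
      have y_lim: "eventually (\<lambda>n. y n t x = f t x) sequentially" for t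
      proof (cases "f t x = 0")
        case False
        then have "eventually (\<lambda>n. e n < \<bar>f t x\<bar>) sequentially"
          using e_lim order_tendstoD(2)[of e 0 sequentially "\<bar>f t x\<bar>"] by (auto simp: filterlim_at)
        then show ?thesis by eventually_elim (simp add: y_def)
      qed (simp add: y_def)
      have "eventually (\<lambda>n. \<forall>t\<in>I. y n t x = f t x) sequentially"
        using y_lim I by (simp add: eventually_ball_finite)
      then have "eventually (\<lambda>n. levy_integrand I \<theta> (\<lambda>t. y n t x) = levy_integrand I \<theta> (\<lambda>t. f t x)) sequentially"
        by eventually_elim (simp add: levy_integrand_def)
      then show "(\<lambda>n. levy_integrand I \<theta> (\<lambda>t. y n t x)) \<longlonglongrightarrow> levy_integrand I \<theta> (\<lambda>t. f t x)"
        by (rule tendsto_eventually)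
    qed
    show "AE x in \<mu>. norm (levy_integrand I \<theta> (\<lambda>t. y n t x)) \<le> levy_bound I \<theta> * (\<Sum>t\<in>I. min 1 ((f t x)\<^sup>2))" for n
    proof (rule AE_I2)
      fix x
      have "norm (levy_integrand I \<theta> (\<lambda>t. y n t x)) \<le> levy_bound I \<theta> * (\<Sum>t\<in>I. min 1 ((y n t x)\<^sup>2))"
        by (rule levy_integrand_bound[OF I])
      also have "\<dots> \<le> levy_bound I \<theta> * (\<Sum>t\<in>I. min 1 ((f t x)\<^sup>2))"
        by (intro mult_left_mono sum_mono levy_bound_nonneg) (auto simp: y_def)
      finally show "norm (levy_integrand I \<theta> (\<lambda>t. y n t x)) \<le> levy_bound I \<theta> * (\<Sum>t\<in>I. min 1 ((f t x)\<^sup>2))" .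
    qed
  qed
  then have "(\<lambda>n. exp (CLINT x|\<mu>. levy_integrand I \<theta> (\<lambda>t. y n t x))) \<longlonglongrightarrow> exp (CLINT x|\<mu>. levy_integrand I \<theta> (\<lambda>t. f t x))"
    by (rule tendsto_exp)
  with lhs show ?thesis unfolding step by (rule LIMSEQ_unique)
qed

lemma sum_spectral_rep_char:
  assumes X: "random_field G M X" and ppp: "poisson_point_process P \<mu> J U"
    and rep: "sum_spectral_rep G M X P J U \<mu> f"
  obtains c where "\<And>I \<theta>. finite I \<Longrightarrow> I \<subseteq> G \<Longrightarrow> (CLINT y|fdd M X I. iexp (\<Sum>t\<in>I. \<theta> t * y t)) =
     exp (\<i> * complex_of_real (\<Sum>t\<in>I. \<theta> t * c t) + (CLINT x|\<mu>. levy_integrand I \<theta> (\<lambda>t. f t x)))"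
proof -
  interpret prob_space P by (rule ppp_prob_space[OF ppp])
  obtain Z c where fL: "\<forall>t\<in>G. f t \<in> L_sum \<mu>" and Z: "\<forall>t\<in>G. is_I_sum P \<mu> J U (f t) (Z t)"
    and eq: "fdd_eq G M X P (\<lambda>t w. Z t w + c t)"
    using rep unfolding sum_spectral_rep_def by blast
  have "(CLINT y|fdd M X I. iexp (\<Sum>t\<in>I. \<theta> t * y t)) =
     exp (\<i> * complex_of_real (\<Sum>t\<in>I. \<theta> t * c t) + (CLINT x|\<mu>. levy_integrand I \<theta> (\<lambda>t. f t x)))"
    if I: "finite I" "I \<subseteq> G" for I \<theta>
  proof -
    have Zm: "Z t \<in> borel_measurable P" if "t \<in> I" for t using Z I that by (auto simp: is_I_sum_def)
    have m: "(\<lambda>w. \<lambda>t\<in>I. Z t w + c t) \<in> P \<rightarrow>\<^sub>M path_space I"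
      using Zm by (intro measurable_restrict) simp
    have m2: "(\<lambda>y. iexp (\<Sum>t\<in>I. \<theta> t * y t)) \<in> borel_measurable (path_space I)" by measurable
    have "fdd M X I = fdd P (\<lambda>t w. Z t w + c t) I" using eq I by (simp add: fdd_eq_def)
    then have "(CLINT y|fdd M X I. iexp (\<Sum>t\<in>I. \<theta> t * y t)) = (CLINT y|fdd P (\<lambda>t w. Z t w + c t) I. iexp (\<Sum>t\<in>I. \<theta> t * y t))"
      by (simp only:)
    also have "\<dots> = (CLINT w|P. iexp (\<Sum>t\<in>I. \<theta> t * (\<lambda>t\<in>I. Z t w + c t) t))"
      unfolding fdd_def by (rule integral_distr[OF m m2])
    also have "\<dots> = (CLINT w|P. iexp (\<Sum>t\<in>I. \<theta> t * (Z t w + c t)))"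
      by (simp cong: sum.cong)
    also have "\<dots> = (CLINT w|P. iexp (\<Sum>t\<in>I. \<theta> t * c t) * iexp (\<Sum>t\<in>I. \<theta> t * Z t w))"
      by (simp add: exp_add[symmetric] algebra_simps sum.distrib)
    also have "\<dots> = iexp (\<Sum>t\<in>I. \<theta> t * c t) * (CLINT w|P. iexp (\<Sum>t\<in>I. \<theta> t * Z t w))"
      by (rule integral_mult_right_zero)
    also have "(CLINT w|P. iexp (\<Sum>t\<in>I. \<theta> t * Z t w)) = exp (CLINT x|\<mu>. levy_integrand I \<theta> (\<lambda>t. f t x))"
      by (rule sum_integral_char[OF ppp I(1)]) (use fL Z I in auto)
    finally show ?thesis by (simp add: exp_add)
  qed
  then show thesis by (rule that)
qed

text \<open>
  Along the segment from \<open>0\<close> to \<open>\<theta>\<close> the difference of the two exponents is continuous, takes values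
  in the integer multiples of \<open>2 * pi * \<i>\<close>, and vanishes at \<open>0\<close>.
\<close>

lemma levy_exponent_unique:
  assumes I: "finite I" and f: "\<And>t. t \<in> I \<Longrightarrow> f t \<in> L_sum \<mu>" and g: "\<And>t. t \<in> I \<Longrightarrow> g t \<in> L_sum \<nu>"
    and eq: "\<And>\<theta>. exp (\<i> * complex_of_real (\<Sum>t\<in>I. \<theta> t * c t) + (CLINT x|\<mu>. levy_integrand I \<theta> (\<lambda>t. f t x))) =
       exp (\<i> * complex_of_real (\<Sum>t\<in>I. \<theta> t * d t) + (CLINT x|\<nu>. levy_integrand I \<theta> (\<lambda>t. g t x)))"
  shows "\<i> * complex_of_real (\<Sum>t\<in>I. \<theta> t * c t) + (CLINT x|\<mu>. levy_integrand I \<theta> (\<lambda>t. f t x)) =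
       \<i> * complex_of_real (\<Sum>t\<in>I. \<theta> t * d t) + (CLINT x|\<nu>. levy_integrand I \<theta> (\<lambda>t. g t x))"
proof -
  have cont: "continuous_on {0..1} (\<lambda>s. CLINT x|\<rho>. levy_integrand I (\<lambda>t. s * \<theta> t) (\<lambda>t. h t x))"
    if h: "\<And>t. t \<in> I \<Longrightarrow> h t \<in> L_sum \<rho>" for \<rho> :: "'x measure" and h
    unfolding continuous_on_sequentially
  proof (intro allI ballI impI)
    fix u :: "nat \<Rightarrow> real" and s assume u: "(\<forall>n. u n \<in> {0..1}) \<and> u \<longlonglongrightarrow> s"
    have hm: "h t \<in> borel_measurable \<rho>" if "t \<in> I" for t using L_sumD(1)[OF h[OF that]] .
    have "(\<lambda>n. CLINT x|\<rho>. levy_integrand I (\<lambda>t. u n * \<theta> t) (\<lambda>t. h t x)) \<longlonglongrightarrow>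
        (CLINT x|\<rho>. levy_integrand I (\<lambda>t. s * \<theta> t) (\<lambda>t. h t x))"
    proof (rule integral_dominated_convergence[where w="\<lambda>x. levy_bound I \<theta> * (\<Sum>t\<in>I. min 1 ((h t x)\<^sup>2))"])
      show "(\<lambda>x. levy_integrand I \<theta>' (\<lambda>t. h t x)) \<in> borel_measurable \<rho>" for \<theta>'
        by (rule levy_integrand_measurable) (use hm in simp)
      then show "(\<lambda>x. levy_integrand I (\<lambda>t. u n * \<theta> t) (\<lambda>t. h t x)) \<in> borel_measurable \<rho>" for n .
      show "integrable \<rho> (\<lambda>x. levy_bound I \<theta> * (\<Sum>t\<in>I. min 1 ((h t x)\<^sup>2)))"
        using L_sumD(2)[OF h] by (intro integrable_mult_right Bochner_Integration.integrable_sum)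
      show "AE x in \<rho>. (\<lambda>n. levy_integrand I (\<lambda>t. u n * \<theta> t) (\<lambda>t. h t x)) \<longlonglongrightarrow> levy_integrand I (\<lambda>t. s * \<theta> t) (\<lambda>t. h t x)"
        unfolding levy_integrand_def using u
        by (intro AE_I2 tendsto_diff tendsto_exp tendsto_mult tendsto_of_real tendsto_sum tendsto_const) auto
      show "AE x in \<rho>. norm (levy_integrand I (\<lambda>t. u n * \<theta> t) (\<lambda>t. h t x)) \<le> levy_bound I \<theta> * (\<Sum>t\<in>I. min 1 ((h t x)\<^sup>2))" for n
      proof (rule AE_I2)
        fix x
        have un: "0 \<le> u n" "u n \<le> 1" using u by auto
        have "\<bar>u n * \<theta> t\<bar> \<le> \<bar>\<theta> t\<bar>" for t
          using un mult_right_mono[of "u n" 1 "\<bar>\<theta> t\<bar>"] by (simp add: abs_mult)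
        moreover from this have "(u n * \<theta> t)\<^sup>2 \<le> (\<theta> t)\<^sup>2" for t by (simp add: abs_le_square_iff)
        ultimately have lb: "levy_bound I (\<lambda>t. u n * \<theta> t) \<le> levy_bound I \<theta>"
          unfolding levy_bound_def by (intro add_mono sum_mono) auto
        have "norm (levy_integrand I (\<lambda>t. u n * \<theta> t) (\<lambda>t. h t x)) \<le> levy_bound I (\<lambda>t. u n * \<theta> t) * (\<Sum>t\<in>I. min 1 ((h t x)\<^sup>2))"
          by (rule levy_integrand_bound[OF I])
        also have "\<dots> \<le> levy_bound I \<theta> * (\<Sum>t\<in>I. min 1 ((h t x)\<^sup>2))"
          by (intro mult_right_mono lb sum_nonneg) auto
        finally show "norm (levy_integrand I (\<lambda>t. u n * \<theta> t) (\<lambda>t. h t x)) \<le> levy_bound I \<theta> * (\<Sum>t\<in>I. min 1 ((h t x)\<^sup>2))" .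
      qed
    qed
    then show "((\<lambda>s. CLINT x|\<rho>. levy_integrand I (\<lambda>t. s * \<theta> t) (\<lambda>t. h t x)) \<circ> u) \<longlonglongrightarrow>
        (CLINT x|\<rho>. levy_integrand I (\<lambda>t. s * \<theta> t) (\<lambda>t. h t x))" by (simp add: comp_def)
  qed
  define D where "D s = (\<i> * complex_of_real (s * (\<Sum>t\<in>I. \<theta> t * c t)) + (CLINT x|\<mu>. levy_integrand I (\<lambda>t. s * \<theta> t) (\<lambda>t. f t x)))
     - (\<i> * complex_of_real (s * (\<Sum>t\<in>I. \<theta> t * d t)) + (CLINT x|\<nu>. levy_integrand I (\<lambda>t. s * \<theta> t) (\<lambda>t. g t x)))" for s
  have "continuous_on {0..1} D"
    unfolding D_def by (intro continuous_intros cont f g)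
  moreover have exp_D: "exp (D s) = 1" for s
    using eq[of "\<lambda>t. s * \<theta> t"] unfolding D_def exp_diff by (simp add: sum_distrib_left mult.assoc)
  have "\<exists>e>0. \<forall>r. r \<in> {0..1} \<and> D r \<noteq> D s \<longrightarrow> e \<le> norm (D r - D s)" for s
  proof (intro exI[of _ "2 * pi"] conjI allI impI)
    fix r assume r: "r \<in> {0..1} \<and> D r \<noteq> D s"
    obtain m n :: int where mn: "Im (D r) = of_int (2 * m) * pi" "Im (D s) = of_int (2 * n) * pi" "Re (D r) = 0" "Re (D s) = 0"
      using exp_D[of r] exp_D[of s] unfolding exp_eq_1 by blast
    with r have "m \<noteq> n" by (auto simp: complex_eq_iff)
    then have "1 \<le> \<bar>m - n\<bar>" by simp
    then have "1 \<le> \<bar>real_of_int m - real_of_int n\<bar>" by (metis of_int_1_le_iff of_int_abs of_int_diff)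
    then have "2 * pi \<le> \<bar>real_of_int m - real_of_int n\<bar> * (2 * pi)"
      using mult_right_mono[of 1 "\<bar>real_of_int m - real_of_int n\<bar>" "2 * pi"] by simp
    also have "\<dots> = \<bar>Im (D r - D s)\<bar>"
    proof -
      have "Im (D r - D s) = (real_of_int m - real_of_int n) * (2 * pi)" by (simp add: mn algebra_simps)
      then show ?thesis by (simp add: abs_mult)
    qed
    also have "\<dots> \<le> norm (D r - D s)" by (rule abs_Im_le_cmod)
    finally show "2 * pi \<le> norm (D r - D s)" .
  qed simp
  ultimately have "D constant_on {0..1}"
    by (intro continuous_discrete_range_constant) auto
  then obtain k where k: "\<And>s. s \<in> {0..1} \<Longrightarrow> D s = k" unfolding constant_on_def by blast
  have "D 1 = D 0" using k[of 0] k[of 1] by simp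
  also have "D 0 = 0" by (simp add: D_def levy_integrand_def)
  finally show ?thesis by (simp add: D_def)
qed

section \<open>Finite measures on product spaces and their characteristic functions\<close>

text \<open>
  Levy's uniqueness theorem for finite measures, by normalising: the total mass is the value of
  the characteristic function at zero.
\<close>

lemma finite_measure_char_unique:
  fixes \<eta>1 \<eta>2 :: "real measure"
  assumes fin: "finite_measure \<eta>1" "finite_measure \<eta>2"
    and sets: "sets \<eta>1 = sets borel" "sets \<eta>2 = sets borel" and eq: "char \<eta>1 = char \<eta>2"
  shows "\<eta>1 = \<eta>2"
proof -
  interpret e1: finite_measure \<eta>1 by (rule fin)
  interpret e2: finite_measure \<eta>2 by (rule fin)
  note [measurable_cong] = sets
  have sp: "space \<eta>1 = UNIV" "space \<eta>2 = UNIV" using sets[THEN sets_eq_imp_space_eq] by auto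
  define m where "m = measure \<eta>1 UNIV"
  have m2: "measure \<eta>2 UNIV = m"
    using fun_cong[OF eq, of 0] unfolding char_def m_def by (simp add: sp)
  have em: "emeasure \<eta>1 UNIV = ennreal m" "emeasure \<eta>2 UNIV = ennreal m"
    using e1.emeasure_eq_measure[of UNIV] e2.emeasure_eq_measure[of UNIV] m2 by (simp_all add: m_def)
  show ?thesis
  proof (cases "m = 0")
    case True
    show ?thesis
    proof (rule measure_eqI)
      fix A
      have "emeasure \<eta>1 A \<le> emeasure \<eta>1 UNIV" "emeasure \<eta>2 A \<le> emeasure \<eta>2 UNIV"
        using sets by (auto intro!: emeasure_mono)
      then show "emeasure \<eta>1 A = emeasure \<eta>2 A" using True em by simp
    qed (simp add: sets)
  next
    case False
    then have m: "m > 0" using measure_nonneg[of \<eta>1 UNIV] by (simp add: m_def less_le)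
    define N1 where "N1 = density \<eta>1 (\<lambda>_. ennreal (1 / m))"
    define N2 where "N2 = density \<eta>2 (\<lambda>_. ennreal (1 / m))"
    have N: "emeasure N1 A = ennreal (1 / m) * emeasure \<eta>1 A" "emeasure N2 A = ennreal (1 / m) * emeasure \<eta>2 A"
      if "A \<in> sets borel" for A
      unfolding N1_def N2_def using that sets by (simp_all add: emeasure_density_const)
    have one: "ennreal (1 / m) * ennreal m = 1" using m by (simp add: ennreal_mult[symmetric])
    have "real_distribution N1" "real_distribution N2"
      unfolding real_distribution_def real_distribution_axioms_def
      using N[of UNIV] em one
      by (auto intro!: prob_spaceI simp: N1_def N2_def sets sp)
    moreover have "char N1 = char N2"
    proof
      fix t
      have "char N1 t = (1 / m) *\<^sub>R char \<eta>1 t" "char N2 t = (1 / m) *\<^sub>R char \<eta>2 t"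
        unfolding N1_def N2_def char_def using m by (simp_all add: integral_density)
      then show "char N1 t = char N2 t" using eq by simp
    qed
    ultimately have "N1 = N2" by (rule Levy_uniqueness)
    show ?thesis
    proof (rule measure_eqI)
      fix A assume "A \<in> sets \<eta>1"
      then have A: "A \<in> sets borel" by (simp add: sets)
      have "ennreal (1 / m) * emeasure \<eta>1 A = ennreal (1 / m) * emeasure \<eta>2 A"
        using N[OF A] \<open>N1 = N2\<close> by simp
      then have "(ennreal m * ennreal (1 / m)) * emeasure \<eta>1 A = (ennreal m * ennreal (1 / m)) * emeasure \<eta>2 A"
        by (simp only: mult.assoc)
      then show "emeasure \<eta>1 A = emeasure \<eta>2 A" using one by (simp only: mult.commute[of "ennreal m"] mult_1)
    qed (simp add: sets)
  qed
qed

text \<open>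
  Levy's uniqueness theorem applied to the distribution of \<open>X\<close> under the finite measure with
  density \<open>V\<close>. The phase \<open>\<beta>\<close> encodes real and imaginary part in one family of real integrals.
\<close>

lemma weighted_cos_unique:
  assumes fin: "finite_measure \<rho>1" "finite_measure \<rho>2" and sets: "sets \<rho>1 = sets N" "sets \<rho>2 = sets N"
    and X: "X \<in> borel_measurable N" and V: "V \<in> borel_measurable N"
    and bd: "\<And>y. 0 \<le> V y" "\<And>y. V y \<le> b"
    and eq: "\<And>\<tau> \<beta>. (LINT y|\<rho>1. cos (\<tau> * X y + \<beta>) * V y) = (LINT y|\<rho>2. cos (\<tau> * X y + \<beta>) * V y)"
    and B: "B \<in> sets borel"
  shows "(LINT y|\<rho>1. indicat_real B (X y) * V y) = (LINT y|\<rho>2. indicat_real B (X y) * V y)"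
proof -
  define L where "L \<rho> = distr (density \<rho> (\<lambda>y. ennreal (V y))) borel X" for \<rho>
  have main: "finite_measure (L \<rho>)" "sets (L \<rho>) = sets borel"
      "char (L \<rho>) \<tau> = complex_of_real (LINT y|\<rho>. cos (\<tau> * X y + 0) * V y) + \<i> * complex_of_real (LINT y|\<rho>. cos (\<tau> * X y + - (pi / 2)) * V y)"
      "measure (L \<rho>) B = (LINT y|\<rho>. indicat_real B (X y) * V y)"
    if f: "finite_measure \<rho>" and s[measurable_cong]: "sets \<rho> = sets N" for \<rho> \<tau>
  proof -
    interpret finite_measure \<rho> by (rule f)
    have [measurable]: "X \<in> borel_measurable \<rho>" "V \<in> borel_measurable \<rho>" using X V by (simp_all cong: measurable_cong_sets add: s)
    have int: "integrable \<rho> (\<lambda>y. c y * V y)" if [measurable]: "c \<in> borel_measurable \<rho>" and c: "\<And>y. \<bar>c y\<bar> \<le> 1" for c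
    proof (rule integrable_const_bound[where B=b])
      show "AE y in \<rho>. norm (c y * V y) \<le> b"
      proof (rule AE_I2)
        fix y
        have "\<bar>c y\<bar> * V y \<le> 1 * V y" by (rule mult_right_mono[OF c bd(1)])
        then show "norm (c y * V y) \<le> b" using bd[of y] by (simp add: abs_mult)
      qed
    qed measurable
    show "sets (L \<rho>) = sets borel" by (simp add: L_def)
    show "finite_measure (L \<rho>)"
    proof
      have "integrable \<rho> V" using int[of "\<lambda>_. 1"] by simp
      then have "(\<integral>\<^sup>+y. ennreal (V y) \<partial>\<rho>) < \<infinity>" using bd by (simp add: integrable_iff_bounded)
      then show "emeasure (L \<rho>) (space (L \<rho>)) \<noteq> \<infinity>"
        unfolding L_def by (simp add: emeasure_distr emeasure_density cong: nn_integral_cong)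
    qed
    have "char (L \<rho>) \<tau> = (CLINT y|\<rho>. V y *\<^sub>R iexp (\<tau> * X y))"
      unfolding L_def char_def using bd by (simp add: integral_distr integral_density)
    also have "\<dots> = (CLINT y|\<rho>. complex_of_real (cos (\<tau> * X y) * V y) + \<i> * complex_of_real (sin (\<tau> * X y) * V y))"
      by (rule Bochner_Integration.integral_cong) (auto simp: complex_eq_iff Re_exp Im_exp)
    also have "\<dots> = (CLINT y|\<rho>. complex_of_real (cos (\<tau> * X y) * V y)) + (CLINT y|\<rho>. \<i> * complex_of_real (sin (\<tau> * X y) * V y))"
      by (intro Bochner_Integration.integral_add integrable_mult_right integrable_of_real int) auto
    also have "\<dots> = complex_of_real (LINT y|\<rho>. cos (\<tau> * X y) * V y) + \<i> * complex_of_real (LINT y|\<rho>. sin (\<tau> * X y) * V y)"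
      by (simp only: integral_complex_of_real integral_mult_right_zero)
    also have "(\<lambda>y. sin (\<tau> * X y) * V y) = (\<lambda>y. cos (\<tau> * X y + - (pi / 2)) * V y)"
      by (simp only: cos_add cos_minus sin_minus cos_pi_half sin_pi_half) simp
    finally show "char (L \<rho>) \<tau> = complex_of_real (LINT y|\<rho>. cos (\<tau> * X y + 0) * V y) + \<i> * complex_of_real (LINT y|\<rho>. cos (\<tau> * X y + - (pi / 2)) * V y)"
      by (simp only: add_0_right)
    have "measure (L \<rho>) B = (LINT x|L \<rho>. indicat_real B x)" using B by (simp add: L_def)
    also have "\<dots> = (LINT y|density \<rho> (\<lambda>y. ennreal (V y)). indicat_real B (X y))"
      unfolding L_def by (rule integral_distr) (use B in measurable)
    also have "\<dots> = (LINT y|\<rho>. V y *\<^sub>R indicat_real B (X y))"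
      by (rule integral_density) (use B bd in \<open>measurable, auto\<close>)
    finally show "measure (L \<rho>) B = (LINT y|\<rho>. indicat_real B (X y) * V y)"
      by (simp only: real_scaleR_def mult.commute)
  qed
  have "char (L \<rho>1) = char (L \<rho>2)"
    unfolding fun_eq_iff main(3)[OF fin(1) sets(1)] main(3)[OF fin(2) sets(2)] eq by simp
  then have "L \<rho>1 = L \<rho>2"
    by (rule finite_measure_char_unique[OF main(1)[OF fin(1) sets(1)] main(1)[OF fin(2) sets(2)]
       main(2)[OF fin(1) sets(1)] main(2)[OF fin(2) sets(2)]])
  then show ?thesis using main(4)[OF fin(1) sets(1)] main(4)[OF fin(2) sets(2)] by simp
qed

text \<open>
  The one-dimensional theorem is applied one coordinate at a time. The hypothesis
  gives the integrals of \<open>cos ((\<Sum>t\<in>I. \<theta> t * y t) + \<alpha>)\<close>; the induction inserts, for one coordinate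
  after the other, an indicator of a Borel condition as a further factor, until only the indicator
  of a box is left. In the step the remaining factors act as a weight. The one-dimensional theorem
  needs a nonnegative weight, so it is applied to \<open>q * (1 + cos r)\<close> and to \<open>q\<close>, and
  the results are subtracted.
\<close>

lemma finite_measure_PiM_char_unique:
  fixes \<rho>1 \<rho>2 :: "('i \<Rightarrow> real) measure"
  assumes fin: "finite_measure \<rho>1" "finite_measure \<rho>2"
    and sets: "sets \<rho>1 = sets (path_space G)" "sets \<rho>2 = sets (path_space G)"
    and eq: "\<And>I \<theta>. finite I \<Longrightarrow> I \<subseteq> G \<Longrightarrow>
      (CLINT y|\<rho>1. iexp (\<Sum>t\<in>I. \<theta> t * y t)) = (CLINT y|\<rho>2. iexp (\<Sum>t\<in>I. \<theta> t * y t))"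
  shows "\<rho>1 = \<rho>2"
proof -
  have comp: "(\<lambda>y. y t) \<in> borel_measurable (path_space G)" if "t \<in> G" for t
    using that by (rule measurable_component_singleton)
  define q where "q K B y = (\<Prod>t\<in>K. indicat_real (B t) (y t))" for K and B :: "'i \<Rightarrow> real set" and y
  have q01: "0 \<le> q K B y" "q K B y \<le> 1" for K B y
    unfolding q_def by (auto intro!: prod_nonneg prod_le_1)
  have q_meas: "q K B \<in> borel_measurable (path_space G)" if "K \<subseteq> G" "\<And>t. t \<in> K \<Longrightarrow> B t \<in> sets borel" for K B
  proof -
    have "(\<lambda>y. indicat_real (B t) (y t)) \<in> borel_measurable (path_space G)" if "t \<in> K" for t
      using comp[of t] \<open>K \<subseteq> G\<close> \<open>\<And>t. t \<in> K \<Longrightarrow> B t \<in> sets borel\<close>[OF that] that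
      by (intro measurable_compose[OF comp borel_measurable_indicator]) auto
    then show ?thesis unfolding q_def[abs_def] by (intro borel_measurable_prod) auto
  qed
  have lin_meas: "(\<lambda>y. \<Sum>t\<in>I. \<theta> t * y t) \<in> borel_measurable (path_space G)" if "I \<subseteq> G" for I and \<theta> :: "'i \<Rightarrow> real"
    by (intro borel_measurable_sum borel_measurable_times borel_measurable_const comp) (use that in auto)
  have int: "integrable \<rho> u" if f: "finite_measure \<rho>" and s: "sets \<rho> = sets (path_space G)"
    and u: "u \<in> borel_measurable (path_space G)" "\<And>y. \<bar>u y\<bar> \<le> b" for \<rho> :: "('i \<Rightarrow> real) measure" and u :: "('i \<Rightarrow> real) \<Rightarrow> real" and b
    by (rule finite_measure.integrable_const_bound[OF f, where B=b])
       (use u in \<open>auto cong: measurable_cong_sets simp: s\<close>)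
  have claim: "(LINT y|\<rho>1. q K B y * cos ((\<Sum>t\<in>I. \<theta> t * y t) + \<alpha>)) = (LINT y|\<rho>2. q K B y * cos ((\<Sum>t\<in>I. \<theta> t * y t) + \<alpha>))"
    if "finite K" "K \<subseteq> G" "\<forall>t\<in>K. B t \<in> sets borel" "finite I" "I \<subseteq> G" for K B I \<theta> \<alpha>
    using that
  proof (induction K arbitrary: I \<theta> \<alpha> rule: finite_induct)
    case empty
    have "(LINT y|\<rho>. cos ((\<Sum>t\<in>I. \<theta> t * y t) + \<alpha>)) = Re (iexp \<alpha> * (CLINT y|\<rho>. iexp (\<Sum>t\<in>I. \<theta> t * y t)))"
      if f: "finite_measure \<rho>" and s: "sets \<rho> = sets (path_space G)" for \<rho> :: "('i \<Rightarrow> real) measure"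
    proof -
      have m[measurable]: "(\<lambda>y. \<Sum>t\<in>I. \<theta> t * y t) \<in> borel_measurable \<rho>"
        using lin_meas[OF empty(4)] by (simp cong: measurable_cong_sets add: s)
      have i: "integrable \<rho> (\<lambda>y. iexp \<alpha> * iexp (\<Sum>t\<in>I. \<theta> t * y t))"
        by (rule finite_measure.integrable_const_bound[OF f, where B=1]) (auto simp: norm_mult simp del: of_real_sum)
      have "iexp \<alpha> * (CLINT y|\<rho>. iexp (\<Sum>t\<in>I. \<theta> t * y t)) = (CLINT y|\<rho>. iexp \<alpha> * iexp (\<Sum>t\<in>I. \<theta> t * y t))"
        by (rule integral_mult_right_zero[symmetric])
      then have "Re (iexp \<alpha> * (CLINT y|\<rho>. iexp (\<Sum>t\<in>I. \<theta> t * y t))) = (LINT y|\<rho>. Re (iexp \<alpha> * iexp (\<Sum>t\<in>I. \<theta> t * y t)))"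
        using integral_Re[OF i] by simp
      also have "\<dots> = (LINT y|\<rho>. cos ((\<Sum>t\<in>I. \<theta> t * y t) + \<alpha>))"
        by (simp add: Re_exp Im_exp cos_add mult.commute del: of_real_sum)
      finally show ?thesis by simp
    qed
    from this[OF fin(1) sets(1)] this[OF fin(2) sets(2)] show ?case
      using eq[OF empty(3,4), of \<theta>] by (simp add: q_def)
  next
    case (insert s K)
    have K: "K \<subseteq> G" and s: "s \<in> G" and Bs: "B s \<in> sets borel" and BK: "\<forall>t\<in>K. B t \<in> sets borel" using insert.prems by auto
    note IH = insert.IH[OF K BK]
    define r where "r y = (\<Sum>t\<in>I. \<theta> t * y t) + \<alpha>" for y :: "'i \<Rightarrow> real"
    have rm[measurable]: "r \<in> borel_measurable (path_space G)"
      unfolding r_def[abs_def] using lin_meas[OF insert.prems(4)] by measurable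
    have qm[measurable]: "q K B \<in> borel_measurable (path_space G)" using BK by (intro q_meas[OF K]) auto
    have sm[measurable]: "(\<lambda>y. y s) \<in> borel_measurable (path_space G)" by (rule comp[OF s])
    have eq_q: "(LINT y|\<rho>1. cos (\<tau> * y s + \<beta>) * q K B y) = (LINT y|\<rho>2. cos (\<tau> * y s + \<beta>) * q K B y)" for \<tau> \<beta>
      using IH[of "{s}" "\<lambda>_. \<tau>" \<beta>] s by (simp add: mult.commute)
    \<comment> \<open>Multiplying by \<open>cos (\<tau> * y s + \<beta>)\<close> stays within the family by the product-to-sum formula: this
      is the frequency vector of the sum (\<open>k = 1\<close>) and of the difference (\<open>k = - 1\<close>) of the arguments.\<close>
    have lin: "(\<Sum>t\<in>insert s I. ((if t \<in> I then k * \<theta> t else 0) + (if t = s then \<tau> else 0)) * y t) = k * (\<Sum>t\<in>I. \<theta> t * y t) + \<tau> * y s"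
      for k \<tau> and y :: "'i \<Rightarrow> real"
    proof -
      have "(\<Sum>t\<in>insert s I. ((if t \<in> I then k * \<theta> t else 0) + (if t = s then \<tau> else 0)) * y t)
          = (\<Sum>t\<in>insert s I. if t \<in> I then k * (\<theta> t * y t) else 0) + (\<Sum>t\<in>insert s I. if t = s then \<tau> * y t else 0)"
        unfolding sum.distrib[symmetric] by (rule sum.cong) (auto simp: algebra_simps)
      also have "(\<Sum>t\<in>insert s I. if t = s then \<tau> * y t else 0) = \<tau> * y s"
        using insert.prems(3) by (simp add: sum.delta)
      also have "(\<Sum>t\<in>insert s I. if t \<in> I then k * (\<theta> t * y t) else 0) = (\<Sum>t\<in>I. k * (\<theta> t * y t))"
        by (rule sum.mono_neutral_cong_right) (use insert.prems(3) in auto)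
      finally show ?thesis by (simp add: sum_distrib_left)
    qed
    have eq_qc: "(LINT y|\<rho>1. cos (\<tau> * y s + \<beta>) * (q K B y * cos (r y))) = (LINT y|\<rho>2. cos (\<tau> * y s + \<beta>) * (q K B y * cos (r y)))" for \<tau> \<beta>
    proof -
      have split: "(LINT y|\<rho>. cos (\<tau> * y s + \<beta>) * (q K B y * cos (r y))) =
          ((LINT y|\<rho>. q K B y * cos ((\<Sum>t\<in>insert s I. ((if t \<in> I then - 1 * \<theta> t else 0) + (if t = s then \<tau> else 0)) * y t) + (\<beta> - \<alpha>)))
          + (LINT y|\<rho>. q K B y * cos ((\<Sum>t\<in>insert s I. ((if t \<in> I then 1 * \<theta> t else 0) + (if t = s then \<tau> else 0)) * y t) + (\<beta> + \<alpha>)))) / 2"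
        if f: "finite_measure \<rho>" and st: "sets \<rho> = sets (path_space G)" for \<rho> :: "('i \<Rightarrow> real) measure"
      proof -
        have ic: "integrable \<rho> (\<lambda>y. q K B y * cos (v y))" if "v \<in> borel_measurable (path_space G)" for v
        proof (rule int[OF f st, where b=1])
          show "\<bar>q K B y * cos (v y)\<bar> \<le> 1" for y
            unfolding abs_mult using q01[of K B y] by (intro mult_le_one) auto
        qed (use that in measurable)
        have product_to_sum: "cos u * (w * cos v) = (w * cos (u - v) + w * cos (u + v)) / 2" for u v w :: real
          by (simp add: cos_add cos_diff algebra_simps)
        have "(LINT y|\<rho>. cos (\<tau> * y s + \<beta>) * (q K B y * cos (r y))) =
            (LINT y|\<rho>. (q K B y * cos ((\<tau> * y s + \<beta>) - r y) + q K B y * cos ((\<tau> * y s + \<beta>) + r y)) / 2)"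
          by (simp only: product_to_sum)
        also have "\<dots> = ((LINT y|\<rho>. q K B y * cos ((\<tau> * y s + \<beta>) - r y)) + (LINT y|\<rho>. q K B y * cos ((\<tau> * y s + \<beta>) + r y))) / 2"
          by (simp only: integral_divide_zero) (subst Bochner_Integration.integral_add, intro ic, measurable, intro ic, measurable)
        finally show ?thesis unfolding lin by (simp add: r_def algebra_simps)
      qed
      have fi: "finite (insert s I)" "insert s I \<subseteq> G" using insert.prems s by auto
      show ?thesis unfolding split[OF fin(1) sets(1)] split[OF fin(2) sets(2)] IH[OF fi] ..
    qed
    have iq: "integrable \<rho> (\<lambda>y. c y * q K B y)" "integrable \<rho> (\<lambda>y. c y * (q K B y * cos (r y)))"
      if f: "finite_measure \<rho>" and st: "sets \<rho> = sets (path_space G)"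
        and c: "c \<in> borel_measurable (path_space G)" "\<And>y. \<bar>c y\<bar> \<le> 1" for \<rho> :: "('i \<Rightarrow> real) measure" and c
    proof -
      note [measurable] = c(1)
      show "integrable \<rho> (\<lambda>y. c y * q K B y)"
      proof (rule int[OF f st, where b=1])
        show "\<bar>c y * q K B y\<bar> \<le> 1" for y
          unfolding abs_mult using q01[of K B y] c(2)[of y] by (intro mult_le_one) auto
      qed measurable
      show "integrable \<rho> (\<lambda>y. c y * (q K B y * cos (r y)))"
      proof (rule int[OF f st, where b=1])
        show "\<bar>c y * (q K B y * cos (r y))\<bar> \<le> 1" for y
          unfolding abs_mult using q01[of K B y] c(2)[of y] by (intro mult_le_one) auto
      qed measurable
    qed
    have split2: "(LINT y|\<rho>. c y * (q K B y * (1 + cos (r y)))) = (LINT y|\<rho>. c y * q K B y) + (LINT y|\<rho>. c y * (q K B y * cos (r y)))"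
      if f: "finite_measure \<rho>" and st: "sets \<rho> = sets (path_space G)"
        and c: "c \<in> borel_measurable (path_space G)" "\<And>y. \<bar>c y\<bar> \<le> 1" for \<rho> :: "('i \<Rightarrow> real) measure" and c
      using Bochner_Integration.integral_add[OF iq[OF f st c]] by (simp add: algebra_simps)
    have cm: "(\<lambda>y. cos (\<tau> * y s + \<beta>)) \<in> borel_measurable (path_space G)" for \<tau> \<beta> by measurable
    have im: "(\<lambda>y. indicat_real (B s) (y s)) \<in> borel_measurable (path_space G)" using Bs by measurable
    have "(LINT y|\<rho>1. indicat_real (B s) (y s) * (q K B y * (1 + cos (r y)))) = (LINT y|\<rho>2. indicat_real (B s) (y s) * (q K B y * (1 + cos (r y))))"
    proof (rule weighted_cos_unique[OF fin sets sm, where b=2])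
      have cge: "0 \<le> 1 + cos (r y)" for y using cos_ge_minus_one[of "r y"] by linarith
      show "0 \<le> q K B y * (1 + cos (r y))" for y by (intro mult_nonneg_nonneg q01 cge)
      have "q K B y * (1 + cos (r y)) \<le> 1 * 2" for y by (intro mult_mono q01 cge) auto
      then show "q K B y * (1 + cos (r y)) \<le> 2" for y by simp
      show "(LINT y|\<rho>1. cos (\<tau> * y s + \<beta>) * (q K B y * (1 + cos (r y)))) = (LINT y|\<rho>2. cos (\<tau> * y s + \<beta>) * (q K B y * (1 + cos (r y))))" for \<tau> \<beta>
        by (simp only: split2[OF fin(1) sets(1) cm abs_cos_le_one] split2[OF fin(2) sets(2) cm abs_cos_le_one] eq_q eq_qc)
    qed (use Bs in measurable)
    moreover have "(LINT y|\<rho>1. indicat_real (B s) (y s) * q K B y) = (LINT y|\<rho>2. indicat_real (B s) (y s) * q K B y)"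
      by (rule weighted_cos_unique[OF fin sets sm qm q01(1) q01(2) eq_q Bs])
    moreover have split3: "(LINT y|\<rho>. indicat_real (B s) (y s) * (q K B y * (1 + cos (r y)))) =
        (LINT y|\<rho>. indicat_real (B s) (y s) * q K B y) + (LINT y|\<rho>. indicat_real (B s) (y s) * (q K B y * cos (r y)))"
      if f: "finite_measure \<rho>" and st: "sets \<rho> = sets (path_space G)" for \<rho> :: "('i \<Rightarrow> real) measure"
      by (rule split2[OF f st im]) (simp add: indicator_def)
    ultimately have "(LINT y|\<rho>1. indicat_real (B s) (y s) * (q K B y * cos (r y))) = (LINT y|\<rho>2. indicat_real (B s) (y s) * (q K B y * cos (r y)))"
      using split3[OF fin(1) sets(1)] split3[OF fin(2) sets(2)] by linarith
    moreover have "q (insert s K) B y = indicat_real (B s) (y s) * q K B y" for y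
      using insert.hyps by (simp add: q_def)
    ultimately show ?case by (simp add: r_def mult.assoc)
  qed
  show ?thesis
  proof (rule measure_eqI_PiM_infinite[where I=G and M="\<lambda>_. borel", OF sets _ fin(1)])
    fix B :: "'i \<Rightarrow> real set" and K assume K: "finite K" "K \<subseteq> G" "\<And>i. i \<in> K \<Longrightarrow> B i \<in> sets borel"
    have em: "emeasure \<rho> (prod_emb G (\<lambda>_. borel) K (Pi\<^sub>E K B)) = ennreal (LINT y|\<rho>. q K B y * cos ((\<Sum>t\<in>{}. 0 * y t) + 0))"
      if f: "finite_measure \<rho>" and st: "sets \<rho> = sets (path_space G)" for \<rho> :: "('i \<Rightarrow> real) measure"
    proof -
      have sp: "space \<rho> = space (path_space G)" using st by (rule sets_eq_imp_space_eq)
      have S: "prod_emb G (\<lambda>_. borel) K (Pi\<^sub>E K B) \<in> sets \<rho>"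
        unfolding st by (intro sets_PiM_I) (use K in auto)
      have "(LINT y|\<rho>. q K B y * cos ((\<Sum>t\<in>{}. 0 * y t) + 0)) = (LINT y|\<rho>. indicat_real (prod_emb G (\<lambda>_. borel) K (Pi\<^sub>E K B)) y)"
      proof (rule Bochner_Integration.integral_cong)
        fix y assume "y \<in> space \<rho>"
        then have y: "y \<in> extensional G" unfolding sp space_PiM by (simp add: PiE_def)
        have "q K B y = (if \<forall>t\<in>K. y t \<in> B t then 1 else 0)"
          unfolding q_def using K(1) by (auto simp: indicator_def prod_zero_iff)
        then show "q K B y * cos ((\<Sum>t\<in>{}. 0 * y t) + 0) = indicat_real (prod_emb G (\<lambda>_. borel) K (Pi\<^sub>E K B)) y"
          using y K(2) by (auto simp: prod_emb_def indicator_def PiE_iff restrict_def extensional_def)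
      qed simp
      also have "\<dots> = measure \<rho> (prod_emb G (\<lambda>_. borel) K (Pi\<^sub>E K B))" using S by simp
      finally show ?thesis by (simp add: finite_measure.emeasure_eq_measure[OF f])
    qed
    have BK: "\<forall>t\<in>K. B t \<in> sets borel" using K(3) by blast
    show "emeasure \<rho>1 (prod_emb G (\<lambda>_. borel) K (Pi\<^sub>E K B)) = emeasure \<rho>2 (prod_emb G (\<lambda>_. borel) K (Pi\<^sub>E K B))"
      unfolding em[OF fin(1) sets(1)] em[OF fin(2) sets(2)] using claim[OF K(1,2) BK, of "{}" "\<lambda>_. 0" 0] by simp
  qed
qed

section \<open>The trajectory law in the sum case\<close>

lemma sum_fun_upd_add:
  assumes "finite I" "s \<in> I"
  shows "(\<Sum>t\<in>I. (\<theta>(s := \<theta> s + u)) t * z t) = (\<Sum>t\<in>I. \<theta> t * z t) + u * (z s :: real)"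
proof -
  have "(\<Sum>t\<in>I. (\<theta>(s := \<theta> s + u)) t * z t) = (\<Sum>t\<in>I. \<theta> t * z t + (if t = s then u * z t else 0))"
    by (rule sum.cong) (auto simp: algebra_simps)
  then show ?thesis using assms by (simp add: sum.distrib sum.delta)
qed

text \<open>
  Second differences annihilate the constant and the linear compensator, leaving the exponential
  times a nonnegative bounded factor that vanishes to second order at \<open>y s = 0\<close>.
\<close>

lemma levy_integrand_second_difference:
  assumes "finite I" "s \<in> I"
  shows "levy_integrand I \<theta> y
      - (levy_integrand I (\<theta>(s := \<theta> s + u)) y + levy_integrand I (\<theta>(s := \<theta> s + - u)) y) / 2
    = (1 - cos (u * y s)) *\<^sub>R iexp (\<Sum>t\<in>I. \<theta> t * y t)"
proof -
  have "iexp (a + v) + iexp (a + - v) = 2 * complex_of_real (cos v) * iexp a" for a v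
    by (simp add: complex_eq_iff Re_exp Im_exp cos_add sin_add cos_diff sin_diff)
  note exps = this[of "\<Sum>t\<in>I. \<theta> t * y t" "u * y s"]
  have lin: "(\<Sum>t\<in>I. (\<theta>(s := \<theta> s + v)) t * y t) = (\<Sum>t\<in>I. \<theta> t * y t) + v * y s" for v
    by (rule sum_fun_upd_add[OF assms])
  have lin_trunc: "(\<Sum>t\<in>I. (\<theta>(s := \<theta> s + v)) t * trunc (y t)) = (\<Sum>t\<in>I. \<theta> t * trunc (y t)) + v * trunc (y s)" for v
    by (rule sum_fun_upd_add[OF assms])
  show ?thesis
    unfolding levy_integrand_def lin lin_trunc scaleR_conv_of_real using exps
    by (simp add: algebra_simps add_divide_distrib diff_divide_distrib)
qed

text \<open>
  By \<open>levy_integrand_second_difference\<close> the exponents determine the characteristic functions of the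
  finite measures with density \<open>\<kappa> u y = 1 - cos (u * y s)\<close> with respect to the trajectory law.
  On \<open>{\<bar>y s\<bar> \<le> n, y s \<noteq> 0}\<close> the density with \<open>u = 1 / (n + 1)\<close> is positive and can be divided out;
  these sets exhaust \<open>{y s \<noteq> 0}\<close>.
\<close>

lemma levy_exponent_determines_law:
  fixes G :: "'i set"
  assumes f: "\<forall>t\<in>G. f t \<in> L_sum \<mu>" and g: "\<forall>t\<in>G. g t \<in> L_sum \<nu>"
    and eq: "\<And>I \<theta>. finite I \<Longrightarrow> I \<subseteq> G \<Longrightarrow>
       \<i> * complex_of_real (\<Sum>t\<in>I. \<theta> t * c t) + (CLINT x|\<mu>. levy_integrand I \<theta> (\<lambda>t. f t x)) =
       \<i> * complex_of_real (\<Sum>t\<in>I. \<theta> t * d t) + (CLINT x|\<nu>. levy_integrand I \<theta> (\<lambda>t. g t x))"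
    and s: "s \<in> G" and C: "C \<in> sets (path_space G)" "C \<subseteq> {y. y s \<noteq> 0}"
  shows "emeasure (path_law G \<mu> f) C = emeasure (path_law G \<nu> g) C"
proof -
  have fm: "\<forall>t\<in>G. f t \<in> borel_measurable \<mu>" and gm: "\<forall>t\<in>G. g t \<in> borel_measurable \<nu>"
    using f g by (auto simp: L_sum_def)
  have sets_law[simp, measurable_cong]: "sets (path_law G \<rho> h) = sets (path_space G)" for \<rho> :: "'x measure" and h
    by (simp add: path_law_def)
  have sm[measurable]: "(\<lambda>y. y s) \<in> borel_measurable (path_space G)" by (rule measurable_component_singleton[OF s])
  define \<kappa> where "\<kappa> u y = 1 - cos (u * y s)" for u and y :: "'i \<Rightarrow> real"
  have kpos: "0 \<le> \<kappa> u y" for u y by (simp add: \<kappa>_def)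
  have km[measurable]: "\<kappa> u \<in> borel_measurable (path_space G)" for u unfolding \<kappa>_def[abs_def] by measurable
  have km_law: "\<kappa> u \<in> borel_measurable (path_law G \<rho> h)" for u and \<rho> :: "'x measure" and h
    using km[of u] by (simp add: path_law_def)
  have diff: "(\<i> * complex_of_real (\<Sum>t\<in>I. \<theta> t * b t) + (CLINT x|\<rho>. levy_integrand I \<theta> (\<lambda>t. h t x)))
      - ((\<i> * complex_of_real (\<Sum>t\<in>I. (\<theta>(s := \<theta> s + u)) t * b t) + (CLINT x|\<rho>. levy_integrand I (\<theta>(s := \<theta> s + u)) (\<lambda>t. h t x)))
        + (\<i> * complex_of_real (\<Sum>t\<in>I. (\<theta>(s := \<theta> s + - u)) t * b t) + (CLINT x|\<rho>. levy_integrand I (\<theta>(s := \<theta> s + - u)) (\<lambda>t. h t x)))) / 2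
      = (CLINT x|\<rho>. (1 - cos (u * h s x)) *\<^sub>R iexp (\<Sum>t\<in>I. \<theta> t * h t x))"
    "integrable \<rho> (\<lambda>x. (1 - cos (u * h s x)) *\<^sub>R iexp (\<Sum>t\<in>I. \<theta> t * h t x))"
    if h: "\<forall>t\<in>G. h t \<in> L_sum \<rho>" and I: "finite I" "I \<subseteq> G" "s \<in> I" for \<rho> :: "'x measure" and h b I \<theta> u
  proof -
    have int: "integrable \<rho> (\<lambda>x. levy_integrand I \<theta>' (\<lambda>t. h t x))" for \<theta>'
      by (rule levy_integrand_integrable) (use h I in auto)
    note sd = levy_integrand_second_difference[OF I(1,3), symmetric]
    show "integrable \<rho> (\<lambda>x. (1 - cos (u * h s x)) *\<^sub>R iexp (\<Sum>t\<in>I. \<theta> t * h t x))"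
      unfolding sd[of u "\<lambda>t. h t x" \<theta> for x]
      by (intro Bochner_Integration.integrable_diff integrable_divide_zero Bochner_Integration.integrable_add int)
    have "(CLINT x|\<rho>. (1 - cos (u * h s x)) *\<^sub>R iexp (\<Sum>t\<in>I. \<theta> t * h t x)) =
      (CLINT x|\<rho>. levy_integrand I \<theta> (\<lambda>t. h t x)) -
      ((CLINT x|\<rho>. levy_integrand I (\<theta>(s := \<theta> s + u)) (\<lambda>t. h t x)) + (CLINT x|\<rho>. levy_integrand I (\<theta>(s := \<theta> s + - u)) (\<lambda>t. h t x))) / 2"
      unfolding sd[of u "\<lambda>t. h t x" \<theta> for x]
      by (subst Bochner_Integration.integral_diff)
         (auto intro!: int Bochner_Integration.integrable_add integrable_divide_zero simp: Bochner_Integration.integral_add[OF int int])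
    then show "(\<i> * complex_of_real (\<Sum>t\<in>I. \<theta> t * b t) + (CLINT x|\<rho>. levy_integrand I \<theta> (\<lambda>t. h t x)))
      - ((\<i> * complex_of_real (\<Sum>t\<in>I. (\<theta>(s := \<theta> s + u)) t * b t) + (CLINT x|\<rho>. levy_integrand I (\<theta>(s := \<theta> s + u)) (\<lambda>t. h t x)))
        + (\<i> * complex_of_real (\<Sum>t\<in>I. (\<theta>(s := \<theta> s + - u)) t * b t) + (CLINT x|\<rho>. levy_integrand I (\<theta>(s := \<theta> s + - u)) (\<lambda>t. h t x)))) / 2
      = (CLINT x|\<rho>. (1 - cos (u * h s x)) *\<^sub>R iexp (\<Sum>t\<in>I. \<theta> t * h t x))"
      unfolding sum_fun_upd_add[OF I(1,3)] by (simp add: field_simps)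
  qed
  have fin: "finite_measure (density (path_law G \<rho> h) (\<lambda>y. ennreal (\<kappa> u y)))"
    if h: "\<forall>t\<in>G. h t \<in> L_sum \<rho>" for \<rho> :: "'x measure" and h u
  proof
    have hm: "\<forall>t\<in>G. h t \<in> borel_measurable \<rho>" using h by (auto simp: L_sum_def)
    have "integrable \<rho> (\<lambda>x. (1 - cos (u * h s x)) *\<^sub>R iexp (\<Sum>t\<in>{s}. 0 * h t x))"
      by (rule diff(2)[OF h]) (use s in auto)
    then have "integrable \<rho> (\<lambda>x. Re ((1 - cos (u * h s x)) *\<^sub>R iexp (\<Sum>t\<in>{s}. 0 * h t x)))" by (rule integrable_Re)
    then have "integrable \<rho> (\<lambda>x. 1 - cos (u * h s x))" by simp
    then have "(\<integral>\<^sup>+x. ennreal (1 - cos (u * h s x)) \<partial>\<rho>) < \<infinity>" by (simp add: integrable_iff_bounded)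
    moreover have "emeasure (density (path_law G \<rho> h) (\<lambda>y. ennreal (\<kappa> u y))) (space (density (path_law G \<rho> h) (\<lambda>y. ennreal (\<kappa> u y))))
        = (\<integral>\<^sup>+y. ennreal (\<kappa> u y) \<partial>path_law G \<rho> h)"
    proof -
      have "(\<lambda>y. ennreal (\<kappa> u y)) \<in> borel_measurable (path_law G \<rho> h)"
        using km_law[of u \<rho> h] by (rule measurable_compose) simp
      then show ?thesis
        unfolding space_density by (subst emeasure_density[OF _ sets.top]) (auto intro!: nn_integral_cong)
    qed
    moreover have "\<dots> = (\<integral>\<^sup>+x. ennreal (1 - cos (u * h s x)) \<partial>\<rho>)"
      unfolding path_law_def by (subst nn_integral_distr[OF trajectory_measurable[OF hm]]) (simp_all add: \<kappa>_def trajectory_def s)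
    ultimately show "emeasure (density (path_law G \<rho> h) (\<lambda>y. ennreal (\<kappa> u y))) (space (density (path_law G \<rho> h) (\<lambda>y. ennreal (\<kappa> u y)))) \<noteq> \<infinity>"
      by simp
  qed
  have char_law: "(CLINT y|density (path_law G \<rho> h) (\<lambda>y. ennreal (\<kappa> u y)). iexp (\<Sum>t\<in>I. \<theta> t * y t)) =
      (CLINT x|\<rho>. (1 - cos (u * h s x)) *\<^sub>R iexp (\<Sum>t\<in>I. \<theta> t * h t x))"
    if h: "\<forall>t\<in>G. h t \<in> L_sum \<rho>" and I: "finite I" "I \<subseteq> G" for \<rho> :: "'x measure" and h I \<theta> u
  proof -
    have hm: "\<forall>t\<in>G. h t \<in> borel_measurable \<rho>" using h by (auto simp: L_sum_def)
    have [measurable]: "(\<lambda>y. \<Sum>t\<in>I. \<theta> t * y t) \<in> borel_measurable (path_space G)"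
      by (intro borel_measurable_sum borel_measurable_times borel_measurable_const measurable_component_singleton) (use I in auto)
    have "(CLINT y|density (path_law G \<rho> h) (\<lambda>y. ennreal (\<kappa> u y)). iexp (\<Sum>t\<in>I. \<theta> t * y t)) =
        (CLINT y|path_law G \<rho> h. \<kappa> u y *\<^sub>R iexp (\<Sum>t\<in>I. \<theta> t * y t))"
      by (rule integral_density) (use kpos in \<open>measurable, auto\<close>)
    also have "\<dots> = (CLINT x|\<rho>. \<kappa> u (trajectory G h x) *\<^sub>R iexp (\<Sum>t\<in>I. \<theta> t * trajectory G h x t))"
      unfolding path_law_def by (rule integral_distr[OF trajectory_measurable[OF hm]]) measurable
    also have "\<dots> = (CLINT x|\<rho>. (1 - cos (u * h s x)) *\<^sub>R iexp (\<Sum>t\<in>I. \<theta> t * h t x))"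
    proof -
      have "(\<Sum>t\<in>I. \<theta> t * trajectory G h x t) = (\<Sum>t\<in>I. \<theta> t * h t x)" for x
        by (rule sum.cong) (use I in \<open>auto simp: trajectory_def\<close>)
      then show ?thesis by (simp add: \<kappa>_def trajectory_def s)
    qed
    finally show ?thesis .
  qed
  have dens: "density (path_law G \<mu> f) (\<lambda>y. ennreal (\<kappa> u y)) = density (path_law G \<nu> g) (\<lambda>y. ennreal (\<kappa> u y))" for u
  proof (rule finite_measure_PiM_char_unique[OF fin[OF f] fin[OF g]])
    fix I and \<theta> :: "'i \<Rightarrow> real" assume I: "finite I" "I \<subseteq> G"
    \<comment> \<open>Padding the frequencies by zero, so that \<open>s\<close> may be assumed to be among the indices.\<close>
    define \<theta>' where "\<theta>' t = (if t \<in> I then \<theta> t else 0)" for t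
    have I': "finite (insert s I)" "insert s I \<subseteq> G" using I s by auto
    have ext: "(\<Sum>t\<in>insert s I. \<theta>' t * z t) = (\<Sum>t\<in>I. \<theta> t * z t)" for z :: "'i \<Rightarrow> real"
      by (rule sum.mono_neutral_cong_right) (use I in \<open>auto simp: \<theta>'_def\<close>)
    have "(CLINT x|\<mu>. (1 - cos (u * f s x)) *\<^sub>R iexp (\<Sum>t\<in>insert s I. \<theta>' t * f t x)) =
        (CLINT x|\<nu>. (1 - cos (u * g s x)) *\<^sub>R iexp (\<Sum>t\<in>insert s I. \<theta>' t * g t x))"
      unfolding diff(1)[OF f I' insertI1, of \<theta>' c u, symmetric] diff(1)[OF g I' insertI1, of \<theta>' d u, symmetric] eq[OF I'] ..
    then show "(CLINT y|density (path_law G \<mu> f) (\<lambda>y. ennreal (\<kappa> u y)). iexp (\<Sum>t\<in>I. \<theta> t * y t)) =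
        (CLINT y|density (path_law G \<nu> g) (\<lambda>y. ennreal (\<kappa> u y)). iexp (\<Sum>t\<in>I. \<theta> t * y t))"
      unfolding ext char_law[OF f I] char_law[OF g I] .
  qed simp_all
  define Q where "Q n = {y\<in>C. \<bar>y s\<bar> \<le> real n}" for n
  have Q: "Q n \<in> sets (path_space G)" for n
  proof -
    have "{y\<in>space (path_space G). \<bar>y s\<bar> \<le> real n} \<inter> C \<in> sets (path_space G)" using C(1) by measurable
    also have "{y\<in>space (path_space G). \<bar>y s\<bar> \<le> real n} \<inter> C = Q n" using sets.sets_into_space[OF C(1)] by (auto simp: Q_def)
    finally show ?thesis .
  qed
  have Q_eq: "emeasure (path_law G \<rho> h) (Q n) = (\<integral>\<^sup>+y. ennreal (1 / \<kappa> (1 / Suc n) y) * indicator (Q n) y \<partial>density (path_law G \<rho> h) (\<lambda>y. ennreal (\<kappa> (1 / Suc n) y)))"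
    for \<rho> :: "'x measure" and h n
  proof -
    have "(\<integral>\<^sup>+y. ennreal (1 / \<kappa> (1 / Suc n) y) * indicator (Q n) y \<partial>density (path_law G \<rho> h) (\<lambda>y. ennreal (\<kappa> (1 / Suc n) y)))
      = (\<integral>\<^sup>+y. ennreal (\<kappa> (1 / Suc n) y) * (ennreal (1 / \<kappa> (1 / Suc n) y) * indicator (Q n) y) \<partial>path_law G \<rho> h)"
      by (rule nn_integral_density) (use Q[of n] in measurable)
    also have "\<dots> = (\<integral>\<^sup>+y. indicator (Q n) y \<partial>path_law G \<rho> h)"
    proof (rule nn_integral_cong)
      fix y
      show "ennreal (\<kappa> (1 / Suc n) y) * (ennreal (1 / \<kappa> (1 / Suc n) y) * indicator (Q n) y) = indicator (Q n) y"
      proof (cases "y \<in> Q n")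
        case True
        then have y: "y s \<noteq> 0" "\<bar>y s\<bar> \<le> real n" using C(2) by (auto simp: Q_def)
        have "\<bar>1 / Suc n * y s\<bar> \<le> 1" using y(2) by (simp add: abs_mult field_simps)
        then have "\<bar>1 / Suc n * y s\<bar> \<le> pi" using pi_gt3 by linarith
        moreover have "0 < \<bar>1 / Suc n * y s\<bar>" using y(1) by simp
        ultimately have "cos \<bar>1 / Suc n * y s\<bar> < cos 0" by (intro cos_monotone_0_pi) auto
        then have "\<kappa> (1 / Suc n) y > 0" unfolding \<kappa>_def cos_abs_real by simp
        then show ?thesis using True by (simp add: ennreal_mult[symmetric])
      qed simp
    qed
    also have "\<dots> = emeasure (path_law G \<rho> h) (Q n)" using Q by simp
    finally show ?thesis by simp
  qed
  have "incseq Q"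
  proof (rule incseq_SucI, rule subsetI)
    fix n y assume "y \<in> Q n"
    then show "y \<in> Q (Suc n)" by (auto simp: Q_def)
  qed
  have UN: "(\<Union>n. Q n) = C" by (auto simp: Q_def real_arch_simple)
  have lim: "(\<lambda>n. emeasure (path_law G \<rho> h) (Q n)) \<longlonglongrightarrow> emeasure (path_law G \<rho> h) C" for \<rho> :: "'x measure" and h
    using Lim_emeasure_incseq[of Q "path_law G \<rho> h"] Q \<open>incseq Q\<close> UN by auto
  have "emeasure (path_law G \<mu> f) (Q n) = emeasure (path_law G \<nu> g) (Q n)" for n
    unfolding Q_eq dens ..
  then have "(\<lambda>n. emeasure (path_law G \<mu> f) (Q n)) \<longlonglongrightarrow> emeasure (path_law G \<nu> g) C"
    using lim[of \<nu> g] by presburger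
  with lim[of \<mu> f] show ?thesis by (rule LIMSEQ_unique)
qed

section \<open>Isomorphism of minimal flow representations\<close>

lemma index_group_closed:
  assumes "T = \<int> \<or> T = UNIV"
  shows "0 \<in> index_group T" "s \<in> index_group T \<Longrightarrow> t \<in> index_group T \<Longrightarrow> s + t \<in> index_group T"
  using assms by (auto simp: index_group_def)

text \<open>
  The isomorphism of the underlying representations is equivariant and unique by
  \<open>minimal_separates\<close>: commuting with the flows and intertwining \<open>f 0\<close> with \<open>g 0\<close> is the same as
  intertwining all coordinates \<open>f t\<close> with \<open>g t\<close>.
\<close>

lemma minimal_flow_rep_iso:
  fixes G :: "'i::comm_monoid_add set"
  assumes G: "0 \<in> G" "\<And>s t. s \<in> G \<Longrightarrow> t \<in> G \<Longrightarrow> s + t \<in> G"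
    and borel: "sigma_finite_borel_space \<mu>" "sigma_finite_borel_space \<nu>"
    and flow: "measure_preserving_flow G \<mu> S" "measure_preserving_flow G \<nu> R"
    and f: "\<forall>t\<in>G. f t \<in> borel_measurable \<mu>" and g: "\<forall>t\<in>G. g t \<in> borel_measurable \<nu>"
    and m: "minimal G \<mu> f" "minimal G \<nu> g"
    and fS: "\<forall>t\<in>G. AE x in \<mu>. f t x = f 0 (S t x)" and gR: "\<forall>t\<in>G. AE z in \<nu>. g t z = g 0 (R t z)"
    and law: "path_law G \<mu> f = path_law G \<nu> g"
  shows "(\<exists>\<Phi>. flow_rep_iso G \<mu> (f 0) S \<nu> (g 0) R \<Phi>) \<and>
         (\<forall>\<Phi> \<Psi>. flow_rep_iso G \<mu> (f 0) S \<nu> (g 0) R \<Phi> \<and> flow_rep_iso G \<mu> (f 0) S \<nu> (g 0) R \<Psi>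
                 \<longrightarrow> (AE x in \<mu>. \<Phi> x = \<Psi> x))"
proof (intro conjI allI impI)
  have S: "nonsingular \<mu> \<mu> (S t)" if "t \<in> G" for t
    using flow(1) that by (auto simp: measure_preserving_flow_def intro: iso_mod_null_nonsingular)
  have R: "nonsingular \<nu> \<nu> (R t)" if "t \<in> G" for t
    using flow(2) that by (auto simp: measure_preserving_flow_def intro: iso_mod_null_nonsingular)
  have shift_f: "AE x in \<mu>. f s (S t x) = f (s + t) x" if s: "s \<in> G" and t: "t \<in> G" for s t
  proof -
    have "AE x in \<mu>. S s (S t x) = S (s + t) x" using flow(1) s t by (simp add: measure_preserving_flow_def)
    with nonsingularD[OF S[OF t] bspec[OF fS s]] bspec[OF fS G(2)[OF s t]]
    show ?thesis by eventually_elim simp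
  qed
  have shift_g: "AE z in \<nu>. g s (R t z) = g (s + t) z" if s: "s \<in> G" and t: "t \<in> G" for s t
  proof -
    have "AE z in \<nu>. R s (R t z) = R (s + t) z" using flow(2) s t by (simp add: measure_preserving_flow_def)
    with nonsingularD[OF R[OF t] bspec[OF gR s]] bspec[OF gR G(2)[OF s t]]
    show ?thesis by eventually_elim simp
  qed
  obtain \<Phi> where iso: "iso_mod_null \<mu> \<nu> \<Phi>" and \<Phi>: "\<And>t. t \<in> G \<Longrightarrow> AE x in \<mu>. f t x = g t (\<Phi> x)"
    using path_law_determines_minimal[OF borel f g m law] by metis
  have ns: "nonsingular \<mu> \<nu> \<Phi>" by (rule iso_mod_null_nonsingular[OF iso])
  have "AE x in \<mu>. \<Phi> (S t x) = R t (\<Phi> x)" if t: "t \<in> G" for t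
  proof (rule minimal_separates[OF borel(2) g m(2) nonsingular_comp[OF S[OF t] ns] nonsingular_comp[OF ns R[OF t]]])
    fix s assume s: "s \<in> G"
    from nonsingularD[OF S[OF t] \<Phi>[OF s]] shift_f[OF s t] \<Phi>[OF G(2)[OF s t]] nonsingularD[OF ns shift_g[OF s t]]
    show "AE x in \<mu>. g s (\<Phi> (S t x)) = g s (R t (\<Phi> x))" by eventually_elim simp
  qed
  then have "flow_rep_iso G \<mu> (f 0) S \<nu> (g 0) R \<Phi>"
    unfolding flow_rep_iso_def using iso \<Phi>[OF G(1)] by blast
  then show "\<exists>\<Phi>. flow_rep_iso G \<mu> (f 0) S \<nu> (g 0) R \<Phi>" by blast
next
  fix \<Phi> \<Psi> assume *: "flow_rep_iso G \<mu> (f 0) S \<nu> (g 0) R \<Phi> \<and> flow_rep_iso G \<mu> (f 0) S \<nu> (g 0) R \<Psi>"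
  have coord: "AE x in \<mu>. g t (\<Xi> x) = f t x" if \<Xi>: "flow_rep_iso G \<mu> (f 0) S \<nu> (g 0) R \<Xi>" and t: "t \<in> G" for \<Xi> t
  proof -
    have iso: "iso_mod_null \<mu> \<nu> \<Xi>" and f0: "AE x in \<mu>. f 0 x = g 0 (\<Xi> x)"
      and eqv: "AE x in \<mu>. \<Xi> (S t x) = R t (\<Xi> x)"
      using \<Xi> t by (auto simp: flow_rep_iso_def)
    have St: "nonsingular \<mu> \<mu> (S t)"
      using flow(1) t by (auto simp: measure_preserving_flow_def intro: iso_mod_null_nonsingular)
    from nonsingularD[OF iso_mod_null_nonsingular[OF iso] bspec[OF gR t]] eqv nonsingularD[OF St f0] bspec[OF fS t]
    show ?thesis by eventually_elim simp
  qed
  have iso: "iso_mod_null \<mu> \<nu> \<Phi>" "iso_mod_null \<mu> \<nu> \<Psi>" using * by (auto simp: flow_rep_iso_def)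
  show "AE x in \<mu>. \<Phi> x = \<Psi> x"
  proof (rule minimal_separates[OF borel(2) g m(2) iso_mod_null_nonsingular[OF iso(1)] iso_mod_null_nonsingular[OF iso(2)]])
    fix t assume t: "t \<in> G"
    from * have "flow_rep_iso G \<mu> (f 0) S \<nu> (g 0) R \<Phi>" "flow_rep_iso G \<mu> (f 0) S \<nu> (g 0) R \<Psi>" by auto
    from coord[OF this(1) t] coord[OF this(2) t]
    show "AE x in \<mu>. g t (\<Phi> x) = g t (\<Psi> x)" by eventually_elim simp
  qed
qed

lemma max_spectral_rep_law_off_zero:
  assumes X: "random_field G M X"
    and ppp1: "poisson_point_process P1 \<mu> J1 U1" and rep1: "max_spectral_rep G M X P1 J1 U1 \<mu> f"
    and ppp2: "poisson_point_process P2 \<nu> J2 U2" and rep2: "max_spectral_rep G M X P2 J2 U2 \<nu> g"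
    and s: "s \<in> G" and C: "C \<in> sets (path_space G)" "C \<subseteq> {y. y s \<noteq> 0}"
  shows "emeasure (path_law G \<mu> f) C = emeasure (path_law G \<nu> g) C"
proof (rule exceedances_determine_law[OF _ _ _ s C])
  show "\<forall>t\<in>G. f t \<in> L_max \<mu>" "\<forall>t\<in>G. g t \<in> L_max \<nu>"
    using rep1 rep2 by (auto simp: max_spectral_rep_def)
  show "emeasure \<mu> {z\<in>space \<mu>. \<exists>t\<in>I. f t z > x t} = emeasure \<nu> {z\<in>space \<nu>. \<exists>t\<in>I. g t z > x t}"
    if "finite I" "I \<subseteq> G" "\<And>t. t \<in> I \<Longrightarrow> x t > 0" for I x
    by (rule max_spectral_rep_exceedance_eq[OF X ppp1 rep1 ppp2 rep2 that])
qed

lemma sum_spectral_rep_law_off_zero: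
  assumes X: "random_field G M X"
    and ppp1: "poisson_point_process P1 \<mu> J1 U1" and rep1: "sum_spectral_rep G M X P1 J1 U1 \<mu> f"
    and ppp2: "poisson_point_process P2 \<nu> J2 U2" and rep2: "sum_spectral_rep G M X P2 J2 U2 \<nu> g"
    and s: "s \<in> G" and C: "C \<in> sets (path_space G)" "C \<subseteq> {y. y s \<noteq> 0}"
  shows "emeasure (path_law G \<mu> f) C = emeasure (path_law G \<nu> g) C"
proof -
  have L: "\<forall>t\<in>G. f t \<in> L_sum \<mu>" "\<forall>t\<in>G. g t \<in> L_sum \<nu>"
    using rep1 rep2 by (auto simp: sum_spectral_rep_def)
  obtain c where c: "\<And>I \<theta>. finite I \<Longrightarrow> I \<subseteq> G \<Longrightarrow> (CLINT y|fdd M X I. iexp (\<Sum>t\<in>I. \<theta> t * y t)) =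
     exp (\<i> * complex_of_real (\<Sum>t\<in>I. \<theta> t * c t) + (CLINT x|\<mu>. levy_integrand I \<theta> (\<lambda>t. f t x)))"
    by (rule sum_spectral_rep_char[OF X ppp1 rep1]) blast
  obtain d where d: "\<And>I \<theta>. finite I \<Longrightarrow> I \<subseteq> G \<Longrightarrow> (CLINT y|fdd M X I. iexp (\<Sum>t\<in>I. \<theta> t * y t)) =
     exp (\<i> * complex_of_real (\<Sum>t\<in>I. \<theta> t * d t) + (CLINT x|\<nu>. levy_integrand I \<theta> (\<lambda>t. g t x)))"
    by (rule sum_spectral_rep_char[OF X ppp2 rep2]) blast
  show ?thesis
  proof (rule levy_exponent_determines_law[OF L _ s C])
    fix I \<theta> assume I: "finite I" "I \<subseteq> G"
    show "\<i> * complex_of_real (\<Sum>t\<in>I. \<theta> t * c t) + (CLINT x|\<mu>. levy_integrand I \<theta> (\<lambda>t. f t x)) =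
       \<i> * complex_of_real (\<Sum>t\<in>I. \<theta> t * d t) + (CLINT x|\<nu>. levy_integrand I \<theta> (\<lambda>t. g t x))"
    proof (rule levy_exponent_unique[OF I(1)])
      show "f t \<in> L_sum \<mu>" "g t \<in> L_sum \<nu>" if "t \<in> I" for t using L I that by auto
      show "exp (\<i> * complex_of_real (\<Sum>t\<in>I. \<theta> t * c t) + (CLINT x|\<mu>. levy_integrand I \<theta> (\<lambda>t. f t x))) =
        exp (\<i> * complex_of_real (\<Sum>t\<in>I. \<theta> t * d t) + (CLINT x|\<nu>. levy_integrand I \<theta> (\<lambda>t. g t x)))" for \<theta>
        unfolding c[OF I, symmetric] d[OF I, symmetric] ..
    qed
  qed
qed

theorem theorem3p5:
  fixes T :: "real set"
    and G :: "(real ^ 'd::finite) set"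
    and M :: "'v measure" and X :: "real ^ 'd \<Rightarrow> 'v \<Rightarrow> real"
    and \<mu>1 :: "'a measure" and P1 :: "'p measure"
    and J1 :: "'p \<Rightarrow> nat set" and U1 :: "nat \<Rightarrow> 'p \<Rightarrow> 'a"
    and f1 :: "'a \<Rightarrow> real" and T1 :: "real ^ 'd \<Rightarrow> 'a \<Rightarrow> 'a"
    and \<mu>2 :: "'b measure" and P2 :: "'q measure"
    and J2 :: "'q \<Rightarrow> nat set" and U2 :: "nat \<Rightarrow> 'q \<Rightarrow> 'b"
    and f2 :: "'b \<Rightarrow> real" and T2 :: "real ^ 'd \<Rightarrow> 'b \<Rightarrow> 'b"
  assumes T: "T = \<int> \<or> T = UNIV"
    and G: "G = index_group T"
    and X: "random_field G M X" "stationary G M X"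
    and cont: "T = UNIV \<Longrightarrow> stochastically_continuous G M X"
    and borel1: "sigma_finite_borel_space \<mu>1"
    and borel2: "sigma_finite_borel_space \<mu>2"
    and ppp1: "poisson_point_process P1 \<mu>1 J1 U1"
    and ppp2: "poisson_point_process P2 \<mu>2 J2 U2"
    and reps:
      "(max_infinitely_divisible G M X \<and> (\<forall>t\<in>G. essinf M (X t) = 0) \<and>
        minimal_flow_rep (max_spectral_rep G M X P1 J1 U1 \<mu>1) G \<mu>1 f1 T1 \<and>
        minimal_flow_rep (max_spectral_rep G M X P2 J2 U2 \<mu>2) G \<mu>2 f2 T2)
     \<or> (infinitely_divisible G M X \<and> without_gaussian_component G M X \<and>
        minimal_flow_rep (sum_spectral_rep G M X P1 J1 U1 \<mu>1) G \<mu>1 f1 T1 \<and>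
        minimal_flow_rep (sum_spectral_rep G M X P2 J2 U2 \<mu>2) G \<mu>2 f2 T2)"
  shows "(\<exists>\<Phi>. flow_rep_iso G \<mu>1 f1 T1 \<mu>2 f2 T2 \<Phi>) \<and>
         (\<forall>\<Phi> \<Psi>. flow_rep_iso G \<mu>1 f1 T1 \<mu>2 f2 T2 \<Phi> \<and> flow_rep_iso G \<mu>1 f1 T1 \<mu>2 f2 T2 \<Psi>
                 \<longrightarrow> (AE x in \<mu>1. \<Phi> x = \<Psi> x))"
proof -
  have G0: "0 \<in> G" and G_add: "\<And>s t. s \<in> G \<Longrightarrow> t \<in> G \<Longrightarrow> s + t \<in> G"
    using index_group_closed[OF T] by (auto simp: G)
  have sf: "sigma_finite_measure \<mu>1" "sigma_finite_measure \<mu>2"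
    using borel1 borel2 by (auto simp: sigma_finite_borel_space_def)
  have flow: "measure_preserving_flow G \<mu>1 T1" "measure_preserving_flow G \<mu>2 T2"
    using reps by (auto simp: minimal_flow_rep_def)
  obtain f g where
    f: "minimal G \<mu>1 f" "f 0 = f1" "\<forall>t\<in>G. AE x in \<mu>1. f t x = f1 (T1 t x)" and
    g: "minimal G \<mu>2 g" "g 0 = f2" "\<forall>t\<in>G. AE x in \<mu>2. g t x = f2 (T2 t x)" and
    rep: "max_spectral_rep G M X P1 J1 U1 \<mu>1 f \<and> max_spectral_rep G M X P2 J2 U2 \<mu>2 g \<or>
      sum_spectral_rep G M X P1 J1 U1 \<mu>1 f \<and> sum_spectral_rep G M X P2 J2 U2 \<mu>2 g"
    using reps unfolding minimal_flow_rep_def by (elim disjE conjE exE) blast+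
  have meas: "\<forall>t\<in>G. f t \<in> borel_measurable \<mu>1" "\<forall>t\<in>G. g t \<in> borel_measurable \<mu>2"
    using rep by (auto simp: max_spectral_rep_def sum_spectral_rep_def L_max_def L_sum_def)
  have off_zero: "emeasure (path_law G \<mu>1 f) C = emeasure (path_law G \<mu>2 g) C"
    if "s \<in> G" "C \<in> sets (path_space G)" "C \<subseteq> {y. y s \<noteq> 0}" for s C
    using rep
  proof
    assume "max_spectral_rep G M X P1 J1 U1 \<mu>1 f \<and> max_spectral_rep G M X P2 J2 U2 \<mu>2 g"
    then show ?thesis using max_spectral_rep_law_off_zero[OF X(1) ppp1 _ ppp2 _ that] by blast
  next
    assume "sum_spectral_rep G M X P1 J1 U1 \<mu>1 f \<and> sum_spectral_rep G M X P2 J2 U2 \<mu>2 g"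
    then show ?thesis using sum_spectral_rep_law_off_zero[OF X(1) ppp1 _ ppp2 _ that] by blast
  qed
  have "path_law G \<mu>1 f = path_law G \<mu>2 g"
    by (rule path_law_eqI[OF sf meas _ _ _ off_zero]) (use f(1) g(1) G0 in \<open>auto simp: minimal_def\<close>)
  from minimal_flow_rep_iso[OF G0 G_add borel1 borel2 flow meas f(1) g(1) _ _ this] f(2,3) g(2,3)
  show ?thesis by simp
qed

end
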